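(* Let $\boldsymbol{Q}=(H_0,H_1,H_2,Q)$ be a Sturm-Liouville problem, with $H_0,H_1,H_2\in\mathbb{R}$ and $Q\in L^2([0,1],\mathbb{R})$. Let $I\subseteq\{1,2\}\times\mathbb{N}$, let $(\omega_{i,n})_{(i,n)\in I}$ be positive real weights, and let $$G(\boldsymbol{q})=\sum_{(i,n)\in I}\omega_{i,n}\,(\lambda_{\boldsymbol{q}_i,n}-\lambda_{\boldsymbol{Q}_i,n})^2 .$$ Let $\boldsymbol{q}_1=(h_0,h_1,q)$ and $\boldsymbol{q}_2=(h_0,h_2,q)$ be two Sturm-Liouville problems, with $h_0,h_1,h_2\in\mathbb{R}$ and $q\in L^2([0,1],\mathbb{R})$, such that $h_1\neq h_2$, and put $\boldsymbol{q}=(h_0,h_1,h_2,q)$. If $I$ is finite or $(\omega_{i,n})_{(i,n)\in I}$ is summable, then the functional $G$ has no local minimum at $\boldsymbol{q}$ with $G(\boldsymbol{q})>0$, i.e. $$\nabla G(\boldsymbol{q})=0\iff G(\boldsymbol{q})=0 .$$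
   Context: Here $\mathbb{N}=\{0,1,2,\dots\}$. For $h_0,h_1,h_2\in\mathbb{R}$ and real $q\in L^2([0,1],\mathbb{R})$, write $\boldsymbol{q}=(h_0,h_1,h_2,q)$, $\boldsymbol{q}_1=(h_0,h_1,q)$ and $\boldsymbol{q}_2=(h_0,h_2,q)$. For $i\in\{1,2\}$, the Sturm-Liouville problem $\boldsymbol{q}_i=(h_0,h_i,q)$ is the eigenvalue problem $$-u''+q(x)u=\lambda u\ \text{ on }[0,1],\qquad h_0u(0)+u'(0)=0,\quad h_iu(1)+u'(1)=0 .$$ Its eigenvalues are real and simple. They are listed in increasing order as $\lambda_{\boldsymbol{q}_i,0}<\lambda_{\boldsymbol{q}_i,1}<\cdots$, and $g_{\boldsymbol{q}_i,n}$ denotes the real eigenfunction for $\lambda_{\boldsymbol{q}_i,n}$ normalized by $\|g_{\boldsymbol{q}_i,n}\|_{L^2}=1$. The same notation is used for $\boldsymbol{Q}=(H_0,H_1,H_2,Q)$, with $\boldsymbol{Q}_1=(H_0,H_1,Q)$ and $\boldsymbol{Q}_2=(H_0,H_2,Q)$. Gradients are taken with respect to $\boldsymbol{q}=(h_0,h_1,h_2,q)$ in the Hilbert space $\mathbb{R}^3\times L^2([0,1],\mathbb{R})$. The gradient of an eigenvalue is $$\nabla\lambda_{\boldsymbol{q}_i,n}=\big(-g_{\boldsymbol{q}_i,n}^2(0),\ g_{\boldsymbol{q}_i,n}^2(1)\,\delta_{i,1},\ g_{\boldsymbol{q}_i,n}^2(1)\,\delta_{i,2},\ g_{\boldsymbol{q}_i,n}^2\big)\in\mathbb{R}^3\times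 L^2([0,1],\mathbb{R}),$$ the components being the derivatives with respect to $h_0$, $h_1$, $h_2$, $q$ respectively. The gradient of $G$ is $$\nabla G(\boldsymbol{q})=2\sum_{(i,n)\in I}\omega_{i,n}(\lambda_{\boldsymbol{q}_i,n}-\lambda_{\boldsymbol{Q}_i,n})\nabla\lambda_{\boldsymbol{q}_i,n}.$$ *)

theory Defs
  imports "HOL-Analysis.Analysis"
begin

section \<open>The Hilbert space \<open>L\<^sup>2([0,1], \<real>)\<close>\<close>

abbreviation unit_lebesgue :: "real measure" where
  "unit_lebesgue \<equiv> lebesgue_on {0..1}"

definition square_integrable :: "(real \<Rightarrow> real) \<Rightarrow> bool" where
  "square_integrable f \<longleftrightarrow>
     f \<in> borel_measurable unit_lebesgue \<and> integrable unit_lebesgue (\<lambda>x. (f x)\<^sup>2)"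

lemma square_integrable_zero: "square_integrable (\<lambda>x. 0)"
  by (simp add: square_integrable_def)

lemma square_integrable_mult:
  assumes "square_integrable f" "square_integrable g"
  shows "integrable unit_lebesgue (\<lambda>x. f x * g x)"
proof (rule Bochner_Integration.integrable_bound)
  show "integrable unit_lebesgue (\<lambda>x. (f x)\<^sup>2 + (g x)\<^sup>2)"
    using assms by (simp add: square_integrable_def)
  show "(\<lambda>x. f x * g x) \<in> borel_measurable unit_lebesgue"
    using assms unfolding square_integrable_def by (intro borel_measurable_times) auto
  have "\<bar>a * b\<bar> \<le> a\<^sup>2 + b\<^sup>2" for a b :: real
  proof -
    have "2 * (\<bar>a\<bar> * \<bar>b\<bar>) \<le> a\<^sup>2 + b\<^sup>2"
      using sum_squares_bound[of "\<bar>a\<bar>" "\<bar>b\<bar>"] by (simp add: mult.assoc)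
    moreover have "0 \<le> \<bar>a\<bar> * \<bar>b\<bar>"
      by simp
    ultimately show ?thesis
      unfolding abs_mult by linarith
  qed
  then show "AE x in unit_lebesgue. norm (f x * g x) \<le> norm ((f x)\<^sup>2 + (g x)\<^sup>2)"
    by (simp del: abs_mult)
qed

lemma square_integrable_add:
  assumes "square_integrable f" "square_integrable g"
  shows "square_integrable (\<lambda>x. f x + g x)"
proof -
  have "integrable unit_lebesgue (\<lambda>x. (f x)\<^sup>2 + (g x)\<^sup>2 + 2 * (f x * g x))"
    using assms square_integrable_mult[OF assms]
    by (simp add: square_integrable_def)
  moreover have "(f x)\<^sup>2 + (g x)\<^sup>2 + 2 * (f x * g x) = (f x + g x)\<^sup>2" for x
    by (simp add: power2_sum)
  moreover have "(\<lambda>x. f x + g x) \<in> borel_measurable unit_lebesgue"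
    using assms unfolding square_integrable_def by (intro borel_measurable_add) auto
  ultimately show ?thesis
    by (simp add: square_integrable_def)
qed

lemma square_integrable_cmult:
  assumes "square_integrable f"
  shows "square_integrable (\<lambda>x. c * f x)"
  using assms unfolding square_integrable_def
  by (auto simp: power_mult_distrib intro!: borel_measurable_times)

definition l2_rel :: "(real \<Rightarrow> real) \<Rightarrow> (real \<Rightarrow> real) \<Rightarrow> bool" where
  "l2_rel f g \<longleftrightarrow>
     square_integrable f \<and> square_integrable g \<and> (AE x in unit_lebesgue. f x = g x)"

lemma l2_rel_part_equivp: "part_equivp l2_rel"
proof (rule part_equivpI)
  show "\<exists>f. l2_rel f f"
    using square_integrable_zero by (auto simp: l2_rel_def)
  show "symp l2_rel"
    by (auto simp: symp_def l2_rel_def eq_commute)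
  show "transp l2_rel"
  proof (rule transpI)
    fix f g h assume fg: "l2_rel f g" and gh: "l2_rel g h"
    have "AE x in unit_lebesgue. f x = g x" "AE x in unit_lebesgue. g x = h x"
      using fg gh by (simp_all add: l2_rel_def)
    then have "AE x in unit_lebesgue. f x = h x"
      by eventually_elim simp
    then show "l2_rel f h"
      using fg gh by (simp add: l2_rel_def)
  qed
qed

quotient_type l2 = "real \<Rightarrow> real" / partial: l2_rel
  by (rule l2_rel_part_equivp)

instantiation l2 :: real_vector
begin

lift_definition zero_l2 :: l2 is "\<lambda>x. 0"
  by (simp add: l2_rel_def square_integrable_zero)

lift_definition plus_l2 :: "l2 \<Rightarrow> l2 \<Rightarrow> l2" is "\<lambda>f g x. f x + g x"
proof -
  fix f f' g g' assume r: "l2_rel f f'" "l2_rel g g'"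
  then have "AE x in unit_lebesgue. f x = f' x" "AE x in unit_lebesgue. g x = g' x"
    by (simp_all add: l2_rel_def)
  then have "AE x in unit_lebesgue. f x + g x = f' x + g' x"
    by eventually_elim simp
  then show "l2_rel (\<lambda>x. f x + g x) (\<lambda>x. f' x + g' x)"
    using r by (simp add: l2_rel_def square_integrable_add)
qed

lift_definition scaleR_l2 :: "real \<Rightarrow> l2 \<Rightarrow> l2" is "\<lambda>c f x. c * f x"
proof -
  fix c :: real and f f' assume r: "l2_rel f f'"
  then have "AE x in unit_lebesgue. f x = f' x"
    by (simp add: l2_rel_def)
  then have "AE x in unit_lebesgue. c * f x = c * f' x"
    by eventually_elim simp
  then show "l2_rel (\<lambda>x. c * f x) (\<lambda>x. c * f' x)"
    using r by (simp add: l2_rel_def square_integrable_cmult)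
qed

definition uminus_l2 :: "l2 \<Rightarrow> l2" where
  "- f = (- 1) *\<^sub>R f" for f :: l2

definition minus_l2 :: "l2 \<Rightarrow> l2 \<Rightarrow> l2" where
  "f - g = f + - g" for f g :: l2

instance
proof
  fix a b c :: l2 and r s :: real
  show "a + b + c = a + (b + c)"
    by transfer (simp add: l2_rel_def square_integrable_add add.assoc)
  show "a + b = b + a"
    by transfer (simp add: l2_rel_def square_integrable_add add.commute)
  show "0 + a = a"
    by transfer (simp add: l2_rel_def)
  show "- a + a = 0"
    unfolding uminus_l2_def
    by transfer (simp add: l2_rel_def square_integrable_zero)
  show "a - b = a + - b"
    by (rule minus_l2_def)
  show "r *\<^sub>R (a + b) = r *\<^sub>R a + r *\<^sub>R b"
    by transfer (simp add: l2_rel_def square_integrable_add square_integrable_cmult distrib_left)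
  show "(r + s) *\<^sub>R a = r *\<^sub>R a + s *\<^sub>R a"
    by transfer (simp add: l2_rel_def square_integrable_add square_integrable_cmult distrib_right)
  show "r *\<^sub>R s *\<^sub>R a = (r * s) *\<^sub>R a"
    by transfer (simp add: l2_rel_def square_integrable_cmult mult.assoc)
  show "1 *\<^sub>R a = a"
    by transfer (simp add: l2_rel_def)
qed

end

instantiation l2 :: real_inner
begin

lift_definition inner_l2 :: "l2 \<Rightarrow> l2 \<Rightarrow> real"
  is "\<lambda>f g. integral\<^sup>L unit_lebesgue (\<lambda>x. f x * g x)"
proof -
  fix f f' g g' assume r: "l2_rel f f'" "l2_rel g g'"
  then have "AE x in unit_lebesgue. f x = f' x" "AE x in unit_lebesgue. g x = g' x"
    by (simp_all add: l2_rel_def)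
  then have "AE x in unit_lebesgue. f x * g x = f' x * g' x"
    by eventually_elim simp
  then show "integral\<^sup>L unit_lebesgue (\<lambda>x. f x * g x) = integral\<^sup>L unit_lebesgue (\<lambda>x. f' x * g' x)"
    using r square_integrable_mult[of f g] square_integrable_mult[of f' g']
    by (intro integral_cong_AE borel_measurable_integrable) (simp_all add: l2_rel_def)
qed

definition norm_l2 :: "l2 \<Rightarrow> real" where
  "norm f = sqrt (inner f f)" for f :: l2

definition sgn_l2 :: "l2 \<Rightarrow> l2" where
  "sgn f = inverse (norm f) *\<^sub>R f" for f :: l2

definition dist_l2 :: "l2 \<Rightarrow> l2 \<Rightarrow> real" where
  "dist f g = norm (f - g)" for f g :: l2

definition uniformity_l2 :: "(l2 \<times> l2) filter" where
  "uniformity_l2 = (INF e\<in>{0<..}. principal {(f, g). dist f g < e})"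

definition open_l2 :: "l2 set \<Rightarrow> bool" where
  "open_l2 U \<longleftrightarrow> (\<forall>f\<in>U. \<forall>\<^sub>F (f', g) in uniformity. f' = f \<longrightarrow> g \<in> U)"

instance
proof
  fix a b c :: l2 and r :: real and U :: "l2 set"
  show "dist a b = norm (a - b)"
    by (rule dist_l2_def)
  show "sgn a = inverse (norm a) *\<^sub>R a"
    by (rule sgn_l2_def)
  show "(uniformity :: (l2 \<times> l2) filter) = (INF e\<in>{0<..}. principal {(x, y). dist x y < e})"
    by (rule uniformity_l2_def)
  show "open U \<longleftrightarrow> (\<forall>x\<in>U. \<forall>\<^sub>F (x', y) in uniformity. x' = x \<longrightarrow> y \<in> U)"
    by (rule open_l2_def)
  show "inner a b = inner b a"
    by transfer (simp add: mult.commute)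
  show "inner (a + b) c = inner a c + inner b c"
    by transfer (simp add: l2_rel_def distrib_right square_integrable_mult)
  show "inner (r *\<^sub>R a) b = r * inner a b"
    by transfer (simp add: mult.assoc)
  show "0 \<le> inner a a"
    by transfer simp
  show "inner a a = 0 \<longleftrightarrow> a = 0"
  proof transfer
    fix f assume "l2_rel f f"
    then have f: "square_integrable f"
      by (simp add: l2_rel_def)
    then have "integrable unit_lebesgue (\<lambda>x. f x * f x)"
      by (simp add: square_integrable_mult)
    then have "integral\<^sup>L unit_lebesgue (\<lambda>x. f x * f x) = 0 \<longleftrightarrow>
        (AE x in unit_lebesgue. f x * f x = 0)"
      by (intro integral_nonneg_eq_0_iff_AE) simp_all
    then show "integral\<^sup>L unit_lebesgue (\<lambda>x. f x * f x) = 0 \<longleftrightarrow> l2_rel f (\<lambda>x. 0)"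
      using f by (simp add: l2_rel_def square_integrable_zero)
  qed
  show "norm a = sqrt (inner a a)"
    by (rule norm_l2_def)
qed

end

section \<open>Sturm-Liouville problems\<close>

text \<open>
  A problem \<open>(h\<^sub>0, h, q)\<close> has boundary coefficient \<open>h\<^sub>0\<close> at \<open>0\<close> and \<open>h\<close> at \<open>1\<close>. A quadruple
  \<open>(h\<^sub>0, h\<^sub>1, h\<^sub>2, q)\<close> is an element of the Hilbert space \<open>\<real>\<^sup>3 \<times> L\<^sup>2\<close>, realised by
  the library's product of inner product spaces.
\<close>

type_synonym sl_problem = "real \<times> real \<times> l2"
type_synonym sl_quad = "real \<times> real \<times> real \<times> l2"

fun sl_sub :: "sl_quad \<Rightarrow> nat \<Rightarrow> sl_problem" where
  "sl_sub (h0, h1, h2, q) i = (h0, if i = 1 then h1 else h2, q)"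

text \<open>
  As \<open>q\<close> is only square integrable, \<open>u\<close> is continuously differentiable with absolutely continuous
  derivative and the equation holds almost everywhere. Absolute continuity of \<open>u'\<close> is expressed by
  saying that \<open>u'\<close> is an indefinite Lebesgue integral; the integrand \<open>u''\<close> is then the almost
  everywhere derivative of \<open>u'\<close>. The choice of the representative of \<open>q\<close> is immaterial. Values of
  \<open>u\<close> outside \<open>[0,1]\<close> are unconstrained.
\<close>

fun sl_eigenfunction :: "sl_problem \<Rightarrow> real \<Rightarrow> (real \<Rightarrow> real) \<Rightarrow> bool" where
  "sl_eigenfunction (h0, h, q) l u \<longleftrightarrow>
     (\<exists>x\<in>{0..1}. u x \<noteq> 0) \<and>
     (\<exists>u' u''.
        (\<forall>x\<in>{0..1}. (u has_real_derivative u' x) (at x within {0..1})) \<and>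
        u'' absolutely_integrable_on {0..1} \<and>
        (\<forall>x\<in>{0..1}. u' x = u' 0 + integral {0..x} u'') \<and>
        (AE x in unit_lebesgue. - u'' x + rep_l2 q x * u x = l * u x) \<and>
        h0 * u 0 + u' 0 = 0 \<and> h * u 1 + u' 1 = 0)"

definition sl_spectrum :: "sl_problem \<Rightarrow> real set" where
  "sl_spectrum P = {l. \<exists>u. sl_eigenfunction P l u}"

text \<open>
  The increasing enumeration from index \<open>0\<close>: the \<open>n\<close>-th eigenvalue is the one with exactly \<open>n\<close>
  eigenvalues below it.
\<close>

definition sl_eigenvalue :: "sl_problem \<Rightarrow> nat \<Rightarrow> real" where
  "sl_eigenvalue P n =
     (THE l. l \<in> sl_spectrum P \<and>
        finite {m \<in> sl_spectrum P. m < l} \<and> card {m \<in> sl_spectrum P. m < l} = n)"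

text \<open>
  Normalization determines the eigenfunction up to sign on \<open>[0,1]\<close>; only its square is used below.
\<close>

definition sl_normalized :: "sl_problem \<Rightarrow> nat \<Rightarrow> real \<Rightarrow> real" where
  "sl_normalized P n =
     (SOME u. sl_eigenfunction P (sl_eigenvalue P n) u \<and> norm (abs_l2 u) = 1)"

section \<open>The functional and the gradients\<close>

definition sl_functional ::
  "(nat \<times> nat) set \<Rightarrow> (nat \<times> nat \<Rightarrow> real) \<Rightarrow> sl_quad \<Rightarrow> sl_quad \<Rightarrow> real" where
  "sl_functional I w Q q =
     (\<Sum>\<^sub>\<infinity>(i, n)\<in>I. w (i, n) *
        (sl_eigenvalue (sl_sub q i) n - sl_eigenvalue (sl_sub Q i) n)\<^sup>2)"

definition grad_eigenvalue :: "sl_quad \<Rightarrow> nat \<Rightarrow> nat \<Rightarrow> sl_quad" where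
  "grad_eigenvalue q i n =
     (let g = sl_normalized (sl_sub q i) n
      in (- ((g 0)\<^sup>2), (g 1)\<^sup>2 * of_bool (i = 1), (g 1)\<^sup>2 * of_bool (i = 2), abs_l2 (\<lambda>x. (g x)\<^sup>2)))"

text \<open>The sum is taken in the norm of \<open>\<real>\<^sup>3 \<times> L\<^sup>2\<close>.\<close>

definition grad_functional ::
  "(nat \<times> nat) set \<Rightarrow> (nat \<times> nat \<Rightarrow> real) \<Rightarrow> sl_quad \<Rightarrow> sl_quad \<Rightarrow> sl_quad" where
  "grad_functional I w Q q =
     2 *\<^sub>R (\<Sum>\<^sub>\<infinity>(i, n)\<in>I.
        (w (i, n) * (sl_eigenvalue (sl_sub q i) n - sl_eigenvalue (sl_sub Q i) n))
          *\<^sub>R grad_eigenvalue q i n)"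

end

theory Submission
  imports Defs
begin

text \<open>
  Both claims rest on directions in the space of quadruples that move one eigenvalue and no other, to
  first order for the gradient and exactly for the local minima. Write \<open>[f, g] = f g' - f' g\<close> for the
  Wronskian.

  Gradient. Let \<open>u\<close> be an eigenfunction of one of the two problems with eigenvalue \<open>l\<close>, and let \<open>v\<close> solve
  the same equation with the right boundary condition of the other problem. For every eigenfunction \<open>f\<close> of
  either problem with eigenvalue \<open>n \<noteq> l\<close>, the function \<open>2 f\<^sup>2 (u v)'\<close> is the derivative of
  \<open>f\<^sup>2 u v + [f, u] [f, v] / (n - l)\<close>. The product of Wronskians vanishes at both ends of the interval, and
  the other term is cancelled by suitable scalar components. So this direction is orthogonal to all eigenvalue gradients
  except that of \<open>l\<close>, where the pairing is a nonzero multiple of \<open>h\<^sub>1 - h\<^sub>2\<close>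
  (\<open>eigenvalue_gradients_biorthogonal\<close>). Pairing the gradient of the functional with these directions shows that
  it vanishes only if every difference of eigenvalues indexed by \<open>I\<close> vanishes.

  Local minima. The same \<open>u\<close> and a solution \<open>v\<close> with that boundary condition at a value \<open>m\<close> near \<open>l\<close> define a double commutation
  \<open>q - 2 (log [v, u])''\<close> of the potential. It transforms all solutions explicitly, and these formulas show that the
  spectrum to which \<open>l\<close> belongs changes only by the replacement of \<open>l\<close> by \<open>m\<close>, while the other one is preserved
  (\<open>single_eigenvalue_movable\<close>). If a term of the functional is positive, moving its eigenvalue towards
  the target decreases this term and keeps all others, by an arbitrarily small change of the problem.

  Spectral theory gives the eigenvalues and the series a meaning. The Pruefer angle at 1 is a strictly increasing
  continuous function of the spectral parameter; it identifies the \<open>n\<close>-th eigenvalue and shows that there is one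
  for every \<open>n\<close> (\<open>sl_eigenvalue_enumerates_spectrum\<close>). The Pruefer angle in the scale of the square root
  of the spectral parameter gives \<open>(n pi)\<^sup>2 + O(1)\<close> for the \<open>n\<close>-th eigenvalue (\<open>sl_eigenvalue_asymptotics\<close>), and an
  energy estimate bounds the normalized eigenfunctions uniformly (\<open>sl_normalized_bounded\<close>). So both
  series converge when \<open>I\<close> is finite or the weights are summable.

  The potential is only square integrable. Its primitive \<open>P\<close> is continuous, and in terms of the
  quasi-derivative \<open>u' - P u\<close> the equation becomes a first-order system with continuous coefficients
  (\<open>sl_eigenfunction_iff_system\<close>), to which everything else refers.
\<close>

section \<open>Real analysis on the unit interval\<close>

lemma unit_interval_mono:
  fixes f f' :: "real \<Rightarrow> real"
  assumes der: "\<And>t. t \<in> {0..1} \<Longrightarrow> (f has_real_derivative f' t) (at t within {0..1})"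
    and nonneg: "\<And>t. t \<in> {0..1} \<Longrightarrow> f' t \<ge> 0"
    and xy: "0 \<le> x" "x \<le> y" "y \<le> 1"
  shows "f x \<le> f y"
proof -
  have "\<exists>t\<in>{x..y}. f y - f x = f' t * (y - x)"
  proof (rule mvt_very_simple)
    fix t assume "x \<le> t" "t \<le> y"
    then have "(f has_real_derivative f' t) (at t within {x..y})"
      using xy by (intro has_field_derivative_subset[OF der]) auto
    then show "(f has_derivative (*) (f' t)) (at t within {x..y})"
      by (simp add: has_field_derivative_def)
  qed (use xy in auto)
  then obtain t where t: "t \<in> {x..y}" "f y - f x = f' t * (y - x)" by blast
  have "f' t * (y - x) \<ge> 0"
    using t nonneg[of t] xy by auto
  then show ?thesis using t by simp
qed

lemma unit_interval_constant:
  fixes f :: "real \<Rightarrow> 'a::real_normed_vector"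
  assumes "\<And>t. t \<in> {0..1} \<Longrightarrow> (f has_vector_derivative 0) (at t within {0..1})"
    and "x \<in> {0..1}"
  shows "f x = f 0"
proof -
  have "\<exists>c. \<forall>t\<in>{0..1}. f t = c"
    using assms(1) by (intro has_derivative_zero_constant) (auto simp: has_vector_derivative_def)
  then show ?thesis using assms(2) by (metis atLeastAtMost_iff order_refl zero_le_one)
qed

lemma has_integral_derivative_unit:
  fixes f f' :: "real \<Rightarrow> real"
  assumes der: "\<And>t. t \<in> {0..1} \<Longrightarrow> (f has_real_derivative f' t) (at t within {0..1})"
    and x: "x \<in> {0..1}"
  shows "(f' has_integral f x - f 0) {0..x}"
proof (rule fundamental_theorem_of_calculus)
  fix t assume "t \<in> {0..x}"
  then show "(f has_vector_derivative f' t) (at t within {0..x})"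
    using x unfolding has_real_derivative_iff_has_vector_derivative[symmetric]
    by (intro has_field_derivative_subset[OF der]) auto
qed (use x in auto)

text \<open>
  The estimate runs in both directions of \<open>x\<close>, so the same lemma propagates bounds from
  either end of the interval and in the interior. With \<open>e = 0\<close> and \<open>E y = 0\<close> it is the uniqueness statement for linear equations.
\<close>

lemma gronwall_two_sided:
  fixes E E' :: "real \<Rightarrow> real"
  assumes der: "\<And>t. t \<in> {0..1} \<Longrightarrow> (E has_real_derivative E' t) (at t within {0..1})"
    and bound: "\<And>t. t \<in> {0..1} \<Longrightarrow> \<bar>E' t\<bar> \<le> K * E t + e"
    and nonneg: "\<And>t. t \<in> {0..1} \<Longrightarrow> E t \<ge> 0"
    and K: "K \<ge> 0" and e: "e \<ge> 0"
    and x: "x \<in> {0..1}" and y: "y \<in> {0..1}"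
  shows "E x \<le> exp K * (E y + e)"
proof (cases "y \<le> x")
  case True
  have "e * y - E y * exp (- K * y) \<le> e * x - E x * exp (- K * x)"
  proof (rule unit_interval_mono[where f = "\<lambda>t. e * t - E t * exp (- K * t)" and x = y and y = x])
    fix t :: real assume t: "t \<in> {0..1}"
    show "((\<lambda>t. e * t - E t * exp (- K * t)) has_real_derivative
        e - (E' t - K * E t) * exp (- K * t)) (at t within {0..1})"
      by (auto intro!: derivative_eq_intros der[OF t] simp: algebra_simps)
    have "(E' t - K * E t) * exp (- K * t) \<le> e * exp (- K * t)"
      using bound[OF t] by (intro mult_right_mono) auto
    also have "\<dots> \<le> e * 1"
      using e K t by (intro mult_left_mono) auto
    finally show "e - (E' t - K * E t) * exp (- K * t) \<ge> 0" by simp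
  qed (use True x y in auto)
  then have "E x * exp (- K * x) \<le> E y * exp (- K * y) + e * (x - y)"
    by (simp add: right_diff_distrib)
  also have "\<dots> \<le> E y * 1 + e * 1"
    using nonneg[OF y] e K x y True by (intro add_mono mult_left_mono) auto
  finally have *: "E x * exp (- K * x) * exp (K * x) \<le> (E y + e) * exp (K * x)"
    by (intro mult_right_mono) auto
  have "E x = E x * exp (- K * x) * exp (K * x)"
    by (simp add: mult.assoc flip: exp_add)
  also note *
  also have "(E y + e) * exp (K * x) \<le> (E y + e) * exp K"
    using nonneg[OF y] e K x by (intro mult_left_mono) (auto simp: mult_left_le)
  finally show ?thesis
    by (simp add: mult.commute)
next
  case False
  have "E x * exp (K * x) + e * exp K * x \<le> E y * exp (K * y) + e * exp K * y"
  proof (rule unit_interval_mono[where f = "\<lambda>t. E t * exp (K * t) + e * exp K * t" and x = x and y = y])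
    fix t :: real assume t: "t \<in> {0..1}"
    show "((\<lambda>t. E t * exp (K * t) + e * exp K * t) has_real_derivative
        (E' t + K * E t) * exp (K * t) + e * exp K) (at t within {0..1})"
      by (auto intro!: derivative_eq_intros der[OF t] simp: algebra_simps)
    have "- e * exp K \<le> - e * exp (K * t)"
      using e K t by (simp add: mult_left_mono mult_left_le)
    also have "\<dots> \<le> (E' t + K * E t) * exp (K * t)"
      using bound[OF t] by (intro mult_right_mono) auto
    finally show "(E' t + K * E t) * exp (K * t) + e * exp K \<ge> 0" by simp
  qed (use False x y in auto)
  then have "E x * exp (K * x) \<le> E y * exp (K * y) + e * exp K * (y - x)"
    by (simp add: algebra_simps)
  also have "\<dots> \<le> E y * exp K + e * exp K * 1"
    using nonneg[OF y] e K x y False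
    by (intro add_mono mult_left_mono) (auto simp: mult_left_le)
  finally have "E x * exp (K * x) \<le> exp K * (E y + e)" by (simp add: algebra_simps)
  moreover have "E x * 1 \<le> E x * exp (K * x)"
    using nonneg[OF x] K x by (intro mult_left_mono) auto
  ultimately show ?thesis by simp
qed

text \<open>
  A crossing principle: a function that can pass zero only upwards stays nonnegative once it
  is. Applied to the difference of a Pruefer angle and a line, it makes the line a barrier.
\<close>

lemma upward_crossing_nonneg:
  fixes f f' :: "real \<Rightarrow> real"
  assumes der: "\<And>t. t \<in> {0..1} \<Longrightarrow> (f has_real_derivative f' t) (at t within {0..1})"
    and up: "\<And>t. t \<in> {0..1} \<Longrightarrow> f t = 0 \<Longrightarrow> f' t > 0"
    and start: "f 0 \<ge> 0" and x: "x \<in> {0..1}"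
  shows "f x \<ge> 0"
proof (rule ccontr)
  assume neg: "\<not> f x \<ge> 0"
  have cont: "continuous_on {0..1} f"
    using der by (intro DERIV_continuous_on)
  define S where "S = {t \<in> {0..x}. f t \<in> {0..}}"
  have "S = {0..x} \<inter> f -` {0..}" by (auto simp: S_def)
  then have "closed S"
    using continuous_on_subset[OF cont, of "{0..x}"] x by (auto intro: continuous_closed_preimage)
  moreover have "S \<noteq> {}" "bdd_above S"
    using start x by (auto simp: S_def)
  ultimately have "Sup S \<in> S" by (rule closed_contains_Sup[rotated 2])
  define s where "s = Sup S"
  have s: "0 \<le> s" "s \<le> x" "f s \<ge> 0"
    using \<open>Sup S \<in> S\<close> by (auto simp: S_def s_def)
  have above: "f t < 0" if "s < t" "t \<le> x" for t
  proof (rule ccontr)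
    assume "\<not> f t < 0"
    then have "t \<in> S" using that s by (simp add: S_def)
    then show False using cSup_upper[of t S] \<open>bdd_above S\<close> that by (simp add: s_def)
  qed
  have "s < x" using s neg by (cases "s = x") auto
  have "f s = 0"
  proof (rule ccontr)
    assume "f s \<noteq> 0"
    then have "f s > 0" using s by simp
    then obtain r where "s \<le> r" "r \<le> x" "f r = 0"
      using IVT2'[of f x 0 s] neg s x continuous_on_subset[OF cont, of "{s..x}"] by auto
    then show False using above[of r] \<open>f s > 0\<close> by (cases "r = s") auto
  qed
  then have "f' s > 0" using up s x by auto
  then obtain d where d: "d > 0" "\<And>h. h > 0 \<Longrightarrow> s + h \<in> {0..1} \<Longrightarrow> h < d \<Longrightarrow> f s < f (s + h)"
    using has_real_derivative_pos_inc_right[OF der[of s]] s x by auto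
  define h where "h = min (x - s) (d / 2)"
  have "h > 0" "h < d" "s + h \<le> x"
    using \<open>s < x\<close> \<open>d > 0\<close> by (auto simp: h_def)
  then show False
    using d(2)[of h] above[of "s + h"] s x \<open>f s = 0\<close> by auto
qed

text \<open>The cosine would vanish at a first point where the angle reaches a right angle.\<close>

lemma angle_difference_lt_half_pi:
  fixes d :: "real \<Rightarrow> real"
  assumes cont: "continuous_on {0..1} d" and start: "\<bar>d 0\<bar> < pi / 2"
    and pos: "\<And>t. t \<in> {0..1} \<Longrightarrow> cos (d t) > 0" and x: "x \<in> {0..1}"
  shows "\<bar>d x\<bar> < pi / 2"
proof (rule ccontr)
  assume "\<not> \<bar>d x\<bar> < pi / 2"
  then obtain r where "0 \<le> r" "r \<le> x" "\<bar>d r\<bar> = pi / 2"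
    using IVT'[of "\<lambda>t. \<bar>d t\<bar>" 0 "pi / 2" x] start x
      continuous_on_subset[OF continuous_on_rabs[OF cont], of "{0..x}"]
    by auto
  moreover from this have "cos (d r) = 0"
    using cos_abs_real[of "d r"] by (simp only: cos_pi_half)
  ultimately show False
    using pos[of r] x by auto
qed

lemma absolutely_integrable_mult_continuous:
  fixes \<rho> f :: "real \<Rightarrow> real"
  assumes "\<rho> absolutely_integrable_on {a..b}" and "continuous_on {a..b} f"
  shows "(\<lambda>t. \<rho> t * f t) absolutely_integrable_on {a..b}"
proof -
  have "(\<lambda>t. f t * \<rho> t) absolutely_integrable_on {a..b}"
    using assms
    by (intro absolutely_integrable_bounded_measurable_product_real)
      (auto intro!: continuous_imp_measurable_on_sets_lebesgue compact_imp_bounded compact_continuous_image)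
  then show ?thesis by (simp add: mult.commute)
qed

text \<open>
  Integration by parts against an indefinite integral of a merely integrable \<open>\<rho>\<close>.
  If \<open>M\<close> bounds \<open>|f'|\<close>, the defect of the formula between \<open>x\<close> and \<open>y\<close> is at most \<open>2 M |y - x|\<close> times the
  integral of \<open>|\<rho>|\<close> over \<open>[x, y]\<close>. That integral tends to 0 as \<open>y\<close> approaches \<open>x\<close>, so the defect has derivative 0
  everywhere and is constant.
\<close>

lemma integral_by_parts_indefinite:
  fixes \<rho> f f' :: "real \<Rightarrow> real"
  assumes int: "\<rho> absolutely_integrable_on {0..1}"
    and der: "\<And>t. t \<in> {0..1} \<Longrightarrow> (f has_real_derivative f' t) (at t within {0..1})"
    and cont: "continuous_on {0..1} f'" and x: "x \<in> {0..1}"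
  shows "integral {0..x} (\<lambda>t. \<rho> t * f t) =
    integral {0..x} \<rho> * f x - integral {0..x} (\<lambda>t. integral {0..t} \<rho> * f' t)"
proof -
  define R where "R = (\<lambda>t. integral {0..t} \<rho>)"
  define V where "V = (\<lambda>t. integral {0..t} (\<lambda>t. \<bar>\<rho> t\<bar>))"
  have rho: "\<rho> integrable_on {0..1}" and abs_rho: "(\<lambda>t. \<bar>\<rho> t\<bar>) integrable_on {0..1}"
    using int by (auto simp: absolutely_integrable_on_def)
  have fcont: "continuous_on {0..1} f" using der by (intro DERIV_continuous_on)
  have Rcont: "continuous_on {0..1} R" and Vcont: "continuous_on {0..1} V"
    unfolding R_def V_def using rho abs_rho by (auto intro: indefinite_integral_continuous_1)
  have rhof: "(\<lambda>t. \<rho> t * f t) integrable_on {0..1}"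
    using absolutely_integrable_mult_continuous[OF int fcont]
    by (simp add: absolutely_integrable_on_def)
  have Rf': "(\<lambda>t. R t * f' t) integrable_on {0..1}"
    using Rcont cont by (intro integrable_continuous_real continuous_intros)
  have "bounded (f' ` {0..1})"
    using cont by (intro compact_imp_bounded compact_continuous_image) auto
  then obtain M where M: "M > 0" "\<And>t. t \<in> {0..1} \<Longrightarrow> \<bar>f' t\<bar> \<le> M"
    unfolding bounded_pos by auto
  define F where "F = (\<lambda>t. R t * f t - integral {0..t} (\<lambda>t. R t * f' t) - integral {0..t} (\<lambda>t. \<rho> t * f t))"
  have split: "integral {0..b} g = integral {0..a} g + integral {a..b} g"
    if "g integrable_on {0..1}" "0 \<le> a" "a \<le> b" "b \<le> 1" for g :: "real \<Rightarrow> real" and a b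
    using that by (subst Henstock_Kurzweil_Integration.integral_combine) (auto intro: integrable_subinterval_real)
  have lip: "\<bar>f b - f a\<bar> \<le> M * (b - a)" if "0 \<le> a" "a \<le> b" "b \<le> 1" for a b
    using field_differentiable_bound[of "{0..1}" f f' M a b] der M that by auto
  have defect: "\<bar>F b - F a\<bar> \<le> 2 * M * (b - a) * (V b - V a)" if ab: "0 \<le> a" "a \<le> b" "b \<le> 1" for a b
  proof -
    have sub: "g integrable_on {a..b}" if "g integrable_on {0..1}" for g :: "real \<Rightarrow> real"
      using that ab by (auto intro: integrable_subinterval_real)
    have ftc: "(f' has_integral (f b - f a)) {a..b}"
      using ab der by (intro fundamental_theorem_of_calculus)
        (auto simp: has_real_derivative_iff_has_vector_derivative intro!: has_vector_derivative_within_subset[of _ _ _ "{0..1}" "{a..b}"])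
    have V: "integral {a..b} (\<lambda>t. \<bar>\<rho> t\<bar>) = V b - V a"
      unfolding V_def using split[OF abs_rho ab] by simp
    have A: "(R b - R a) * f b - integral {a..b} (\<lambda>t. \<rho> t * f t) = integral {a..b} (\<lambda>t. \<rho> t * (f b - f t))"
      using sub[OF rhof] sub[OF rho] split[OF rho ab]
      by (simp add: R_def right_diff_distrib Henstock_Kurzweil_Integration.integral_diff integrable_on_mult_left)
    have B: "R a * (f b - f a) - integral {a..b} (\<lambda>t. R t * f' t) = integral {a..b} (\<lambda>t. (R a - R t) * f' t)"
      using has_integral_diff[OF has_integral_mult_right[OF ftc, of "R a"] integrable_integral[OF sub[OF Rf']]]
      by (simp add: left_diff_distrib integral_unique)
    have "F b - F a = integral {a..b} (\<lambda>t. \<rho> t * (f b - f t)) + integral {a..b} (\<lambda>t. (R a - R t) * f' t)"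
      unfolding F_def A[symmetric] B[symmetric] using split[OF rhof ab] split[OF Rf' ab]
      by (simp add: algebra_simps)
    moreover have "\<bar>integral {a..b} (\<lambda>t. \<rho> t * (f b - f t))\<bar> \<le> integral {a..b} (\<lambda>t. \<bar>\<rho> t\<bar> * (M * (b - a)))"
      unfolding real_norm_def[symmetric]
    proof (rule integral_norm_bound_integral)
      show "(\<lambda>t. \<rho> t * (f b - f t)) integrable_on {a..b}"
        using sub[OF rhof] sub[OF rho]
        by (simp add: right_diff_distrib integrable_diff integrable_on_mult_left)
      show "(\<lambda>t. norm (\<rho> t) * (M * (b - a))) integrable_on {a..b}"
        using integrable_on_mult_left[OF sub[OF abs_rho], of "M * (b - a)"] by simp
      fix t assume t: "t \<in> {a..b}"
      have "\<bar>f b - f t\<bar> \<le> M * (b - t)" using lip[of t b] t ab by auto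
      also have "\<dots> \<le> M * (b - a)" using t M by (auto intro: mult_left_mono)
      finally show "norm (\<rho> t * (f b - f t)) \<le> norm (\<rho> t) * (M * (b - a))"
        by (simp add: abs_mult mult_left_mono)
    qed
    moreover have "\<bar>integral {a..b} (\<lambda>t. (R a - R t) * f' t)\<bar> \<le> integral {a..b} (\<lambda>t. (V b - V a) * M)"
      unfolding real_norm_def[symmetric]
    proof (rule integral_norm_bound_integral)
      show "(\<lambda>t. (R a - R t) * f' t) integrable_on {a..b}"
        using sub[OF Rf'] has_integral_integrable[OF has_integral_mult_right[OF ftc, of "R a"]]
        by (simp add: left_diff_distrib integrable_diff)
      fix t assume t: "t \<in> {a..b}"
      have "R t - R a = integral {a..t} \<rho>"
        unfolding R_def using split[OF rho, of a t] t ab by simp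
      also have "\<bar>\<dots>\<bar> \<le> integral {a..t} (\<lambda>t. \<bar>\<rho> t\<bar>)"
        unfolding real_norm_def[symmetric] using rho abs_rho t ab
        by (intro integral_norm_bound_integral) (auto intro: integrable_subinterval_real)
      also have "\<dots> \<le> V b - V a"
        unfolding V[symmetric] using sub[OF abs_rho] t
        by (intro integral_subset_le) (auto intro: integrable_subinterval_real)
      finally show "norm ((R a - R t) * f' t) \<le> (V b - V a) * M"
        using M(2)[of t] M(1) t ab by (auto simp: abs_mult abs_minus_commute intro!: mult_mono)
    qed auto
    moreover have "integral {a..b} (\<lambda>t. \<bar>\<rho> t\<bar> * (M * (b - a))) = M * (b - a) * (V b - V a)"
      by (simp add: V)
    ultimately show ?thesis using ab by (simp add: algebra_simps)
  qed
  have F0: "F x = F 0"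
  proof (rule unit_interval_constant[OF _ x])
    fix t :: real assume t: "t \<in> {0..1}"
    have "((\<lambda>s. 2 * M * (V s - V t)) \<longlongrightarrow> 2 * M * (V t - V t)) (at t within {0..1})"
      using Vcont t by (intro tendsto_intros) (simp add: continuous_on_def)
    then have lim: "((\<lambda>s. 2 * M * \<bar>V s - V t\<bar>) \<longlongrightarrow> 0) (at t within {0..1})"
      using tendsto_rabs_zero[of "\<lambda>s. 2 * M * (V s - V t)"] M(1) by (simp add: abs_mult)
    have "((\<lambda>s. (F s - F t) / (s - t)) \<longlongrightarrow> 0) (at t within {0..1})"
    proof (rule Lim_null_comparison[OF _ lim])
      show "\<forall>\<^sub>F s in at t within {0..1}. norm ((F s - F t) / (s - t)) \<le> 2 * M * \<bar>V s - V t\<bar>"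
        unfolding eventually_at_filter
      proof (intro always_eventually allI impI)
        fix s assume "s \<noteq> t" "s \<in> {0..1}"
        then have "\<bar>F s - F t\<bar> \<le> (2 * M * \<bar>V s - V t\<bar>) * \<bar>s - t\<bar>"
        proof (cases "t \<le> s")
          case True
          have "\<bar>F s - F t\<bar> \<le> 2 * M * (s - t) * (V s - V t)"
            using defect[of t s] True \<open>s \<in> _\<close> t by simp
          also have "\<dots> \<le> 2 * M * (s - t) * \<bar>V s - V t\<bar>"
            using True M(1) by (intro mult_left_mono) auto
          also have "\<dots> = 2 * M * \<bar>V s - V t\<bar> * \<bar>s - t\<bar>"
            using True by simp
          finally show ?thesis .
        next
          case False
          have "\<bar>F s - F t\<bar> \<le> 2 * M * (t - s) * (V t - V s)"
            using defect[of s t] False \<open>s \<in> _\<close> t by (simp add: abs_minus_commute)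
          also have "\<dots> \<le> 2 * M * (t - s) * \<bar>V s - V t\<bar>"
            using False M(1) by (intro mult_left_mono) auto
          also have "\<dots> = 2 * M * \<bar>V s - V t\<bar> * \<bar>s - t\<bar>"
            using False by simp
          finally show ?thesis .
        qed
        then show "norm ((F s - F t) / (s - t)) \<le> 2 * M * \<bar>V s - V t\<bar>"
          using \<open>s \<noteq> t\<close> by (simp add: divide_le_eq)
      qed
    qed
    then have "(F has_real_derivative 0) (at t within {0..1})"
      by (simp add: has_field_derivative_iff)
    then show "(F has_vector_derivative 0) (at t within {0..1})"
      by (simp add: has_real_derivative_iff_has_vector_derivative)
  qed
  then show ?thesis
    by (simp add: F_def R_def)
qed

text \<open>
  Picard iteration. Successive iterates differ by at most a multiple of \<open>exp (2 M x) / 2 ^ n\<close>: against the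
  weight \<open>exp (2 M x)\<close> each integration gains the factor \<open>1/2\<close>, so the iterates converge
  on the whole interval at once.
\<close>

lemma lipschitz_ode_exists:
  fixes A :: "real \<Rightarrow> 'a::banach \<Rightarrow> 'a" and y0 :: 'a
  assumes cont: "\<And>y. continuous_on {0..1} y \<Longrightarrow> continuous_on {0..1} (\<lambda>t. A t (y t))"
    and lip: "\<And>t a b. t \<in> {0..1} \<Longrightarrow> norm (A t a - A t b) \<le> M * norm (a - b)"
    and M: "M > 0"
  obtains y where "y 0 = y0"
    "\<And>t. t \<in> {0..1} \<Longrightarrow> (y has_vector_derivative A t (y t)) (at t within {0..1})"
proof -
  define Y where "Y = rec_nat (\<lambda>x. y0) (\<lambda>n y x. y0 + integral {0..x} (\<lambda>t. A t (y t)))"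
  have Y0: "Y 0 = (\<lambda>x. y0)" and YS: "Y (Suc n) = (\<lambda>x. y0 + integral {0..x} (\<lambda>t. A t (Y n t)))" for n
    by (simp_all add: Y_def)
  have Ycont: "continuous_on {0..1} (Y n)" for n
  proof (induction n)
    case (Suc n)
    then show ?case unfolding YS
      using cont[OF Suc] by (intro continuous_intros indefinite_integral_continuous_1 integrable_continuous_real)
  qed (simp add: Y0)
  have AYint: "(\<lambda>t. A t (Y n t)) integrable_on {0..x}" if "x \<in> {0..1}" for n x
    using that continuous_on_subset[OF cont[OF Ycont[of n]], of "{0..x}"]
    by (intro integrable_continuous_real) auto
  have "bounded ((\<lambda>t. A t (Y 0 t)) ` {0..1})"
    using cont[OF Ycont[of 0]] by (intro compact_imp_bounded compact_continuous_image) auto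
  then obtain B where B: "B > 0" "\<And>t. t \<in> {0..1} \<Longrightarrow> norm (A t (Y 0 t)) \<le> B"
    unfolding bounded_pos by auto
  have expint: "((\<lambda>t. exp (2 * M * t)) has_integral (exp (2 * M * x) - 1) / (2 * M)) {0..x}"
    if "0 \<le> x" for x
  proof -
    have "((\<lambda>t. exp (2 * M * t)) has_integral exp (2 * M * x) / (2 * M) - exp (2 * M * 0) / (2 * M)) {0..x}"
      using that M by (intro fundamental_theorem_of_calculus)
        (auto intro!: derivative_eq_intros simp flip: has_real_derivative_iff_has_vector_derivative)
    then show ?thesis by (simp add: diff_divide_distrib)
  qed
  have step: "norm (Y (Suc n) x - Y n x) \<le> B * exp (2 * M * x) * (1/2) ^ n" if "x \<in> {0..1}" for n x
    using that
  proof (induction n arbitrary: x)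
    case 0
    have "norm (integral {0..x} (\<lambda>t. A t (Y 0 t))) \<le> integral {0..x} (\<lambda>t. B)"
      using 0 B AYint[OF 0, of 0] by (intro integral_norm_bound_integral) auto
    also have "\<dots> \<le> B * exp (2 * M * x)"
      using 0 B M by (auto simp: mult.commute intro!: mult_left_mono order_trans[of x 1])
    finally show ?case unfolding YS by (simp add: Y0)
  next
    case (Suc n)
    have "Y (Suc (Suc n)) x - Y (Suc n) x = integral {0..x} (\<lambda>t. A t (Y (Suc n) t)) - integral {0..x} (\<lambda>t. A t (Y n t))"
      by (simp add: YS[of "Suc n"]) (simp add: YS)
    also have "\<dots> = integral {0..x} (\<lambda>t. A t (Y (Suc n) t) - A t (Y n t))"
      using Suc.prems by (intro Henstock_Kurzweil_Integration.integral_diff[symmetric] AYint)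
    also have "norm \<dots> \<le> integral {0..x} (\<lambda>t. M * (B * (1/2) ^ n) * exp (2 * M * t))"
    proof (rule integral_norm_bound_integral)
      show "(\<lambda>t. A t (Y (Suc n) t) - A t (Y n t)) integrable_on {0..x}"
        using Suc.prems by (intro integrable_diff AYint)
      show "(\<lambda>t. M * (B * (1/2) ^ n) * exp (2 * M * t)) integrable_on {0..x}"
        using expint[of x] Suc.prems by (intro integrable_on_mult_right) (auto intro: has_integral_integrable)
      fix t assume "t \<in> {0..x}"
      then have t: "t \<in> {0..1}" using Suc.prems by auto
      have "norm (A t (Y (Suc n) t) - A t (Y n t)) \<le> M * norm (Y (Suc n) t - Y n t)"
        by (rule lip[OF t])
      also have "\<dots> \<le> M * (B * exp (2 * M * t) * (1/2) ^ n)"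
        using Suc.IH[OF t] M by (intro mult_left_mono) auto
      finally show "norm (A t (Y (Suc n) t) - A t (Y n t)) \<le> M * (B * (1/2) ^ n) * exp (2 * M * t)"
        by (simp add: mult_ac)
    qed
    also have "\<dots> = M * (B * (1/2) ^ n) * ((exp (2 * M * x) - 1) / (2 * M))"
      using expint[of x] Suc.prems by (simp add: integral_unique)
    also have "\<dots> \<le> B * exp (2 * M * x) * (1/2) ^ Suc n"
      using M B by (simp add: field_simps)
    finally show ?case .
  qed
  define d where "d = (\<lambda>n x. Y (Suc n) x - Y n x)"
  define y where "y = (\<lambda>x. y0 + (\<Sum>n. d n x))"
  have "uniform_limit {0..1} (\<lambda>n x. \<Sum>i<n. d i x) (\<lambda>x. \<Sum>n. d n x) sequentially"
  proof (rule Weierstrass_m_test)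
    fix n x assume x: "x \<in> {0..1::real}"
    have "B * exp (2 * M * x) * (1/2) ^ n \<le> B * exp (2 * M) * (1/2) ^ n"
      using x M B by (intro mult_right_mono mult_left_mono) (auto simp: mult_left_le)
    then show "norm (d n x) \<le> B * exp (2 * M) * (1/2) ^ n"
      using step[OF x, of n] by (simp add: d_def)
  next
    show "summable (\<lambda>n. B * exp (2 * M) * (1 / 2) ^ n)"
      by (intro summable_mult summable_geometric) auto
  qed
  moreover have "Y n x = y0 + (\<Sum>i<n. d i x)" for n x
    unfolding d_def by (subst sum_lessThan_telescope) (simp add: Y0)
  ultimately have lim: "uniform_limit {0..1} Y y sequentially"
    unfolding y_def by (simp add: uniform_limit_iff)
  have ycont: "continuous_on {0..1} y"
    using lim Ycont by (intro uniform_limit_theorem[OF _ lim]) auto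
  have Alim: "uniform_limit {0..1} (\<lambda>n t. A t (Y n t)) (\<lambda>t. A t (y t)) sequentially"
    unfolding uniform_limit_iff
  proof (intro allI impI)
    fix e :: real assume "e > 0"
    then have "\<forall>\<^sub>F n in sequentially. \<forall>x\<in>{0..1}. dist (Y n x) (y x) < e / M"
      using lim M unfolding uniform_limit_iff by simp
    then show "\<forall>\<^sub>F n in sequentially. \<forall>t\<in>{0..1}. dist (A t (Y n t)) (A t (y t)) < e"
    proof (rule eventually_mono, intro ballI)
      fix n t assume "\<forall>x\<in>{0..1}. dist (Y n x) (y x) < e / M" and t: "t \<in> {0..1::real}"
      then have "M * dist (Y n t) (y t) < e"
        using M by (simp add: pos_less_divide_eq mult.commute)
      then show "dist (A t (Y n t)) (A t (y t)) < e"
        using lip[OF t, of "Y n t" "y t"] by (simp add: dist_norm)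
    qed
  qed
  have fix_eq: "y x = y0 + integral {0..x} (\<lambda>t. A t (y t))" if x: "x \<in> {0..1}" for x
  proof (rule LIMSEQ_unique)
    show "(\<lambda>n. Y (Suc n) x) \<longlonglongrightarrow> y x"
      by (rule LIMSEQ_Suc[OF tendsto_uniform_limitI[OF lim x]])
    have "((\<lambda>n. integral {0..x} (\<lambda>t. A t (Y n t))) \<longlongrightarrow> integral {0..x} (\<lambda>t. A t (y t))) sequentially"
    proof -
      have "uniform_limit {0..x} (\<lambda>n t. A t (Y n t)) (\<lambda>t. A t (y t)) sequentially"
        using Alim x by (auto intro: uniform_limit_on_subset)
      moreover have "continuous_on {0..x} (\<lambda>t. A t (Y n t))" for n
        using cont[OF Ycont[of n]] x by (auto intro: continuous_on_subset)
      ultimately obtain I J where IJ: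
        "\<And>n. ((\<lambda>t. A t (Y n t)) has_integral I n) {0..x}" "((\<lambda>t. A t (y t)) has_integral J) {0..x}"
        "(I \<longlongrightarrow> J) sequentially"
        by (rule uniform_limit_integral) auto
      then show ?thesis
        by (simp add: integral_unique[OF IJ(1)] integral_unique[OF IJ(2)])
    qed
    then show "(\<lambda>n. Y (Suc n) x) \<longlonglongrightarrow> y0 + integral {0..x} (\<lambda>t. A t (y t))"
      unfolding YS by (intro tendsto_intros)
  qed
  show thesis
  proof (rule that)
    show "y 0 = y0" using fix_eq[of 0] by simp
    fix t :: real assume t: "t \<in> {0..1}"
    have "((\<lambda>x. y0 + integral {0..x} (\<lambda>t. A t (y t))) has_vector_derivative A t (y t)) (at t within {0..1})"
      using integral_has_vector_derivative[OF cont[OF ycont] t]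
      by (auto intro!: derivative_eq_intros)
    then show "(y has_vector_derivative A t (y t)) (at t within {0..1})"
      by (rule has_vector_derivative_transform[rotated 2]) (use t fix_eq in auto)
  qed
qed

text \<open>
  A planar curve that avoids the origin has a differentiable polar angle: if \<open>L\<close> is the integral
  of \<open>Z'/Z\<close>, starting at \<open>Ln (Z 0)\<close>, then \<open>Z exp (-L)\<close> is constant, and the angle is \<open>Im L\<close>.
\<close>

lemma polar_angle_exists:
  fixes a b a' b' :: "real \<Rightarrow> real"
  assumes a: "\<And>t. t \<in> {0..1} \<Longrightarrow> (a has_real_derivative a' t) (at t within {0..1})"
    and b: "\<And>t. t \<in> {0..1} \<Longrightarrow> (b has_real_derivative b' t) (at t within {0..1})"
    and cont: "continuous_on {0..1} a'" "continuous_on {0..1} b'"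
    and nz: "\<And>t. t \<in> {0..1} \<Longrightarrow> (a t)\<^sup>2 + (b t)\<^sup>2 > 0"
  obtains \<theta> where "\<theta> 0 = Arg (Complex (a 0) (b 0))"
    "\<And>t. t \<in> {0..1} \<Longrightarrow> a t = sqrt ((a t)\<^sup>2 + (b t)\<^sup>2) * cos (\<theta> t)"
    "\<And>t. t \<in> {0..1} \<Longrightarrow> b t = sqrt ((a t)\<^sup>2 + (b t)\<^sup>2) * sin (\<theta> t)"
    "\<And>t. t \<in> {0..1} \<Longrightarrow>
      (\<theta> has_real_derivative (b' t * a t - b t * a' t) / ((a t)\<^sup>2 + (b t)\<^sup>2)) (at t within {0..1})"
proof -
  define Z where "Z = (\<lambda>t. Complex (a t) (b t))"
  define Z' where "Z' = (\<lambda>t. Complex (a' t) (b' t))"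
  have Zder: "(Z has_vector_derivative Z' t) (at t within {0..1})" if "t \<in> {0..1}" for t
    unfolding Z_def Z'_def Complex_eq
    using a[OF that] b[OF that]
    by (auto intro!: derivative_eq_intros has_vector_derivative_of_real
        simp: has_real_derivative_iff_has_vector_derivative[symmetric])
  have normZ: "cmod (Z t) = sqrt ((a t)\<^sup>2 + (b t)\<^sup>2)" for t
    by (simp add: Z_def complex_norm)
  have Znz: "Z t \<noteq> 0" if "t \<in> {0..1}" for t
    using nz[OF that] by (auto simp: Z_def complex_eq_iff)
  have Zcont: "continuous_on {0..1} Z"
    using Zder by (meson continuous_on_eq_continuous_within has_vector_derivative_continuous)
  have Z'cont: "continuous_on {0..1} Z'"
    unfolding Z'_def Complex_eq using cont by (intro continuous_intros)
  define L where "L = (\<lambda>t. Ln (Z 0) + integral {0..t} (\<lambda>s. Z' s / Z s))"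
  have Lder: "(L has_vector_derivative Z' t / Z t) (at t within {0..1})" if "t \<in> {0..1}" for t
    unfolding L_def using that Znz Zcont Z'cont
    by (auto intro!: derivative_eq_intros integral_has_vector_derivative continuous_intros)
  have "Z t * exp (- L t) = Z 0 * exp (- L 0)" if t: "t \<in> {0..1}" for t
  proof (rule unit_interval_constant[OF _ t])
    fix s :: real assume s: "s \<in> {0..1}"
    have "((\<lambda>s. exp (- L s)) has_vector_derivative (- (Z' s / Z s)) * exp (- L s)) (at s within {0..1})"
    proof -
      have "(exp has_field_derivative exp (- L s)) (at (- L s) within (\<lambda>s. - L s) ` {0..1})"
        by (auto intro!: derivative_eq_intros)
      from field_vector_diff_chain_within[OF has_vector_derivative_minus[OF Lder[OF s]] this]
      show ?thesis by (simp add: o_def)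
    qed
    from has_vector_derivative_mult[OF Zder[OF s] this]
    show "((\<lambda>s. Z s * exp (- L s)) has_vector_derivative 0) (at s within {0..1})"
      using Znz[OF s] by simp
  qed
  moreover have "Z 0 * exp (- L 0) = 1"
    using Znz[of 0] by (simp add: L_def exp_minus)
  ultimately have polar: "Z t = exp (L t)" if "t \<in> {0..1}" for t
    using that by (metis exp_minus_inverse mult.commute mult.left_neutral mult_left_cancel exp_not_eq_zero)
  define \<theta> where "\<theta> = (\<lambda>t. Im (L t))"
  have "cmod (Z t) = exp (Re (L t))" if "t \<in> {0..1}" for t
    using polar[OF that] by simp
  then have rep: "Z t = Complex (cmod (Z t) * cos (\<theta> t)) (cmod (Z t) * sin (\<theta> t))" if "t \<in> {0..1}" for t
    using that polar[OF that] by (auto simp: \<theta>_def complex_eq_iff Re_exp Im_exp)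
  show thesis
  proof (rule that)
    show "\<theta> 0 = Arg (Complex (a 0) (b 0))"
      using Znz[of 0] by (simp add: \<theta>_def L_def Z_def Arg_def)
    fix t :: real assume t: "t \<in> {0..1}"
    show "a t = sqrt ((a t)\<^sup>2 + (b t)\<^sup>2) * cos (\<theta> t)" "b t = sqrt ((a t)\<^sup>2 + (b t)\<^sup>2) * sin (\<theta> t)"
      using rep[OF t] by (simp_all add: normZ) (simp_all add: Z_def)
    have "(\<theta> has_vector_derivative Im (Z' t / Z t)) (at t within {0..1})"
      unfolding \<theta>_def using bounded_linear.has_vector_derivative[OF bounded_linear_Im Lder[OF t]] .
    moreover have "Im (Z' t / Z t) = (b' t * a t - b t * a' t) / ((a t)\<^sup>2 + (b t)\<^sup>2)"
      by (simp add: Z_def Z'_def Im_divide algebra_simps)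
    ultimately show "(\<theta> has_real_derivative (b' t * a t - b t * a' t) / ((a t)\<^sup>2 + (b t)\<^sup>2)) (at t within {0..1})"
      by (simp add: has_real_derivative_iff_has_vector_derivative)
  qed
qed

section \<open>Continuous representatives in \<open>L\<^sup>2([0,1])\<close>\<close>

lemma AE_unit_iff_negligible:
  "(AE x in unit_lebesgue. P x) \<longleftrightarrow> negligible {x \<in> {0..1}. \<not> P x}"
proof -
  have "(AE x in unit_lebesgue. P x) \<longleftrightarrow> (AE x in lebesgue. x \<in> {0..1} \<longrightarrow> P x)"
    by (subst AE_restrict_space_iff) auto
  also have "\<dots> \<longleftrightarrow> {x. \<not> (x \<in> {0..1} \<longrightarrow> P x)} \<in> null_sets lebesgue"
    by (subst completion.AE_iff_null_sets) auto
  also have "{x. \<not> (x \<in> {0..1} \<longrightarrow> P x)} = {x \<in> {0..1}. \<not> P x}" by auto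
  finally show ?thesis by (simp add: negligible_iff_null_sets)
qed

lemma square_integrable_continuous:
  assumes "continuous_on {0..1} f" shows "square_integrable f"
proof -
  have "(\<lambda>x. (f x)\<^sup>2) absolutely_integrable_on {0..1}"
    using assms by (intro absolutely_integrable_continuous_real continuous_intros)
  then have "integrable unit_lebesgue (\<lambda>x. (f x)\<^sup>2)"
    by (simp add: integrable_restrict_space set_integrable_def)
  then show ?thesis
    using continuous_imp_measurable_on_sets_lebesgue[OF assms]
    by (simp add: square_integrable_def)
qed

lemma square_integrable_imp_absolutely_integrable:
  assumes "square_integrable f" shows "f absolutely_integrable_on {0..1}"
  using square_integrable_mult[OF assms square_integrable_continuous[of "\<lambda>x. 1"]]
  by (simp add: integrable_restrict_space set_integrable_def)

lemma l2_rel_rep: "l2_rel (rep_l2 q) (rep_l2 q)"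
  using Quotient3_rep_reflp[OF Quotient3_l2] .

lemma square_integrable_rep: "square_integrable (rep_l2 q)"
  using l2_rel_rep by (simp add: l2_rel_def)

lemma abs_l2_rep: "abs_l2 (rep_l2 q) = q"
  using Quotient3_abs_rep[OF Quotient3_l2] .

lemma l2_rel_continuous: "continuous_on {0..1} f \<Longrightarrow> l2_rel f f"
  by (simp add: l2_rel_def square_integrable_continuous)

lemma rep_abs_l2_AE:
  assumes "square_integrable f" shows "AE x in unit_lebesgue. rep_l2 (abs_l2 f) x = f x"
  using Quotient3_rep_abs[OF Quotient3_l2, of f] assms by (simp add: l2_rel_def)

lemma inner_abs_l2_continuous:
  assumes f: "continuous_on {0..1} f" and g: "continuous_on {0..1} g"
  shows "inner (abs_l2 f) (abs_l2 g) = integral {0..1} (\<lambda>x. f x * g x)"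
proof -
  have "inner (abs_l2 f) (abs_l2 g) = integral\<^sup>L unit_lebesgue (\<lambda>x. f x * g x)"
    using l2_rel_continuous[OF f] l2_rel_continuous[OF g] by (rule inner_l2.abs_eq)
  also have "\<dots> = integral {0..1} (\<lambda>x. f x * g x)"
    using square_integrable_mult[OF square_integrable_continuous[OF f] square_integrable_continuous[OF g]]
    by (intro lebesgue_integral_eq_integral) auto
  finally show ?thesis .
qed

lemma norm_abs_l2_continuous:
  "continuous_on {0..1} f \<Longrightarrow> norm (abs_l2 f) = sqrt (integral {0..1} (\<lambda>x. (f x)\<^sup>2))"
  by (simp add: norm_l2_def inner_abs_l2_continuous power2_eq_square)

lemma norm_abs_l2_le:
  assumes f: "continuous_on {0..1} f" and B: "\<And>x. x \<in> {0..1} \<Longrightarrow> \<bar>f x\<bar> \<le> B"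
  shows "norm (abs_l2 f) \<le> B"
proof -
  have "B \<ge> 0" using B[of 0] by simp
  have "integral {0..1} (\<lambda>x. (f x)\<^sup>2) \<le> integral {0..1::real} (\<lambda>x. B\<^sup>2)"
  proof (rule Henstock_Kurzweil_Integration.integral_le)
    show "(\<lambda>x. (f x)\<^sup>2) integrable_on {0..1}"
      using f by (intro integrable_continuous_real continuous_intros)
    show "(f x)\<^sup>2 \<le> B\<^sup>2" if "x \<in> {0..1}" for x
      using B[OF that] \<open>B \<ge> 0\<close> by (simp add: abs_le_square_iff[symmetric])
  qed auto
  then show ?thesis
    using \<open>B \<ge> 0\<close> by (simp add: norm_abs_l2_continuous[OF f] real_le_lsqrt)
qed

lemma abs_l2_add:
  "continuous_on {0..1} f \<Longrightarrow> continuous_on {0..1} g \<Longrightarrow>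
    abs_l2 f + abs_l2 g = abs_l2 (\<lambda>x. f x + g x)"
  by (intro plus_l2.abs_eq l2_rel_continuous)

lemma abs_l2_scaleR: "continuous_on {0..1} f \<Longrightarrow> c *\<^sub>R abs_l2 f = abs_l2 (\<lambda>x. c * f x)"
  by (intro scaleR_l2.abs_eq l2_rel_continuous)

definition primitive :: "l2 \<Rightarrow> real \<Rightarrow> real" where
  "primitive q x = integral {0..x} (rep_l2 q)"

lemma absolutely_integrable_rep: "rep_l2 q absolutely_integrable_on {0..1}"
  by (simp add: square_integrable_imp_absolutely_integrable square_integrable_rep)

lemma primitive_0 [simp]: "primitive q 0 = 0"
  by (simp add: primitive_def)

lemma continuous_on_primitive: "continuous_on {0..1} (primitive q)"
  unfolding primitive_def[abs_def]
  using absolutely_integrable_rep by (intro indefinite_integral_continuous_1) (simp add: absolutely_integrable_on_def)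

lemma primitive_add_continuous:
  assumes f: "continuous_on {0..1} f" and x: "x \<in> {0..1}"
  shows "primitive (q + abs_l2 f) x = primitive q x + integral {0..x} f"
proof -
  have "q + abs_l2 f = abs_l2 (\<lambda>t. rep_l2 q t + f t)"
    using plus_l2.abs_eq[OF l2_rel_rep l2_rel_continuous[OF f], of q] by (simp add: abs_l2_rep)
  moreover have "square_integrable (\<lambda>t. rep_l2 q t + f t)"
    using square_integrable_rep square_integrable_continuous[OF f] by (rule square_integrable_add)
  ultimately have "negligible {t \<in> {0..1}. rep_l2 (q + abs_l2 f) t \<noteq> rep_l2 q t + f t}"
    using rep_abs_l2_AE by (simp add: AE_unit_iff_negligible)
  then have "primitive (q + abs_l2 f) x = integral {0..x} (\<lambda>t. rep_l2 q t + f t)"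
    unfolding primitive_def using x by (rule_tac integral_spike) auto
  also have "\<dots> = primitive q x + integral {0..x} f"
  proof -
    have "rep_l2 q integrable_on {0..x}" "f integrable_on {0..x}"
      using absolutely_integrable_rep[of q] f x
      by (auto simp: absolutely_integrable_on_def intro: integrable_subinterval_real integrable_continuous_real)
    then show ?thesis by (simp add: primitive_def Henstock_Kurzweil_Integration.integral_add)
  qed
  finally show ?thesis .
qed

section \<open>The regularized first-order system\<close>

text \<open>
  With \<open>P\<close> the primitive of the potential \<open>q\<close>, the quasi-derivative \<open>w = u' - P u\<close> of a
  solution of \<open>- u'' + q u = l u\<close> satisfies \<open>w' = - l u - P u'\<close>. This turns the equation into a system
  with continuous coefficients in which \<open>q\<close> no longer occurs, so that all solutions are
  continuously differentiable and classical calculus applies.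
\<close>

definition sl_system :: "(real \<Rightarrow> real) \<Rightarrow> real \<Rightarrow> (real \<Rightarrow> real) \<Rightarrow> (real \<Rightarrow> real) \<Rightarrow> bool" where
  "sl_system P l u w \<longleftrightarrow> (\<forall>x\<in>{0..1}.
     (u has_real_derivative P x * u x + w x) (at x within {0..1}) \<and>
     (w has_real_derivative - (l + (P x)\<^sup>2) * u x - P x * w x) (at x within {0..1}))"

lemma sl_system_deriv:
  assumes "sl_system P l u w" "x \<in> {0..1}"
  shows "(u has_real_derivative P x * u x + w x) (at x within {0..1})"
    and "(w has_real_derivative - (l + (P x)\<^sup>2) * u x - P x * w x) (at x within {0..1})"
  using assms by (auto simp: sl_system_def)

lemma sl_system_continuous:
  assumes "sl_system P l u w"
  shows "continuous_on {0..1} u" "continuous_on {0..1} w"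
  by (rule DERIV_continuous_on, rule sl_system_deriv[OF assms], assumption)+

lemma sl_system_linear:
  assumes "sl_system P l u w" "sl_system P l f g"
  shows "sl_system P l (\<lambda>x. a * u x + b * f x) (\<lambda>x. a * w x + b * g x)"
  unfolding sl_system_def
  by (auto intro!: derivative_eq_intros sl_system_deriv[OF assms(1)] sl_system_deriv[OF assms(2)]
      simp: algebra_simps simp del: atLeastAtMost_iff)

text \<open>The Wronskian \<open>u f' - u' f\<close> is the same expression in the quasi-derivatives.\<close>

lemma wronskian_deriv:
  assumes "sl_system P l u w" "sl_system P m f g" "x \<in> {0..1}"
  shows "((\<lambda>x. u x * g x - w x * f x) has_real_derivative (l - m) * (u x * f x)) (at x within {0..1})"
  by (auto intro!: derivative_eq_intros sl_system_deriv[OF assms(1,3)] sl_system_deriv[OF assms(2,3)]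
      simp: algebra_simps)

lemma wronskian_constant:
  assumes "sl_system P l u w" "sl_system P l f g" "x \<in> {0..1}"
  shows "u x * g x - w x * f x = u 0 * g 0 - w 0 * f 0"
  using unit_interval_constant[of "\<lambda>x. u x * g x - w x * f x" x] wronskian_deriv[OF assms(1,2)] assms(3)
  by (simp add: has_real_derivative_iff_has_vector_derivative)

lemma greens_identity:
  assumes "sl_system P l u w" "sl_system P m f g" "x \<in> {0..1}"
  shows "((\<lambda>t. (l - m) * (u t * f t)) has_integral
    (u x * g x - w x * f x) - (u 0 * g 0 - w 0 * f 0)) {0..x}"
  by (rule has_integral_derivative_unit[OF wronskian_deriv[OF assms(1,2)] assms(3)])

lemma continuous_bound_unit:
  fixes f :: "real \<Rightarrow> real"
  assumes "continuous_on {0..1} f"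
  obtains B where "B > 0" "\<And>x. x \<in> {0..1} \<Longrightarrow> \<bar>f x\<bar> \<le> B"
proof -
  have "bounded (f ` {0..1})"
    using assms by (intro compact_imp_bounded compact_continuous_image) auto
  then show thesis using that unfolding bounded_pos by auto
qed

text \<open>
  Gronwall's inequality for the squared distance of two solutions. The point \<open>y\<close> of agreement
  is arbitrary, so that the estimate covers solutions prescribed at 0 as well as at 1.
\<close>

lemma sl_system_lipschitz_parameter:
  assumes P: "continuous_on {0..1} P" and fg: "sl_system P m f g"
  shows "\<exists>C>0. \<forall>l u w y x. \<bar>l - m\<bar> \<le> 1 \<longrightarrow> sl_system P l u w \<longrightarrow> y \<in> {0..1} \<longrightarrow>
    u y = f y \<longrightarrow> w y = g y \<longrightarrow> x \<in> {0..1} \<longrightarrow> \<bar>u x - f x\<bar> \<le> C * \<bar>l - m\<bar> \<and> \<bar>w x - g x\<bar> \<le> C * \<bar>l - m\<bar>"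
proof -
  obtain p where p: "p > 0" "\<And>x. x \<in> {0..1} \<Longrightarrow> \<bar>P x\<bar> \<le> p"
    using continuous_bound_unit[OF P] by blast
  obtain F where F: "F > 0" "\<And>x. x \<in> {0..1} \<Longrightarrow> \<bar>f x\<bar> \<le> F"
    using continuous_bound_unit[OF sl_system_continuous(1)[OF fg]] by blast
  define K where "K = 2 * p + 3 + \<bar>m\<bar> + p\<^sup>2"
  have est: "\<bar>u x - f x\<bar> \<le> (F * exp K) * \<bar>l - m\<bar> \<and> \<bar>w x - g x\<bar> \<le> (F * exp K) * \<bar>l - m\<bar>"
    if l: "\<bar>l - m\<bar> \<le> 1" and uw: "sl_system P l u w" and y: "y \<in> {0..1}" "u y = f y" "w y = g y"
      and x: "x \<in> {0..1}" for l u w y x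
  proof -
    define d where "d = (\<lambda>x. u x - f x)"
    define e where "e = (\<lambda>x. w x - g x)"
    define E where "E = (\<lambda>x. (d x)\<^sup>2 + (e x)\<^sup>2)"
    define E' where "E' = (\<lambda>x. 2 * d x * (P x * d x + e x)
      + 2 * e x * (- (l + (P x)\<^sup>2) * d x - P x * e x - (l - m) * f x))"
    have der: "(E has_real_derivative E' t) (at t within {0..1})" if "t \<in> {0..1}" for t
      unfolding E_def E'_def d_def e_def
      by (auto intro!: derivative_eq_intros sl_system_deriv[OF uw that] sl_system_deriv[OF fg that]
          simp: algebra_simps power2_eq_square)
    have bound: "\<bar>E' t\<bar> \<le> K * E t + (l - m)\<^sup>2 * F\<^sup>2" if t: "t \<in> {0..1}" for t
    proof -
      have Psq: "(P t)\<^sup>2 \<le> p\<^sup>2" using p(2)[OF t] p(1) by (simp add: abs_le_square_iff[symmetric])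
      have de: "2 * \<bar>d t * e t\<bar> \<le> E t"
        using sum_squares_bound[of "\<bar>d t\<bar>" "\<bar>e t\<bar>"] by (simp add: E_def abs_mult mult.assoc)
      have "\<bar>1 - l - (P t)\<^sup>2\<bar> \<le> 2 + \<bar>m\<bar> + p\<^sup>2"
        using Psq l zero_le_power2[of "P t"] by linarith
      then have "\<bar>(1 - l - (P t)\<^sup>2) * (2 * (d t * e t))\<bar> \<le> (2 + \<bar>m\<bar> + p\<^sup>2) * E t"
        using de unfolding abs_mult by (intro mult_mono) (auto simp: abs_mult)
      moreover have "\<bar>2 * P t * ((d t)\<^sup>2 - (e t)\<^sup>2)\<bar> \<le> 2 * p * E t"
        using p(2)[OF t] p(1) unfolding abs_mult by (intro mult_mono) (auto simp: E_def abs_le_iff)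
      moreover have "\<bar>2 * (e t * ((l - m) * f t))\<bar> \<le> (e t)\<^sup>2 + (l - m)\<^sup>2 * F\<^sup>2"
      proof -
        have "2 * \<bar>e t\<bar> * \<bar>(l - m) * f t\<bar> \<le> (e t)\<^sup>2 + ((l - m) * f t)\<^sup>2"
          using sum_squares_bound[of "\<bar>e t\<bar>" "\<bar>(l - m) * f t\<bar>"] by simp
        moreover have "((l - m) * f t)\<^sup>2 \<le> (l - m)\<^sup>2 * F\<^sup>2"
          using F(2)[OF t] F(1) unfolding power_mult_distrib
          by (intro mult_left_mono) (auto simp: abs_le_square_iff[symmetric])
        ultimately show ?thesis by (simp add: abs_mult)
      qed
      moreover have "(e t)\<^sup>2 \<le> E t" by (simp add: E_def)
      moreover have "E' t = (1 - l - (P t)\<^sup>2) * (2 * (d t * e t)) + 2 * P t * ((d t)\<^sup>2 - (e t)\<^sup>2)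
          - 2 * (e t * ((l - m) * f t))"
        by (simp add: E'_def algebra_simps power2_eq_square)
      ultimately show ?thesis
        unfolding K_def by (simp add: algebra_simps abs_le_iff)
    qed
    have "E x \<le> exp K * (E y + (l - m)\<^sup>2 * F\<^sup>2)"
      using der bound x y p by (intro gronwall_two_sided[of E E']) (auto simp: E_def K_def)
    also have "E y = 0" using y by (simp add: E_def d_def e_def)
    also have "exp K * (0 + (l - m)\<^sup>2 * F\<^sup>2) \<le> (exp K)\<^sup>2 * ((l - m)\<^sup>2 * F\<^sup>2)"
    proof -
      have "K \<ge> 0" using p by (simp add: K_def)
      then have "exp K * 1 \<le> exp K * exp K" by (intro mult_left_mono) auto
      then have "exp K * ((l - m)\<^sup>2 * F\<^sup>2) \<le> (exp K)\<^sup>2 * ((l - m)\<^sup>2 * F\<^sup>2)"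
        by (intro mult_right_mono) (auto simp: power2_eq_square)
      then show ?thesis by simp
    qed
    also have "\<dots> = ((F * exp K) * \<bar>l - m\<bar>)\<^sup>2"
      by (simp add: power_mult_distrib mult_ac)
    finally have "(d x)\<^sup>2 + (e x)\<^sup>2 \<le> ((F * exp K) * \<bar>l - m\<bar>)\<^sup>2" by (simp add: E_def)
    then have "(d x)\<^sup>2 \<le> ((F * exp K) * \<bar>l - m\<bar>)\<^sup>2" "(e x)\<^sup>2 \<le> ((F * exp K) * \<bar>l - m\<bar>)\<^sup>2"
      using zero_le_power2[of "d x"] zero_le_power2[of "e x"] by linarith+
    then show ?thesis
      using F(1) unfolding d_def e_def by (auto simp flip: abs_le_square_iff)
  qed
  show ?thesis
    by (rule exI[of _ "F * exp K"]) (use F(1) est in auto)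
qed

lemma sl_system_zero: "sl_system P l (\<lambda>x. 0) (\<lambda>x. 0)"
  by (simp add: sl_system_def)

lemma sl_system_unique:
  assumes P: "continuous_on {0..1} P" and "sl_system P l u w" "sl_system P l f g"
    and "y \<in> {0..1}" "u y = f y" "w y = g y" "x \<in> {0..1}"
  shows "u x = f x" "w x = g x"
proof -
  obtain C where lip: "\<forall>l' u w y x. \<bar>l' - l\<bar> \<le> 1 \<longrightarrow> sl_system P l' u w \<longrightarrow> y \<in> {0..1} \<longrightarrow>
    u y = f y \<longrightarrow> w y = g y \<longrightarrow> x \<in> {0..1} \<longrightarrow> \<bar>u x - f x\<bar> \<le> C * \<bar>l' - l\<bar> \<and> \<bar>w x - g x\<bar> \<le> C * \<bar>l' - l\<bar>"
    using sl_system_lipschitz_parameter[OF P assms(3)] by blast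
  from lip[rule_format, of l u w y x] show "u x = f x" "w x = g x" using assms by auto
qed

lemma sl_system_nontrivial:
  assumes P: "continuous_on {0..1} P" and uw: "sl_system P l u w"
    and "y \<in> {0..1}" "(u y)\<^sup>2 + (w y)\<^sup>2 \<noteq> 0" and x: "x \<in> {0..1}"
  shows "(u x)\<^sup>2 + (w x)\<^sup>2 > 0"
proof -
  have "\<not> (u x = 0 \<and> w x = 0)"
    using sl_system_unique[OF P uw sl_system_zero x, of y] assms(3,4) by auto
  then show ?thesis by (simp add: sum_power2_gt_zero_iff)
qed

lemma sl_system_exists_left:
  assumes P: "continuous_on {0..1} P"
  obtains u w where "sl_system P l u w" "u 0 = a" "w 0 = b"
proof -
  obtain p where p: "p > 0" "\<And>x. x \<in> {0..1} \<Longrightarrow> \<bar>P x\<bar> \<le> p"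
    using continuous_bound_unit[OF P] by blast
  define A where "A = (\<lambda>t (z :: real \<times> real). (P t * fst z + snd z, - (l + (P t)\<^sup>2) * fst z - P t * snd z))"
  define M where "M = 2 * p + 1 + \<bar>l\<bar> + p\<^sup>2"
  have "M > 0" using p(1) zero_le_power2[of p] unfolding M_def by linarith
  obtain y where y: "y 0 = (a, b)"
    "\<And>t. t \<in> {0..1} \<Longrightarrow> (y has_vector_derivative A t (y t)) (at t within {0..1})"
  proof (rule lipschitz_ode_exists[of A M "(a, b)"])
    fix y :: "real \<Rightarrow> real \<times> real" assume "continuous_on {0..1} y"
    then show "continuous_on {0..1} (\<lambda>t. A t (y t))"
      unfolding A_def using P by (intro continuous_intros)
  next
    fix t :: real and c d :: "real \<times> real" assume t: "t \<in> {0..1}"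
    define x1 where "x1 = fst c - fst d"
    define x2 where "x2 = snd c - snd d"
    have x12: "\<bar>x1\<bar> \<le> norm (c - d)" "\<bar>x2\<bar> \<le> norm (c - d)"
      using norm_fst_le[of x1 x2] norm_snd_le[of x2 x1]
      by (simp_all add: x1_def x2_def flip: fst_diff snd_diff)
    have "A t c - A t d = (P t * x1 + x2, - (l + (P t)\<^sup>2) * x1 - P t * x2)"
      by (simp add: A_def x1_def x2_def algebra_simps)
    then have "norm (A t c - A t d) \<le> \<bar>P t * x1 + x2\<bar> + \<bar>- (l + (P t)\<^sup>2) * x1 - P t * x2\<bar>"
      using norm_Pair_le[of "P t * x1 + x2" "- (l + (P t)\<^sup>2) * x1 - P t * x2"] by simp
    also have "\<dots> \<le> (\<bar>P t\<bar> * \<bar>x1\<bar> + \<bar>x2\<bar>) + (\<bar>l + (P t)\<^sup>2\<bar> * \<bar>x1\<bar> + \<bar>P t\<bar> * \<bar>x2\<bar>)"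
      unfolding abs_mult[symmetric] by linarith
    also have "\<dots> \<le> (p * norm (c - d) + norm (c - d)) + ((\<bar>l\<bar> + p\<^sup>2) * norm (c - d) + p * norm (c - d))"
    proof -
      have "(P t)\<^sup>2 \<le> p\<^sup>2" using p(2)[OF t] p(1) by (simp add: abs_le_square_iff[symmetric])
      then have "\<bar>l + (P t)\<^sup>2\<bar> \<le> \<bar>l\<bar> + p\<^sup>2" using zero_le_power2[of "P t"] by linarith
      then show ?thesis using x12 p(2)[OF t] by (intro add_mono mult_mono) auto
    qed
    finally show "norm (A t c - A t d) \<le> M * norm (c - d)"
      by (simp add: M_def algebra_simps)
  qed (use \<open>M > 0\<close> in auto)
  show thesis
  proof (rule that[of "\<lambda>t. fst (y t)" "\<lambda>t. snd (y t)"])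
    show "sl_system P l (\<lambda>t. fst (y t)) (\<lambda>t. snd (y t))"
      unfolding sl_system_def has_real_derivative_iff_has_vector_derivative
      using bounded_linear.has_vector_derivative[OF bounded_linear_fst y(2)]
        bounded_linear.has_vector_derivative[OF bounded_linear_snd y(2)]
      by (simp add: A_def)
  qed (simp_all add: y(1))
qed

text \<open>Data at 1 are reached by combining the two fundamental solutions, whose Wronskian is 1.\<close>

lemma sl_system_exists_right:
  assumes P: "continuous_on {0..1} P"
  obtains u w where "sl_system P l u w" "u 1 = a" "w 1 = b"
proof -
  obtain c c' where c: "sl_system P l c c'" "c 0 = 1" "c' 0 = 0"
    by (rule sl_system_exists_left[OF P])
  obtain s s' where s: "sl_system P l s s'" "s 0 = 0" "s' 0 = 1"
    by (rule sl_system_exists_left[OF P])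
  have det: "c 1 * s' 1 - c' 1 * s 1 = 1"
    using wronskian_constant[OF c(1) s(1), of 1] c s by simp
  define \<alpha> \<beta> where "\<alpha> = s' 1 * a - s 1 * b" and "\<beta> = c 1 * b - c' 1 * a"
  show thesis
  proof (rule that)
    show "sl_system P l (\<lambda>x. \<alpha> * c x + \<beta> * s x) (\<lambda>x. \<alpha> * c' x + \<beta> * s' x)"
      by (rule sl_system_linear[OF c(1) s(1)])
    have "\<alpha> * c 1 + \<beta> * s 1 = a * (c 1 * s' 1 - c' 1 * s 1)"
      by (simp add: \<alpha>_def \<beta>_def algebra_simps)
    then show "\<alpha> * c 1 + \<beta> * s 1 = a" using det by simp
    have "\<alpha> * c' 1 + \<beta> * s' 1 = b * (c 1 * s' 1 - c' 1 * s 1)"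
      by (simp add: \<alpha>_def \<beta>_def algebra_simps)
    then show "\<alpha> * c' 1 + \<beta> * s' 1 = b" using det by simp
  qed
qed

text \<open>
  An eigenfunction is a nontrivial solution of the system that satisfies the boundary conditions.
  Both directions rest on integrating \<open>q u\<close> by parts, which replaces the integrable \<open>q\<close> by its
  primitive.
\<close>

lemma sl_eigenfunction_iff_system:
  "sl_eigenfunction (h0, h, q) l u \<longleftrightarrow> (\<exists>x\<in>{0..1}. u x \<noteq> 0) \<and>
    (\<exists>w. sl_system (primitive q) l u w \<and> w 0 = - h0 * u 0 \<and> w 1 = - (h + primitive q 1) * u 1)"
  (is "?L \<longleftrightarrow> ?nz \<and> (\<exists>w. ?R w)")
proof -
  define P where "P = primitive q"
  define r where "r = rep_l2 q"
  have Pcont: "continuous_on {0..1} P" unfolding P_def by (rule continuous_on_primitive)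
  have rint: "r absolutely_integrable_on {0..1}" unfolding r_def by (rule absolutely_integrable_rep)
  have Pint: "P x = integral {0..x} r" for x by (simp add: P_def primitive_def r_def)
  \<comment> \<open>the integrated equation, valid for every continuously differentiable \<open>u\<close>\<close>
  have key: "integral {0..x} (\<lambda>t. (r t - l) * u t) = P x * u x - integral {0..x} (\<lambda>t. P t * u' t + l * u t)"
    if der: "\<And>t. t \<in> {0..1} \<Longrightarrow> (u has_real_derivative u' t) (at t within {0..1})"
      and cont: "continuous_on {0..1} u'" and x: "x \<in> {0..1}" for u' x
  proof -
    have ucont: "continuous_on {0..1} u" using der by (intro DERIV_continuous_on)
    have sub: "f integrable_on {0..x}" if "f integrable_on {0..1}" for f :: "real \<Rightarrow> real"
      using that x by (auto intro: integrable_subinterval_real)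
    have ru: "(\<lambda>t. r t * u t) integrable_on {0..x}"
      using absolutely_integrable_mult_continuous[OF rint ucont]
      by (intro sub) (simp add: absolutely_integrable_on_def)
    have lu: "(\<lambda>t. l * u t) integrable_on {0..x}"
      using ucont by (intro sub integrable_continuous_real continuous_intros)
    have Pu: "(\<lambda>t. P t * u' t) integrable_on {0..x}"
      using cont Pcont by (intro sub integrable_continuous_real continuous_intros)
    have "integral {0..x} (\<lambda>t. (r t - l) * u t) = integral {0..x} (\<lambda>t. r t * u t) - integral {0..x} (\<lambda>t. l * u t)"
      using Henstock_Kurzweil_Integration.integral_diff[OF ru lu] by (simp add: left_diff_distrib)
    also have "integral {0..x} (\<lambda>t. r t * u t) = P x * u x - integral {0..x} (\<lambda>t. P t * u' t)"
      unfolding Pint by (rule integral_by_parts_indefinite[OF rint der cont x])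
    finally show ?thesis
      using Henstock_Kurzweil_Integration.integral_add[OF Pu lu] by simp
  qed
  show ?thesis
  proof
    assume ?L
    then have nz: ?nz by simp
    from \<open>?L\<close> obtain u' u'' where
      u'_ball: "\<forall>x\<in>{0..1}. (u has_real_derivative u' x) (at x within {0..1})"
      and u'': "u'' absolutely_integrable_on {0..1}"
      and ind_ball: "\<forall>x\<in>{0..1}. u' x = u' 0 + integral {0..x} u''"
      and ae: "AE x in unit_lebesgue. - u'' x + r x * u x = l * u x"
      and bc: "h0 * u 0 + u' 0 = 0" "h * u 1 + u' 1 = 0"
      unfolding sl_eigenfunction.simps r_def by blast
    have u': "(u has_real_derivative u' x) (at x within {0..1})"
      and ind: "u' x = u' 0 + integral {0..x} u''" if "x \<in> {0..1}" for x
      using that u'_ball ind_ball by blast+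
    have u'cont: "continuous_on {0..1} u'"
    proof -
      have "continuous_on {0..1} (\<lambda>x. u' 0 + integral {0..x} u'')"
        using u'' by (intro continuous_intros indefinite_integral_continuous_1)
          (simp add: absolutely_integrable_on_def)
      then show ?thesis
        by (rule continuous_on_eq) (rule ind[symmetric])
    qed
    define w where "w = (\<lambda>x. u' x - P x * u x)"
    have ucont: "continuous_on {0..1} u" using u' by (intro DERIV_continuous_on)
    have w: "w x = u' 0 - integral {0..x} (\<lambda>t. P t * u' t + l * u t)" if x: "x \<in> {0..1}" for x
    proof -
      have "integral {0..x} u'' = integral {0..x} (\<lambda>t. (r t - l) * u t)"
        using ae x unfolding AE_unit_iff_negligible
        by (rule_tac integral_spike) (auto simp: algebra_simps)
      then show ?thesis using key[OF u' u'cont x] ind[OF x] by (simp add: w_def)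
    qed
    have "(w has_real_derivative - (l + (P x)\<^sup>2) * u x - P x * w x) (at x within {0..1})" if x: "x \<in> {0..1}" for x
    proof -
      have "((\<lambda>x. u' 0 - integral {0..x} (\<lambda>t. P t * u' t + l * u t)) has_real_derivative
          - (P x * u' x + l * u x)) (at x within {0..1})"
        using x u'cont Pcont ucont
        by (auto intro!: derivative_eq_intros integral_has_real_derivative continuous_intros)
      then have "(w has_real_derivative - (P x * u' x + l * u x)) (at x within {0..1})"
        by (rule has_field_derivative_transform_within[of _ _ _ _ 1]) (use x w in auto)
      then show ?thesis by (simp add: w_def algebra_simps power2_eq_square)
    qed
    moreover have "(u has_real_derivative P x * u x + w x) (at x within {0..1})" if "x \<in> {0..1}" for x
      using u'[OF that] by (simp add: w_def)
    ultimately have "sl_system P l u w" by (simp add: sl_system_def)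
    moreover have "w 0 = - h0 * u 0" "w 1 = - (h + P 1) * u 1"
      using bc by (simp_all add: w_def P_def algebra_simps)
    ultimately show "?nz \<and> (\<exists>w. ?R w)" using nz by (auto simp: P_def)
  next
    assume "?nz \<and> (\<exists>w. ?R w)"
    then obtain w where nz: ?nz and sys: "sl_system P l u w"
      and bc: "w 0 = - h0 * u 0" "w 1 = - (h + P 1) * u 1" by (auto simp: P_def)
    define u' where "u' = (\<lambda>x. P x * u x + w x)"
    define u'' where "u'' = (\<lambda>x. (r x - l) * u x)"
    have u': "(u has_real_derivative u' x) (at x within {0..1})" if "x \<in> {0..1}" for x
      using sl_system_deriv(1)[OF sys that] by (simp add: u'_def)
    have ucont: "continuous_on {0..1} u" and wcont: "continuous_on {0..1} w"
      using sl_system_continuous[OF sys] by auto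
    have u'cont: "continuous_on {0..1} u'"
      unfolding u'_def using ucont wcont Pcont by (intro continuous_intros)
    have "(\<lambda>x. l * u x) absolutely_integrable_on {0..1}"
      using ucont by (intro absolutely_integrable_continuous_real continuous_intros)
    then have "(\<lambda>x. r x * u x - l * u x) absolutely_integrable_on {0..1}"
      by (rule set_integral_diff(1)[OF absolutely_integrable_mult_continuous[OF rint ucont]])
    then have "u'' absolutely_integrable_on {0..1}"
      by (simp add: u''_def left_diff_distrib)
    moreover have "u' x = u' 0 + integral {0..x} u''" if x: "x \<in> {0..1}" for x
    proof -
      have "((\<lambda>t. P t * u' t + l * u t) has_integral (- w x) - (- w 0)) {0..x}"
      proof (rule has_integral_derivative_unit[OF _ x])
        fix t :: real assume "t \<in> {0..1}"
        from DERIV_minus[OF sl_system_deriv(2)[OF sys this]]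
        show "((\<lambda>t. - w t) has_real_derivative P t * u' t + l * u t) (at t within {0..1})"
          by (simp add: u'_def algebra_simps power2_eq_square)
      qed
      then show ?thesis
        using key[OF u' u'cont x] by (simp add: u''_def integral_unique u'_def P_def)
    qed
    moreover have "AE x in unit_lebesgue. - u'' x + r x * u x = l * u x"
      by (simp add: u''_def algebra_simps)
    moreover have "h0 * u 0 + u' 0 = 0" "h * u 1 + u' 1 = 0"
      using bc by (simp_all add: u'_def P_def algebra_simps)
    ultimately show ?L
      using nz u' unfolding sl_eigenfunction.simps r_def by blast
  qed
qed

section \<open>The Pruefer angle and the enumeration of the spectrum\<close>

lemma cos_pos_imp_lt_half_pi:
  fixes x :: real
  assumes "\<bar>x\<bar> < pi" "cos x > 0" shows "\<bar>x\<bar> < pi / 2"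
proof (rule ccontr)
  assume "\<not> \<bar>x\<bar> < pi / 2"
  then have "cos \<bar>x\<bar> \<le> cos (pi / 2)"
    using assms(1) by (intro cos_monotone_0_pi_le) auto
  then show False using assms(2) cos_abs_real[of x] by simp
qed

text \<open>
  The angle is attached to the vector \<open>(w, \<sigma> u)\<close>. The scale \<open>\<sigma> = 1\<close> serves for the enumeration of
  the eigenvalues; the scale \<open>\<sigma> = sqrt l\<close> removes the oscillation from the leading term of the angular
  velocity and serves for the asymptotics.
\<close>

lemma pruefer_angle_exists:
  assumes P: "continuous_on {0..1} P" and uw: "sl_system P l u w"
    and nz: "\<And>x. x \<in> {0..1} \<Longrightarrow> (u x)\<^sup>2 + (w x)\<^sup>2 > 0" and \<sigma>: "\<sigma> > 0"
  shows "\<exists>\<theta>. \<theta> 0 = Arg (Complex (w 0) (\<sigma> * u 0)) \<and>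
    (\<forall>x\<in>{0..1}. w x = sqrt ((w x)\<^sup>2 + (\<sigma> * u x)\<^sup>2) * cos (\<theta> x) \<and>
      \<sigma> * u x = sqrt ((w x)\<^sup>2 + (\<sigma> * u x)\<^sup>2) * sin (\<theta> x) \<and>
      (\<theta> has_real_derivative \<sigma> * (cos (\<theta> x))\<^sup>2 + P x * sin (2 * \<theta> x)
        + (l + (P x)\<^sup>2) / \<sigma> * (sin (\<theta> x))\<^sup>2) (at x within {0..1}))"
proof -
  have cont: "continuous_on {0..1} u" "continuous_on {0..1} w"
    using sl_system_continuous[OF uw] by auto
  have pos: "(w x)\<^sup>2 + (\<sigma> * u x)\<^sup>2 > 0" if "x \<in> {0..1}" for x
    using nz[OF that] \<sigma> by (auto simp: sum_power2_gt_zero_iff)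
  obtain \<theta> where \<theta>: "\<theta> 0 = Arg (Complex (w 0) (\<sigma> * u 0))"
    "\<And>x. x \<in> {0..1} \<Longrightarrow> w x = sqrt ((w x)\<^sup>2 + (\<sigma> * u x)\<^sup>2) * cos (\<theta> x)"
    "\<And>x. x \<in> {0..1} \<Longrightarrow> \<sigma> * u x = sqrt ((w x)\<^sup>2 + (\<sigma> * u x)\<^sup>2) * sin (\<theta> x)"
    "\<And>x. x \<in> {0..1} \<Longrightarrow> (\<theta> has_real_derivative
      (\<sigma> * (P x * u x + w x) * w x - \<sigma> * u x * (- (l + (P x)\<^sup>2) * u x - P x * w x))
        / ((w x)\<^sup>2 + (\<sigma> * u x)\<^sup>2)) (at x within {0..1})"
  proof (rule polar_angle_exists[of w "\<lambda>x. - (l + (P x)\<^sup>2) * u x - P x * w x" "\<lambda>x. \<sigma> * u x"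
        "\<lambda>x. \<sigma> * (P x * u x + w x)"])
    show "continuous_on {0..1} (\<lambda>x. - (l + (P x)\<^sup>2) * u x - P x * w x)"
      "continuous_on {0..1} (\<lambda>x. \<sigma> * (P x * u x + w x))"
      using cont P by (auto intro!: continuous_intros)
    fix t :: real assume t: "t \<in> {0..1}"
    show "(w has_real_derivative - (l + (P t)\<^sup>2) * u t - P t * w t) (at t within {0..1})"
      "((\<lambda>x. \<sigma> * u x) has_real_derivative \<sigma> * (P t * u t + w t)) (at t within {0..1})"
      by (intro sl_system_deriv[OF uw t] DERIV_cmult)+
    show "(w t)\<^sup>2 + (\<sigma> * u t)\<^sup>2 > 0" by (rule pos[OF t])
  qed blast
  have "(\<sigma> * (P x * u x + w x) * w x - \<sigma> * u x * (- (l + (P x)\<^sup>2) * u x - P x * w x))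
      / ((w x)\<^sup>2 + (\<sigma> * u x)\<^sup>2) = \<sigma> * (cos (\<theta> x))\<^sup>2 + P x * sin (2 * \<theta> x) + (l + (P x)\<^sup>2) / \<sigma> * (sin (\<theta> x))\<^sup>2"
    if x: "x \<in> {0..1}" for x
  proof -
    define r where "r = sqrt ((w x)\<^sup>2 + (\<sigma> * u x)\<^sup>2)"
    have r: "r > 0" "r\<^sup>2 = (w x)\<^sup>2 + (\<sigma> * u x)\<^sup>2" using pos[OF x] by (auto simp: r_def)
    have w: "w x = r * cos (\<theta> x)" and u: "u x = r * sin (\<theta> x) / \<sigma>"
      using \<theta>(2,3)[OF x, folded r_def] \<sigma> by (simp_all add: eq_divide_eq mult.commute)
    show ?thesis
      unfolding r(2)[symmetric] unfolding w u sin_double using r(1) \<sigma>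
      by (simp add: field_simps power2_eq_square sin_double)
  qed
  then show ?thesis using \<theta> by (intro exI[of _ \<theta>]) auto
qed

locale regular_problem =
  fixes P :: "real \<Rightarrow> real" and h0 k :: real
  assumes cont_P: "continuous_on {0..1} P"
begin

text \<open>
  \<open>U l\<close> and \<open>W l\<close> are the solution that satisfies the left boundary condition, and its
  quasi-derivative; \<open>k\<close> is the right boundary coefficient with respect to the
  quasi-derivative.
\<close>

definition UW :: "real \<Rightarrow> (real \<Rightarrow> real) \<times> (real \<Rightarrow> real)" where
  "UW l = (SOME z. sl_system P l (fst z) (snd z) \<and> fst z 0 = 1 \<and> snd z 0 = - h0)"
definition U where "U l = fst (UW l)"
definition W where "W l = snd (UW l)"

lemma UW: "sl_system P l (U l) (W l)" "U l 0 = 1" "W l 0 = - h0"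
proof -
  obtain u w where "sl_system P l u w" "u 0 = 1" "w 0 = - h0"
    by (rule sl_system_exists_left[OF cont_P])
  then have "\<exists>z. sl_system P l (fst z) (snd z) \<and> fst z 0 = 1 \<and> snd z 0 = - h0"
    by (intro exI[of _ "(u, w)"]) auto
  from someI_ex[OF this] show "sl_system P l (U l) (W l)" "U l 0 = 1" "W l 0 = - h0"
    unfolding U_def W_def UW_def by auto
qed

lemma continuous_UW: "continuous_on {0..1} (U l)" "continuous_on {0..1} (W l)"
  using sl_system_continuous[OF UW(1)] by auto

lemma UW_nonzero:
  assumes "x \<in> {0..1}" shows "(U l x)\<^sup>2 + (W l x)\<^sup>2 > 0"
proof (rule sl_system_nontrivial[OF cont_P UW(1) _ _ assms, of 0])
  have "(U l 0)\<^sup>2 + (W l 0)\<^sup>2 > 0" by (simp add: UW add_pos_nonneg)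
  then show "(U l 0)\<^sup>2 + (W l 0)\<^sup>2 \<noteq> 0" by linarith
qed auto

definition \<rho> where "\<rho> \<sigma> l x = sqrt ((W l x)\<^sup>2 + (\<sigma> * U l x)\<^sup>2)"

definition angle where
  "angle \<sigma> l = (SOME \<theta>. \<theta> 0 = Arg (Complex (W l 0) (\<sigma> * U l 0)) \<and>
    (\<forall>x\<in>{0..1}. W l x = sqrt ((W l x)\<^sup>2 + (\<sigma> * U l x)\<^sup>2) * cos (\<theta> x) \<and>
      \<sigma> * U l x = sqrt ((W l x)\<^sup>2 + (\<sigma> * U l x)\<^sup>2) * sin (\<theta> x) \<and>
      (\<theta> has_real_derivative \<sigma> * (cos (\<theta> x))\<^sup>2 + P x * sin (2 * \<theta> x)
        + (l + (P x)\<^sup>2) / \<sigma> * (sin (\<theta> x))\<^sup>2) (at x within {0..1})))"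

lemma angle:
  assumes "\<sigma> > 0"
  shows "angle \<sigma> l 0 = Arg (Complex (- h0) \<sigma>)"
    and "x \<in> {0..1} \<Longrightarrow> W l x = \<rho> \<sigma> l x * cos (angle \<sigma> l x)"
    and "x \<in> {0..1} \<Longrightarrow> \<sigma> * U l x = \<rho> \<sigma> l x * sin (angle \<sigma> l x)"
    and "x \<in> {0..1} \<Longrightarrow> (angle \<sigma> l has_real_derivative \<sigma> * (cos (angle \<sigma> l x))\<^sup>2
      + P x * sin (2 * angle \<sigma> l x) + (l + (P x)\<^sup>2) / \<sigma> * (sin (angle \<sigma> l x))\<^sup>2) (at x within {0..1})"
  using someI_ex[OF pruefer_angle_exists[OF cont_P UW(1)[of l] UW_nonzero assms]]
  unfolding angle_def[symmetric] \<rho>_def by (auto simp: UW)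

lemma \<rho>_pos: "\<sigma> > 0 \<Longrightarrow> x \<in> {0..1} \<Longrightarrow> \<rho> \<sigma> l x > 0"
  using UW_nonzero[of x l] by (auto simp: \<rho>_def sum_power2_gt_zero_iff)

lemma continuous_angle: "\<sigma> > 0 \<Longrightarrow> continuous_on {0..1} (angle \<sigma> l)"
  by (rule DERIV_continuous_on, rule angle(4), assumption+)

lemma angle_0_bounds: "\<sigma> > 0 \<Longrightarrow> 0 < angle \<sigma> l 0 \<and> angle \<sigma> l 0 < pi"
  by (simp add: angle(1) Arg_lt_pi)

definition \<beta> where "\<beta> \<sigma> = Arg (Complex (- k) \<sigma>)"

lemma \<beta>_bounds: "\<sigma> > 0 \<Longrightarrow> 0 < \<beta> \<sigma> \<and> \<beta> \<sigma> < pi"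
  by (simp add: \<beta>_def Arg_lt_pi)

lemma \<beta>_polar:
  assumes "\<sigma> > 0"
  obtains r where "r > 0" "- k = r * cos (\<beta> \<sigma>)" "\<sigma> = r * sin (\<beta> \<sigma>)"
proof (rule that)
  let ?z = "Complex (- k) \<sigma>"
  have nz: "?z \<noteq> 0" using assms by (auto simp: complex_eq_iff)
  then show "cmod ?z > 0" by simp
  have "rcis (cmod ?z) (Arg ?z) = ?z" by (rule rcis_cmod_Arg)
  then show "- k = cmod ?z * cos (\<beta> \<sigma>)" "\<sigma> = cmod ?z * sin (\<beta> \<sigma>)"
    unfolding \<beta>_def by (metis Re_rcis complex.sel(1), metis Im_rcis complex.sel(2))
qed

definition eigenvalues where "eigenvalues = {l. W l 1 = - k * U l 1}"

lemma eigenvalue_iff_angle: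
  assumes \<sigma>: "\<sigma> > 0"
  shows "l \<in> eigenvalues \<longleftrightarrow> (\<exists>n::int. angle \<sigma> l 1 = \<beta> \<sigma> + of_int n * pi)"
proof -
  obtain r where r: "r > 0" "- k = r * cos (\<beta> \<sigma>)" "\<sigma> = r * sin (\<beta> \<sigma>)"
    by (rule \<beta>_polar[OF \<sigma>])
  have "\<sigma> * (W l 1 + k * U l 1) = W l 1 * \<sigma> - (- k) * (\<sigma> * U l 1)"
    by (simp add: algebra_simps)
  also have "\<dots> = \<rho> \<sigma> l 1 * cos (angle \<sigma> l 1) * (r * sin (\<beta> \<sigma>)) - r * cos (\<beta> \<sigma>) * (\<rho> \<sigma> l 1 * sin (angle \<sigma> l 1))"
    using angle(2,3)[OF \<sigma>, of 1 l] r by simp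
  also have "\<dots> = - (\<rho> \<sigma> l 1 * r * sin (angle \<sigma> l 1 - \<beta> \<sigma>))"
    by (simp add: sin_diff algebra_simps)
  finally have "\<sigma> * (W l 1 + k * U l 1) = - (\<rho> \<sigma> l 1 * r * sin (angle \<sigma> l 1 - \<beta> \<sigma>))" .
  moreover have "\<rho> \<sigma> l 1 * r \<noteq> 0" using \<rho>_pos[OF \<sigma>, of 1 l] r by simp
  ultimately have "W l 1 + k * U l 1 = 0 \<longleftrightarrow> sin (angle \<sigma> l 1 - \<beta> \<sigma>) = 0"
    using \<sigma> by (metis mult_eq_0_iff neg_equal_0_iff_equal less_irrefl)
  also have "\<dots> \<longleftrightarrow> (\<exists>n::int. angle \<sigma> l 1 = \<beta> \<sigma> + of_int n * pi)"
    unfolding sin_zero_iff_int2 by (simp add: diff_eq_eq add.commute)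
  finally show ?thesis by (auto simp: eigenvalues_def algebra_simps eq_neg_iff_add_eq_0)
qed

text \<open>
  Rescaling keeps a vector in its open half plane around the original direction, so it changes
  a continuous angle by less than a quarter turn. Hence the index of an eigenvalue does not
  depend on the scale.
\<close>

lemma angle_scale:
  assumes \<sigma>: "\<sigma> > 0"
  shows "\<bar>angle \<sigma> l 1 - angle 1 l 1\<bar> < pi / 2"
proof (rule angle_difference_lt_half_pi[where d = "\<lambda>x. angle \<sigma> l x - angle 1 l x"])
  show "continuous_on {0..1} (\<lambda>x. angle \<sigma> l x - angle 1 l x)"
    using continuous_angle \<sigma> by (intro continuous_intros) auto
  show pos: "cos (angle \<sigma> l x - angle 1 l x) > 0" if x: "x \<in> {0..1}" for x
  proof -
    have "\<rho> \<sigma> l x * \<rho> 1 l x * cos (angle \<sigma> l x - angle 1 l x)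
        = (\<rho> \<sigma> l x * cos (angle \<sigma> l x)) * (\<rho> 1 l x * cos (angle 1 l x))
          + (\<rho> \<sigma> l x * sin (angle \<sigma> l x)) * (\<rho> 1 l x * sin (angle 1 l x))"
      by (simp add: cos_diff algebra_simps)
    also have "\<dots> = W l x * W l x + \<sigma> * U l x * (1 * U l x)"
      using x \<sigma> by (simp only: angle(2,3)[symmetric] zero_less_one)
    also have "\<dots> > 0"
      using UW_nonzero[OF x, of l] \<sigma> unfolding sum_power2_gt_zero_iff
      by (cases "W l x = 0") (auto intro: add_pos_nonneg simp: zero_less_mult_iff linorder_neq_iff mult.assoc)
    finally show ?thesis
      by (rule zero_less_mult_pos[OF _ mult_pos_pos[OF \<rho>_pos[OF \<sigma> x] \<rho>_pos[OF zero_less_one x]]])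
  qed
  show "\<bar>angle \<sigma> l 0 - angle 1 l 0\<bar> < pi / 2"
    using angle_0_bounds[OF \<sigma>, of l] angle_0_bounds[of 1 l] pos[of 0]
    by (intro cos_pos_imp_lt_half_pi) auto
qed auto

lemma \<beta>_scale:
  assumes \<sigma>: "\<sigma> > 0" shows "\<bar>\<beta> \<sigma> - \<beta> 1\<bar> < pi / 2"
proof (rule cos_pos_imp_lt_half_pi)
  show "\<bar>\<beta> \<sigma> - \<beta> 1\<bar> < pi" using \<beta>_bounds[OF \<sigma>] \<beta>_bounds[of 1] by auto
  obtain r where r: "r > 0" "- k = r * cos (\<beta> \<sigma>)" "\<sigma> = r * sin (\<beta> \<sigma>)"
    by (rule \<beta>_polar[OF \<sigma>])
  obtain s where s: "s > 0" "- k = s * cos (\<beta> 1)" "1 = s * sin (\<beta> 1)"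
    by (rule \<beta>_polar[of 1]) auto
  have "r * s * cos (\<beta> \<sigma> - \<beta> 1) = (r * cos (\<beta> \<sigma>)) * (s * cos (\<beta> 1)) + (r * sin (\<beta> \<sigma>)) * (s * sin (\<beta> 1))"
    by (simp add: cos_diff algebra_simps)
  also have "\<dots> = (- k) * (- k) + \<sigma> * 1"
    by (simp only: r(2,3)[symmetric] s(2,3)[symmetric])
  also have "\<dots> > 0" using \<sigma> by (simp add: add_nonneg_pos)
  finally show "cos (\<beta> \<sigma> - \<beta> 1) > 0"
    by (rule zero_less_mult_pos) (rule mult_pos_pos[OF r(1) s(1)])
qed

lemma eigenvalue_index_scale:
  assumes \<sigma>: "\<sigma> > 0" and l: "angle 1 l 1 = \<beta> 1 + of_int n * pi"
  shows "angle \<sigma> l 1 = \<beta> \<sigma> + of_int n * pi"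
proof -
  obtain m :: int where m: "angle \<sigma> l 1 = \<beta> \<sigma> + of_int m * pi"
    using eigenvalue_iff_angle[OF \<sigma>, of l] eigenvalue_iff_angle[of 1 l] l by auto
  have "of_int (m - n) * pi = (angle \<sigma> l 1 - angle 1 l 1) - (\<beta> \<sigma> - \<beta> 1)"
    using m l by (simp add: algebra_simps)
  then have "\<bar>of_int (m - n) * pi\<bar> < 1 * pi"
    using angle_scale[OF \<sigma>, of l] \<beta>_scale[OF \<sigma>] by linarith
  then have "\<bar>real_of_int (m - n)\<bar> < 1" unfolding abs_mult using pi_gt_zero by simp
  then show ?thesis using m by simp
qed

lemma U_square_integral_pos: "integral {0..1} (\<lambda>t. U l t * U l t) > 0"
proof -
  have c: "continuous_on {0..1} (\<lambda>t. U l t * U l t)"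
    using continuous_UW by (intro continuous_intros)
  have "integral {0..1} (\<lambda>t. U l t * U l t) \<noteq> 0"
  proof
    assume "integral {0..1} (\<lambda>t. U l t * U l t) = 0"
    then have "\<forall>t\<in>{0..1}. U l t * U l t = 0"
      using integral_eq_0_iff[OF c zero_less_one] by simp
    then show False using UW(2)[of l] by force
  qed
  moreover have "integral {0..1} (\<lambda>t. U l t * U l t) \<ge> 0"
    using c by (intro Henstock_Kurzweil_Integration.integral_nonneg integrable_continuous_real) auto
  ultimately show ?thesis by simp
qed

text \<open>
  The end angle increases strictly with the spectral parameter. Since
  \<open>\<rho> \<rho>' sin (\<theta>' - \<theta>)\<close> is the Wronskian of the two solutions, which by Green's identity is
  \<open>(m - l)\<close> times the integral of their product, the difference of the end angles
  is the arcsine of a function with positive derivative at \<open>m = l\<close>.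
\<close>

lemma end_angle_has_positive_derivative:
  "\<exists>D>0. ((\<lambda>m. angle 1 m 1) has_real_derivative D) (at l)"
proof -
  obtain C where C: "C > 0" and lip: "\<forall>m u w y x. \<bar>m - l\<bar> \<le> 1 \<longrightarrow> sl_system P m u w \<longrightarrow> y \<in> {0..1} \<longrightarrow>
    u y = U l y \<longrightarrow> w y = W l y \<longrightarrow> x \<in> {0..1} \<longrightarrow> \<bar>u x - U l x\<bar> \<le> C * \<bar>m - l\<bar> \<and> \<bar>w x - W l x\<bar> \<le> C * \<bar>m - l\<bar>"
    using sl_system_lipschitz_parameter[OF cont_P UW(1)[of l]] by blast
  have close: "\<bar>U m x - U l x\<bar> \<le> C * \<bar>m - l\<bar>" "\<bar>W m x - W l x\<bar> \<le> C * \<bar>m - l\<bar>"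
    if "\<bar>m - l\<bar> \<le> 1" "x \<in> {0..1}" for m x
    using lip[rule_format, of m "U m" "W m" 0 x] that by (auto simp: UW)
  have "continuous_on {0..1} (\<lambda>x. \<bar>U l x\<bar> + \<bar>W l x\<bar>)"
    using continuous_UW by (intro continuous_intros)
  then obtain B where B: "B > 0" "\<And>x. x \<in> {0..1} \<Longrightarrow> \<bar>\<bar>U l x\<bar> + \<bar>W l x\<bar>\<bar> \<le> B"
    using continuous_bound_unit by blast
  have "continuous_on {0..1} (\<lambda>x. (U l x)\<^sup>2 + (W l x)\<^sup>2)"
    using continuous_UW by (intro continuous_intros)
  then obtain x0 where x0: "x0 \<in> {0..1}" "\<And>x. x \<in> {0..1} \<Longrightarrow> (U l x0)\<^sup>2 + (W l x0)\<^sup>2 \<le> (U l x)\<^sup>2 + (W l x)\<^sup>2"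
    using continuous_attains_inf[of "{0..1::real}"] by force
  define \<epsilon> where "\<epsilon> = (U l x0)\<^sup>2 + (W l x0)\<^sup>2"
  have \<epsilon>: "\<epsilon> > 0" unfolding \<epsilon>_def by (rule UW_nonzero[OF x0(1)])
  define J where "J = (\<lambda>m. integral {0..1} (\<lambda>t. U m t * U l t))"
  define \<kappa> where "\<kappa> = (\<lambda>m. J m / (\<rho> 1 m 1 * \<rho> 1 l 1))"
  have rho1: "\<rho> 1 m x = sqrt ((W m x)\<^sup>2 + (U m x)\<^sup>2)" for m x by (simp add: \<rho>_def)
  \<comment> \<open>for \<open>m\<close> within \<open>\<delta>\<close> of \<open>l\<close> the vectors \<open>(W m x, U m x)\<close> and \<open>(W l x, U l x)\<close> enclose an acute angle\<close>
  define \<delta> where "\<delta> = min 1 (\<epsilon> / (2 * C * B))"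
  have \<delta>: "\<delta> > 0" using \<epsilon> C B by (simp add: \<delta>_def)
  have eq: "angle 1 m 1 = angle 1 l 1 + arcsin ((m - l) * \<kappa> m)" if m: "\<bar>m - l\<bar> < \<delta>" for m
  proof -
    let ?d = "\<lambda>x. angle 1 m x - angle 1 l x"
    have prod: "\<rho> 1 m x * \<rho> 1 l x * cos (?d x) = W m x * W l x + U m x * U l x"
      "\<rho> 1 m x * \<rho> 1 l x * sin (?d x) = U m x * W l x - W m x * U l x" if x: "x \<in> {0..1}" for x
    proof -
      have *: "W m x = \<rho> 1 m x * cos (angle 1 m x)" "U m x = \<rho> 1 m x * sin (angle 1 m x)"
        "W l x = \<rho> 1 l x * cos (angle 1 l x)" "U l x = \<rho> 1 l x * sin (angle 1 l x)"
        using angle(2,3)[of 1 x] x by auto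
      have "\<rho> 1 m x * \<rho> 1 l x * cos (?d x) = (\<rho> 1 m x * cos (angle 1 m x)) * (\<rho> 1 l x * cos (angle 1 l x))
          + (\<rho> 1 m x * sin (angle 1 m x)) * (\<rho> 1 l x * sin (angle 1 l x))"
        by (simp add: cos_diff algebra_simps)
      then show "\<rho> 1 m x * \<rho> 1 l x * cos (?d x) = W m x * W l x + U m x * U l x"
        by (simp only: *[symmetric])
      have "\<rho> 1 m x * \<rho> 1 l x * sin (?d x) = (\<rho> 1 m x * sin (angle 1 m x)) * (\<rho> 1 l x * cos (angle 1 l x))
          - (\<rho> 1 m x * cos (angle 1 m x)) * (\<rho> 1 l x * sin (angle 1 l x))"
        by (simp add: sin_diff algebra_simps)
      then show "\<rho> 1 m x * \<rho> 1 l x * sin (?d x) = U m x * W l x - W m x * U l x"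
        by (simp only: *[symmetric])
    qed
    have rpos: "\<rho> 1 m x * \<rho> 1 l x > 0" if "x \<in> {0..1}" for x
      using \<rho>_pos[of 1 x] that by simp
    have "\<bar>?d 1\<bar> < pi / 2"
    proof (rule angle_difference_lt_half_pi[where d = ?d and x = 1])
      show "continuous_on {0..1} ?d" using continuous_angle by (intro continuous_intros) auto
      show "\<bar>?d 0\<bar> < pi / 2" by (simp add: angle(1))
      fix x :: real assume x: "x \<in> {0..1}"
      have "\<bar>(W m x - W l x) * W l x + (U m x - U l x) * U l x\<bar> \<le> C * \<bar>m - l\<bar> * \<bar>W l x\<bar> + C * \<bar>m - l\<bar> * \<bar>U l x\<bar>"
        using close[of m x] m x \<delta>_def
        by (intro order_trans[OF abs_triangle_ineq] add_mono) (auto simp: abs_mult intro!: mult_right_mono)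
      also have "\<dots> = C * \<bar>m - l\<bar> * (\<bar>U l x\<bar> + \<bar>W l x\<bar>)" by (simp add: algebra_simps)
      also have "\<dots> \<le> C * \<bar>m - l\<bar> * B"
        using B(2)[OF x] C by (intro mult_left_mono) auto
      also have "\<dots> < \<epsilon>"
      proof -
        have "\<bar>m - l\<bar> < \<epsilon> / (2 * C * B)" using m by (simp add: \<delta>_def)
        then have "C * \<bar>m - l\<bar> * B < \<epsilon> / 2" using C B by (simp add: field_simps)
        then show ?thesis using \<epsilon> by simp
      qed
      also have "\<epsilon> \<le> (U l x)\<^sup>2 + (W l x)\<^sup>2" unfolding \<epsilon>_def by (rule x0(2)[OF x])
      finally have "W m x * W l x + U m x * U l x > 0"
        by (simp add: algebra_simps power2_eq_square abs_less_iff)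
      then show "cos (?d x) > 0"
        using prod(1)[OF x] rpos[OF x] by (metis zero_less_mult_pos)
    qed auto
    moreover have "sin (?d 1) = (m - l) * \<kappa> m"
    proof -
      have "((\<lambda>t. (m - l) * (U m t * U l t)) has_integral U m 1 * W l 1 - W m 1 * U l 1) {0..1}"
        using greens_identity[OF UW(1)[of m] UW(1)[of l], of 1] by (simp add: UW)
      moreover have "(\<lambda>t. U m t * U l t) integrable_on {0..1}"
        using continuous_UW by (intro integrable_continuous_real continuous_intros)
      ultimately have "U m 1 * W l 1 - W m 1 * U l 1 = (m - l) * J m"
        unfolding J_def using integrable_integral has_integral_mult_right has_integral_unique by blast
      then have "\<rho> 1 m 1 * \<rho> 1 l 1 * sin (?d 1) = (m - l) * J m"
        using prod(2)[of 1] by simp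
      moreover have "\<rho> 1 m 1 * \<rho> 1 l 1 \<noteq> 0" using rpos[of 1] by force
      ultimately show ?thesis
        unfolding \<kappa>_def times_divide_eq_right by (simp only: eq_divide_eq) (simp add: mult.commute)
    qed
    moreover from calculation(1) have "- (pi / 2) \<le> ?d 1" "?d 1 \<le> pi / 2" by linarith+
    ultimately show ?thesis
      using arcsin_sin[of "?d 1"] by simp
  qed
  have near: "\<forall>\<^sub>F m in at l. \<bar>m - l\<bar> \<le> 1"
    unfolding eventually_at by (intro exI[of _ 1]) (auto simp: dist_real_def)
  have lin0: "((\<lambda>m. C * \<bar>m - l\<bar>) \<longlongrightarrow> 0) (at l)"
    by (intro tendsto_eq_intros refl) auto
  have tendU: "((\<lambda>m. U m 1) \<longlongrightarrow> U l 1) (at l)"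
    by (rule LIM_zero_cancel, rule Lim_null_comparison[OF _ lin0], rule eventually_mono[OF near]) (use close in auto)
  have tendW: "((\<lambda>m. W m 1) \<longlongrightarrow> W l 1) (at l)"
    by (rule LIM_zero_cancel, rule Lim_null_comparison[OF _ lin0], rule eventually_mono[OF near]) (use close in auto)
  have tendJ: "(J \<longlongrightarrow> J l) (at l)"
  proof (rule LIM_zero_cancel, rule Lim_null_comparison)
    show "((\<lambda>m. C * \<bar>m - l\<bar> * B) \<longlongrightarrow> 0) (at l)" using lin0 by (rule tendsto_mult_left_zero)
    show "\<forall>\<^sub>F m in at l. norm (J m - J l) \<le> C * \<bar>m - l\<bar> * B"
    proof (rule eventually_mono[OF near])
      fix m assume m: "\<bar>m - l\<bar> \<le> 1"
      have int: "(\<lambda>t. U m t * U l t) integrable_on {0..1}" for m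
        using continuous_UW by (intro integrable_continuous_real continuous_intros)
      have diff: "J m - J l = integral {0..1} (\<lambda>t. U m t * U l t - U l t * U l t)"
        unfolding J_def by (rule Henstock_Kurzweil_Integration.integral_diff[OF int int, symmetric])
      have "norm (J m - J l) \<le> integral {0..1::real} (\<lambda>t. C * \<bar>m - l\<bar> * B)"
        unfolding diff
      proof (rule integral_norm_bound_integral)
        show "(\<lambda>t. U m t * U l t - U l t * U l t) integrable_on {0..1}"
          by (rule integrable_diff[OF int int])
        fix t :: real assume t: "t \<in> {0..1}"
        have "\<bar>(U m t - U l t) * U l t\<bar> \<le> (C * \<bar>m - l\<bar>) * B"
          unfolding abs_mult using close(1)[OF m t] B(2)[OF t] by (intro mult_mono) auto
        then show "norm (U m t * U l t - U l t * U l t) \<le> C * \<bar>m - l\<bar> * B"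
          by (simp add: left_diff_distrib)
      qed auto
      then show "norm (J m - J l) \<le> C * \<bar>m - l\<bar> * B" by simp
    qed
  qed
  have "\<rho> 1 l 1 > 0" by (rule \<rho>_pos) auto
  then have kappa: "isCont \<kappa> l"
    unfolding isCont_def \<kappa>_def using tendU tendW tendJ
    by (intro tendsto_intros) (auto simp: rho1 intro!: tendsto_intros)
  have "((\<lambda>m. (m - l) * \<kappa> m) has_real_derivative \<kappa> l) (at l)"
    unfolding CARAT_DERIV using kappa by (intro exI[of _ \<kappa>]) (auto simp: mult.commute)
  from DERIV_chain2[OF DERIV_arcsin this] have "((\<lambda>m. arcsin ((m - l) * \<kappa> m)) has_real_derivative \<kappa> l) (at l)"
    by simp
  from DERIV_add[OF DERIV_const[of "angle 1 l 1"] this]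
  have "((\<lambda>m. angle 1 l 1 + arcsin ((m - l) * \<kappa> m)) has_real_derivative \<kappa> l) (at l)"
    by simp
  then have "((\<lambda>m. angle 1 m 1) has_real_derivative \<kappa> l) (at l)"
  proof (rule has_field_derivative_transform_within[OF _ \<delta>])
    fix m assume "dist m l < \<delta>"
    then show "angle 1 l 1 + arcsin ((m - l) * \<kappa> m) = angle 1 m 1"
      by (intro eq[symmetric]) (simp add: dist_real_def)
  qed simp
  moreover have "\<kappa> l > 0"
    using U_square_integral_pos[of l] \<open>\<rho> 1 l 1 > 0\<close> by (simp add: \<kappa>_def J_def)
  ultimately show ?thesis by blast
qed

lemma end_angle_strict_mono: "a < b \<Longrightarrow> angle 1 a 1 < angle 1 b 1"
  using end_angle_has_positive_derivative by (intro DERIV_pos_imp_increasing[of a b "\<lambda>m. angle 1 m 1"]) blast+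

lemma end_angle_continuous: "continuous_on A (\<lambda>m. angle 1 m 1)"
  using end_angle_has_positive_derivative
  by (meson DERIV_isCont continuous_at_imp_continuous_on)

lemma end_angle_nonneg: "angle 1 l 1 \<ge> 0"
  by (rule upward_crossing_nonneg[OF angle(4)]) (use angle_0_bounds[of 1 l] in auto)

text \<open>In the scale \<open>s = sqrt l\<close> the angular velocity is at least \<open>s - p\<close>, where \<open>p\<close> bounds \<open>P\<close>.\<close>

lemma end_angle_unbounded: "\<exists>l. angle 1 l 1 > b"
proof -
  obtain p where p: "p > 0" "\<And>x. x \<in> {0..1} \<Longrightarrow> \<bar>P x\<bar> \<le> p"
    using continuous_bound_unit[OF cont_P] by blast
  define s where "s = \<bar>b\<bar> + p + pi"
  have s: "s > 0" using p(1) pi_gt_zero abs_ge_zero[of b] unfolding s_def by linarith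
  define l where "l = s\<^sup>2"
  have "angle s l 0 - (s - p) * 0 \<le> angle s l 1 - (s - p) * 1"
  proof (rule unit_interval_mono[where f = "\<lambda>x. angle s l x - (s - p) * x" and x = 0 and y = 1])
    fix x :: real assume x: "x \<in> {0..1}"
    let ?\<theta> = "angle s l x"
    let ?D = "s * (cos ?\<theta>)\<^sup>2 + P x * sin (2 * ?\<theta>) + (l + (P x)\<^sup>2) / s * (sin ?\<theta>)\<^sup>2"
    show "((\<lambda>x. angle s l x - (s - p) * x) has_real_derivative ?D - (s - p)) (at x within {0..1})"
      by (auto intro!: derivative_eq_intros angle(4)[OF s x])
    have "?D = (s * (cos ?\<theta>)\<^sup>2 + s * (sin ?\<theta>)\<^sup>2) + P x * sin (2 * ?\<theta>) + (P x)\<^sup>2 / s * (sin ?\<theta>)\<^sup>2"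
    proof -
      have "l / s = s" using s by (simp add: l_def power2_eq_square)
      then show ?thesis by (simp add: add_divide_distrib distrib_left distrib_right)
    qed
    moreover have "s * (cos ?\<theta>)\<^sup>2 + s * (sin ?\<theta>)\<^sup>2 = s"
      by (simp flip: distrib_left)
    moreover have "\<bar>P x * sin (2 * ?\<theta>)\<bar> \<le> p * 1"
      unfolding abs_mult using p(2)[OF x] by (intro mult_mono) auto
    moreover have "(P x)\<^sup>2 / s * (sin ?\<theta>)\<^sup>2 \<ge> 0" using s by simp
    ultimately show "?D - (s - p) \<ge> 0" by (simp add: abs_le_iff)
  qed auto
  then have "angle s l 1 > \<bar>b\<bar> + pi"
    using angle_0_bounds[OF s, of l] by (simp add: s_def)
  then have "angle 1 l 1 > b"
    using angle_scale[OF s, of l] pi_gt_zero abs_ge_self[of b] by linarith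
  then show ?thesis ..
qed

text \<open>
  For very negative \<open>l\<close> the angle cannot cross the segment from its initial value to \<open>\<beta>/2\<close>:
  along that segment the sine is bounded away from 0, so the term with \<open>l\<close> makes the angular velocity
  smaller than the slope of the segment.
\<close>

lemma end_angle_below_\<beta>: "\<exists>l. angle 1 l 1 < \<beta> 1"
proof -
  obtain p where p: "p > 0" "\<And>x. x \<in> {0..1} \<Longrightarrow> \<bar>P x\<bar> \<le> p"
    using continuous_bound_unit[OF cont_P] by blast
  define \<alpha> where "\<alpha> = Arg (Complex (- h0) 1)"
  have \<alpha>: "0 < \<alpha>" "\<alpha> < pi" using angle_0_bounds[of 1] by (auto simp: \<alpha>_def angle(1))
  define c where "c = \<beta> 1 / 2 - \<alpha>"
  define L where "L = (\<lambda>x. \<alpha> + c * x)"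
  have L: "0 < L x \<and> L x < pi" if "x \<in> {0..1}" for x
  proof -
    have "L x = (1 - x) * \<alpha> + x * (\<beta> 1 / 2)" by (simp add: L_def c_def algebra_simps)
    moreover have "(1 - x) * \<alpha> + x * (\<beta> 1 / 2) < pi"
      using that \<alpha> \<beta>_bounds[of 1] by (intro convex_bound_lt) auto
    moreover have "- ((1 - x) * \<alpha> + x * (\<beta> 1 / 2)) < 0"
    proof -
      have "(1 - x) * (- \<alpha>) + x * (- (\<beta> 1 / 2)) < 0"
        using that \<alpha> \<beta>_bounds[of 1] by (intro convex_bound_lt) auto
      then show ?thesis by (simp add: algebra_simps)
    qed
    ultimately show ?thesis by simp
  qed
  have "continuous_on {0..1} (\<lambda>x. sin (L x))"
    unfolding L_def by (intro continuous_intros)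
  then obtain x0 where x0: "x0 \<in> {0..1}" "\<And>x. x \<in> {0..1} \<Longrightarrow> sin (L x0) \<le> sin (L x)"
    using continuous_attains_inf[of "{0..1::real}"] by force
  define s where "s = sin (L x0)"
  have s: "s > 0" unfolding s_def using L[OF x0(1)] by (intro sin_gt_zero) auto
  define l where "l = - ((2 + p + p\<^sup>2 + \<bar>c\<bar>) / s\<^sup>2)"
  have "2 + p + p\<^sup>2 + \<bar>c\<bar> > 0" using p(1) by (simp add: add_pos_nonneg)
  then have l: "l < 0" using s unfolding l_def neg_less_0_iff_less by (intro divide_pos_pos) auto
  have "L 1 - angle 1 l 1 \<ge> 0"
  proof (rule upward_crossing_nonneg[where f = "\<lambda>x. L x - angle 1 l x"])
    fix x :: real assume x: "x \<in> {0..1}"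
    let ?\<theta> = "angle 1 l x"
    let ?D = "1 * (cos ?\<theta>)\<^sup>2 + P x * sin (2 * ?\<theta>) + (l + (P x)\<^sup>2) / 1 * (sin ?\<theta>)\<^sup>2"
    show "((\<lambda>x. L x - angle 1 l x) has_real_derivative c - ?D) (at x within {0..1})"
      unfolding L_def by (auto intro!: derivative_eq_intros angle(4)[OF zero_less_one x])
    assume "L x - angle 1 l x = 0"
    then have sin: "sin ?\<theta> \<ge> s" using x0(2)[OF x] by (simp add: s_def)
    then have "l * (sin ?\<theta>)\<^sup>2 \<le> l * s\<^sup>2"
      using l s by (intro mult_left_mono_neg power_mono) auto
    also have "\<dots> = - (2 + p + p\<^sup>2 + \<bar>c\<bar>)" using s by (simp add: l_def)
    finally have 1: "l * (sin ?\<theta>)\<^sup>2 \<le> - (2 + p + p\<^sup>2 + \<bar>c\<bar>)" .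
    have 2: "\<bar>P x * sin (2 * ?\<theta>)\<bar> \<le> p * 1"
      unfolding abs_mult using p(2)[OF x] by (intro mult_mono) auto
    have 3: "(P x)\<^sup>2 * (sin ?\<theta>)\<^sup>2 \<le> p\<^sup>2 * 1"
      using p(2)[OF x] p(1) by (intro mult_mono) (auto simp: abs_le_square_iff[symmetric] power_le_one_iff abs_square_le_1)
    have 4: "(cos ?\<theta>)\<^sup>2 \<le> 1" by (simp add: abs_square_le_1)
    have "?D = (cos ?\<theta>)\<^sup>2 + P x * sin (2 * ?\<theta>) + l * (sin ?\<theta>)\<^sup>2 + (P x)\<^sup>2 * (sin ?\<theta>)\<^sup>2"
      by (simp add: algebra_simps)
    then show "c - ?D > 0" using 1 2 3 4 by (simp add: abs_le_iff abs_if split: if_splits)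
  qed (auto simp: L_def angle(1) \<alpha>_def)
  then have "angle 1 l 1 < \<beta> 1" using \<beta>_bounds[of 1] by (simp add: L_def c_def)
  then show ?thesis ..
qed

text \<open>
  The end angle takes all values from one below \<open>\<beta>\<close> upwards and is never negative, and \<open>\<beta> < pi\<close>. So it
  meets \<open>\<beta> + n pi\<close> exactly once for each natural \<open>n\<close>, and never for negative \<open>n\<close>.
\<close>

lemma eigenvalue_exists_index: "\<exists>l. angle 1 l 1 = \<beta> 1 + of_nat n * pi"
proof -
  obtain a where a: "angle 1 a 1 < \<beta> 1" using end_angle_below_\<beta> by blast
  obtain b where b: "angle 1 b 1 > \<beta> 1 + of_nat n * pi" using end_angle_unbounded by blast
  have le: "\<beta> 1 \<le> \<beta> 1 + of_nat n * pi" by simp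
  have "a \<le> b"
    using end_angle_strict_mono[of b a] a b le by (force simp: not_le[symmetric])
  then show ?thesis
    using IVT'[of "\<lambda>m. angle 1 m 1" a "\<beta> 1 + of_nat n * pi" b] a b le end_angle_continuous by fastforce
qed

definition ev :: "nat \<Rightarrow> real" where "ev n = (SOME l. angle 1 l 1 = \<beta> 1 + of_nat n * pi)"

lemma ev: "angle 1 (ev n) 1 = \<beta> 1 + of_nat n * pi"
  unfolding ev_def using someI_ex[OF eigenvalue_exists_index] .

lemma strict_mono_ev: "strict_mono ev"
proof (rule strict_monoI)
  fix m n :: nat assume "m < n"
  then have "angle 1 (ev m) 1 < angle 1 (ev n) 1" by (simp add: ev)
  then show "ev m < ev n"
    using end_angle_strict_mono[of "ev n" "ev m"] by (cases "ev m" "ev n" rule: linorder_cases) auto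
qed

lemma range_ev: "range ev = eigenvalues"
proof (intro equalityI subsetI)
  fix l assume "l \<in> range ev"
  then obtain n where "l = ev n" by auto
  then have "angle 1 l 1 = \<beta> 1 + of_int (int n) * pi" by (simp add: ev)
  then show "l \<in> eigenvalues"
    unfolding eigenvalue_iff_angle[OF zero_less_one] by (rule exI)
next
  fix l assume "l \<in> eigenvalues"
  then obtain n :: int where n: "angle 1 l 1 = \<beta> 1 + of_int n * pi"
    using eigenvalue_iff_angle[of 1] by auto
  then have "(-1) * pi < of_int n * pi"
    using end_angle_nonneg[of l] \<beta>_bounds[of 1] by simp
  then have "n \<ge> 0" by (subst (asm) mult_less_cancel_right_pos) auto
  then have "angle 1 l 1 = angle 1 (ev (nat n)) 1" using n by (simp add: ev)
  then have "l = ev (nat n)"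
    using end_angle_strict_mono[of l "ev (nat n)"] end_angle_strict_mono[of "ev (nat n)" l]
    by (cases l "ev (nat n)" rule: linorder_cases) auto
  then show "l \<in> range ev" by auto
qed

end

lemma enumeration_unique:
  fixes e :: "nat \<Rightarrow> real"
  assumes mono: "strict_mono e" and range: "range e = S"
  shows "(THE l. l \<in> S \<and> finite {m \<in> S. m < l} \<and> card {m \<in> S. m < l} = n) = e n"
proof -
  have below: "{m \<in> S. m < e j} = e ` {..<j}" for j
    unfolding range[symmetric] using mono by (auto simp: strict_mono_less)
  have card: "finite {m \<in> S. m < e j} \<and> card {m \<in> S. m < e j} = j" for j
    unfolding below using strict_mono_imp_inj_on[OF mono] by (auto simp: card_image inj_on_subset)
  show ?thesis
  proof (rule the_equality)
    show "e n \<in> S \<and> finite {m \<in> S. m < e n} \<and> card {m \<in> S. m < e n} = n"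
      using card[of n] range by auto
    fix l assume l: "l \<in> S \<and> finite {m \<in> S. m < l} \<and> card {m \<in> S. m < l} = n"
    then obtain j where "l = e j" using range by auto
    then show "l = e n" using l card[of j] by simp
  qed
qed

lemma sl_eigenvalue_eq_enumeration:
  "strict_mono e \<Longrightarrow> range e = sl_spectrum p \<Longrightarrow> sl_eigenvalue p n = e n"
  unfolding sl_eigenvalue_def by (rule enumeration_unique)

lemma regular_problem_primitive: "regular_problem (primitive q)"
  by (rule regular_problem.intro[OF continuous_on_primitive])

text \<open>An eigenfunction is a multiple of the left solution, by uniqueness.\<close>

lemma sl_eigenfunction_imp_eigenvalue:
  assumes "sl_eigenfunction (h0, h, q) l u"
  shows "l \<in> regular_problem.eigenvalues (primitive q) h0 (h + primitive q 1)"
proof -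
  interpret R: regular_problem "primitive q" h0 "h + primitive q 1" by (rule regular_problem_primitive)
  obtain w where nz: "\<exists>x\<in>{0..1}. u x \<noteq> 0" and sys: "sl_system (primitive q) l u w"
    and bc: "w 0 = - h0 * u 0" "w 1 = - (h + primitive q 1) * u 1"
    using assms unfolding sl_eigenfunction_iff_system by blast
  have sys': "sl_system (primitive q) l (\<lambda>x. u 0 * R.U l x) (\<lambda>x. u 0 * R.W l x)"
    using sl_system_linear[OF R.UW(1)[of l] R.UW(1)[of l], of "u 0" 0] by simp
  have eq: "u x = u 0 * R.U l x" "w x = u 0 * R.W l x" if "x \<in> {0..1}" for x
    using sl_system_unique[OF R.cont_P sys sys' _ _ _ that, of 0] bc by (auto simp: R.UW)
  have "u 0 \<noteq> 0" using eq(1) nz by force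
  then show ?thesis
    using eq[of 1] bc(2) by (simp add: R.eigenvalues_def)
qed

lemma sl_spectrum_eq_eigenvalues:
  "sl_spectrum (h0, h, q) = regular_problem.eigenvalues (primitive q) h0 (h + primitive q 1)"
proof -
  interpret R: regular_problem "primitive q" h0 "h + primitive q 1" by (rule regular_problem_primitive)
  have "sl_eigenfunction (h0, h, q) l (R.U l)" if "l \<in> R.eigenvalues" for l
    unfolding sl_eigenfunction_iff_system
  proof
    show "\<exists>x\<in>{0..1}. R.U l x \<noteq> 0" by (rule bexI[of _ 0]) (auto simp: R.UW)
    show "\<exists>w. sl_system (primitive q) l (R.U l) w \<and> w 0 = - h0 * R.U l 0 \<and> w 1 = - (h + primitive q 1) * R.U l 1"
      using that by (intro exI[of _ "R.W l"]) (auto simp: R.UW R.eigenvalues_def)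
  qed
  then show ?thesis
    unfolding sl_spectrum_def using sl_eigenfunction_imp_eigenvalue by blast
qed

lemma sl_eigenvalue_eq_ev: "sl_eigenvalue (h0, h, q) n = regular_problem.ev (primitive q) h0 (h + primitive q 1) n"
proof -
  interpret R: regular_problem "primitive q" h0 "h + primitive q 1" by (rule regular_problem_primitive)
  show ?thesis
    using R.strict_mono_ev R.range_ev by (intro sl_eigenvalue_eq_enumeration) (auto simp: sl_spectrum_eq_eigenvalues)
qed

theorem sl_eigenvalue_enumerates_spectrum:
  shows "strict_mono (sl_eigenvalue (h0, h, q))" "range (sl_eigenvalue (h0, h, q)) = sl_spectrum (h0, h, q)"
proof -
  interpret R: regular_problem "primitive q" h0 "h + primitive q 1" by (rule regular_problem_primitive)
  have "sl_eigenvalue (h0, h, q) = R.ev" by (rule ext) (rule sl_eigenvalue_eq_ev)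
  then show "strict_mono (sl_eigenvalue (h0, h, q))" "range (sl_eigenvalue (h0, h, q)) = sl_spectrum (h0, h, q)"
    using R.strict_mono_ev R.range_ev by (simp_all add: sl_spectrum_eq_eigenvalues)
qed

section \<open>Asymptotics of the eigenvalues\<close>

lemma Arg_near_half_pi:
  assumes "s > 0" shows "\<bar>Arg (Complex a s) - pi / 2\<bar> \<le> \<bar>a\<bar> / s"
proof -
  let ?z = "Complex a s"
  define r where "r = cmod ?z"
  have nz: "?z \<noteq> 0" using assms by (auto simp: complex_eq_iff)
  then have r: "r > 0" by (simp add: r_def)
  have b: "0 < Arg ?z" "Arg ?z < pi" using Arg_lt_pi[of ?z] assms by auto
  have rc: "rcis r (Arg ?z) = ?z" unfolding r_def by (rule rcis_cmod_Arg)
  have a: "a = r * cos (Arg ?z)" using arg_cong[OF rc, of Re] by simp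
  have s: "s = r * sin (Arg ?z)" using arg_cong[OF rc, of Im] by simp
  have "tan (pi / 2 - Arg ?z) = cos (Arg ?z) / sin (Arg ?z)"
    by (simp add: tan_def sin_diff cos_diff)
  also have "\<dots> = (r * cos (Arg ?z)) / (r * sin (Arg ?z))" using r by simp
  also have "\<dots> = a / s" by (simp only: a[symmetric] s[symmetric])
  finally have "arctan (a / s) = pi / 2 - Arg ?z"
    using b by (intro arctan_unique) auto
  then have "\<bar>pi / 2 - Arg ?z\<bar> \<le> \<bar>a / s\<bar>" using abs_arctan_le[of "a / s"] by simp
  then show ?thesis using assms by (simp add: abs_minus_commute abs_divide)
qed

text \<open>
  In the scale \<open>s = sqrt l\<close> the angular velocity is \<open>s + P sin 2\<phi> + O(1/s)\<close>. The oscillating term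
  contributes only \<open>O(1/s)\<close> as well: \<open>sin 2\<phi>\<close> has a primitive of size \<open>O(1/s)\<close>, and integrating
  by parts moves the derivative onto \<open>P\<close>, where it becomes the integrable potential. Hence
  \<open>s = n pi + O(1/s)\<close> at the \<open>n\<close>-th eigenvalue.
\<close>

lemma sqrt_eigenvalue_asymptotics:
  obtains C where "C \<ge> 0"
    "\<And>n. sl_eigenvalue (h0, h, q) n \<ge> 1 \<Longrightarrow>
      \<bar>sqrt (sl_eigenvalue (h0, h, q) n) - of_nat n * pi\<bar> \<le> C / sqrt (sl_eigenvalue (h0, h, q) n)"
proof -
  define P where "P = primitive q"
  define k where "k = h + P 1"
  interpret R: regular_problem P h0 k unfolding P_def by (rule regular_problem_primitive)
  define r where "r = rep_l2 q"
  have rint: "r absolutely_integrable_on {0..1}" unfolding r_def by (rule absolutely_integrable_rep)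
  have Pint: "P x = integral {0..x} r" for x by (simp add: P_def primitive_def r_def)
  obtain p where p: "p > 0" "\<And>x. x \<in> {0..1} \<Longrightarrow> \<bar>P x\<bar> \<le> p"
    using continuous_bound_unit[OF R.cont_P] by blast
  define Nq where "Nq = integral {0..1} (\<lambda>t. \<bar>r t\<bar>)"
  define M where "M = 1 + (p + p\<^sup>2)"
  define C where "C = p\<^sup>2 + (p + Nq) * M + \<bar>h0\<bar> + \<bar>k\<bar>"
  have abs_r: "(\<lambda>t. \<bar>r t\<bar>) integrable_on {0..1}" and r_int: "r integrable_on {0..1}"
    using rint by (auto simp: absolutely_integrable_on_def)
  have Nq: "Nq \<ge> 0" unfolding Nq_def using abs_r
    by (intro Henstock_Kurzweil_Integration.integral_nonneg) auto
  have M: "M \<ge> 0" using p by (simp add: M_def)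
  have C: "C \<ge> 0" using p Nq M by (simp add: C_def)
  have est: "\<bar>s - of_nat n * pi\<bar> \<le> C / s" if l: "R.ev n = l" "l \<ge> 1" and s: "s = sqrt l" for n l s
  proof -
    have s1: "s \<ge> 1" and s0: "s > 0" and s2: "s\<^sup>2 = l" using l s by auto
    define \<phi> where "\<phi> = R.angle s l"
    define g where "g = (\<lambda>x. P x * sin (2 * \<phi> x) + (P x)\<^sup>2 / s * (sin (\<phi> x))\<^sup>2)"
    define S where "S = (\<lambda>x. sin (2 * \<phi> x))"
    have \<phi>': "(\<phi> has_real_derivative s + g x) (at x within {0..1})" if "x \<in> {0..1}" for x
    proof -
      have "l / s = s" using s0 s2 by (simp add: power2_eq_square field_simps)
      moreover have "s * (cos (\<phi> x))\<^sup>2 + s * (sin (\<phi> x))\<^sup>2 = s" by (simp flip: distrib_left)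
      ultimately have "s * (cos (\<phi> x))\<^sup>2 + P x * sin (2 * \<phi> x) + (l + (P x)\<^sup>2) / s * (sin (\<phi> x))\<^sup>2 = s + g x"
        by (simp add: g_def add_divide_distrib distrib_right)
      then show ?thesis using R.angle(4)[OF s0 that, of l] by (simp add: \<phi>_def)
    qed
    have \<phi>cont: "continuous_on {0..1} \<phi>" using \<phi>' by (rule DERIV_continuous_on)
    have gcont: "continuous_on {0..1} g" and Scont: "continuous_on {0..1} S"
      unfolding g_def S_def using R.cont_P \<phi>cont s0 by (auto intro!: continuous_intros)
    have sub: "f integrable_on {0..x}" if "continuous_on {0..1} f" "x \<in> {0..1}" for f :: "real \<Rightarrow> real" and x
      using that by (intro integrable_continuous_real) (auto intro: continuous_on_subset)
    have Psq: "(P x)\<^sup>2 / s * (sin (\<phi> x))\<^sup>2 \<le> p\<^sup>2 / s" if x: "x \<in> {0..1}" for x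
    proof -
      have "(P x)\<^sup>2 \<le> p\<^sup>2" using p(2)[OF x] p(1) by (simp add: abs_le_square_iff[symmetric])
      then have "(P x)\<^sup>2 / s * (sin (\<phi> x))\<^sup>2 \<le> p\<^sup>2 / s * 1"
        using s0 by (intro mult_mono divide_right_mono) (auto simp: abs_square_le_1)
      then show ?thesis by simp
    qed
    have gbound: "\<bar>g x\<bar> \<le> p + p\<^sup>2" if x: "x \<in> {0..1}" for x
    proof -
      have "\<bar>P x * sin (2 * \<phi> x)\<bar> \<le> p * 1"
        unfolding abs_mult using p(2)[OF x] by (intro mult_mono) auto
      moreover have "p\<^sup>2 / s \<le> p\<^sup>2" using s1 by (simp add: divide_le_eq mult_le_cancel_left1 mult_left_le_one_le)
      moreover have "(P x)\<^sup>2 / s * (sin (\<phi> x))\<^sup>2 \<ge> 0" using s0 by simp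
      ultimately show ?thesis using Psq[OF x] unfolding g_def by linarith
    qed
    define \<Psi> where "\<Psi> = (\<lambda>x. integral {0..x} S)"
    have \<Psi>: "(\<Psi> has_real_derivative S x) (at x within {0..1})" if "x \<in> {0..1}" for x
      unfolding \<Psi>_def using integral_has_real_derivative[OF Scont that] .
    have \<Psi>bound: "\<bar>\<Psi> x\<bar> \<le> M / s" if x: "x \<in> {0..1}" for x
    proof -
      have "((\<lambda>t. S t * (s + g t)) has_integral (- cos (2 * \<phi> x) / 2) - (- cos (2 * \<phi> 0) / 2)) {0..x}"
      proof (rule has_integral_derivative_unit[OF _ x])
        fix t :: real assume t: "t \<in> {0..1}"
        show "((\<lambda>t. - cos (2 * \<phi> t) / 2) has_real_derivative S t * (s + g t)) (at t within {0..1})"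
          by (auto intro!: derivative_eq_intros \<phi>'[OF t] simp: S_def)
      qed
      moreover have "((\<lambda>t. S t * g t) has_integral integral {0..x} (\<lambda>t. S t * g t)) {0..x}"
        using sub[of "\<lambda>t. S t * g t" x] x Scont gcont by (auto intro!: integrable_integral continuous_intros)
      ultimately have "((\<lambda>t. S t * (s + g t) - S t * g t) has_integral
          (- cos (2 * \<phi> x) / 2) - (- cos (2 * \<phi> 0) / 2) - integral {0..x} (\<lambda>t. S t * g t)) {0..x}"
        by (rule has_integral_diff)
      moreover have "(\<lambda>t. S t * (s + g t) - S t * g t) = (\<lambda>t. s * S t)"
        by (simp add: fun_eq_iff algebra_simps)
      moreover have "((\<lambda>t. s * S t) has_integral s * \<Psi> x) {0..x}"
        unfolding \<Psi>_def using sub[OF Scont x] by (intro has_integral_mult_right integrable_integral)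
      ultimately have "s * \<Psi> x = (- cos (2 * \<phi> x) / 2) - (- cos (2 * \<phi> 0) / 2) - integral {0..x} (\<lambda>t. S t * g t)"
        by (metis has_integral_unique)
      then have eq: "s * \<Psi> x = (cos (2 * \<phi> 0) - cos (2 * \<phi> x)) / 2 - integral {0..x} (\<lambda>t. S t * g t)"
        by (simp add: diff_divide_distrib)
      have "norm (integral {0..x} (\<lambda>t. S t * g t)) \<le> integral {0..x} (\<lambda>t. p + p\<^sup>2)"
      proof (rule integral_norm_bound_integral)
        show "(\<lambda>t. S t * g t) integrable_on {0..x}"
          using Scont gcont x by (intro sub continuous_intros)
        fix t assume "t \<in> {0..x}"
        then have t: "t \<in> {0..1}" using x by auto
        have "\<bar>S t * g t\<bar> \<le> 1 * (p + p\<^sup>2)"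
          unfolding abs_mult using gbound[OF t] by (intro mult_mono) (auto simp: S_def)
        then show "norm (S t * g t) \<le> p + p\<^sup>2" by simp
      qed auto
      also have "\<dots> = x * (p + p\<^sup>2)" using x by simp
      also have "\<dots> \<le> p + p\<^sup>2" using x p by (intro mult_left_le_one_le) auto
      finally have "\<bar>integral {0..x} (\<lambda>t. S t * g t)\<bar> \<le> p + p\<^sup>2" by simp
      moreover have "\<bar>(cos (2 * \<phi> 0) - cos (2 * \<phi> x)) / 2\<bar> \<le> 1"
      proof -
        have "\<bar>(a - b) / 2\<bar> \<le> 1" if "- 1 \<le> a" "a \<le> 1" "- 1 \<le> b" "b \<le> 1" for a b :: real
          using that by (simp add: abs_le_iff)
        then show ?thesis by simp
      qed
      ultimately have "\<bar>s * \<Psi> x\<bar> \<le> M" unfolding eq M_def by linarith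
      then show ?thesis using s0 by (simp add: abs_mult pos_le_divide_eq mult.commute)
    qed
    have osc: "\<bar>integral {0..1} (\<lambda>t. P t * S t)\<bar> \<le> (p + Nq) * M / s"
    proof -
      have parts: "integral {0..1} (\<lambda>t. r t * \<Psi> t) = P 1 * \<Psi> 1 - integral {0..1} (\<lambda>t. P t * S t)"
        unfolding Pint by (rule integral_by_parts_indefinite[OF rint \<Psi> Scont]) auto
      have \<Psi>cont: "continuous_on {0..1} \<Psi>" using \<Psi> by (rule DERIV_continuous_on)
      have "norm (integral {0..1} (\<lambda>t. r t * \<Psi> t)) \<le> integral {0..1} (\<lambda>t. \<bar>r t\<bar> * (M / s))"
      proof (rule integral_norm_bound_integral)
        show "(\<lambda>t. r t * \<Psi> t) integrable_on {0..1}"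
          using absolutely_integrable_mult_continuous[OF rint \<Psi>cont] by (simp add: absolutely_integrable_on_def)
        show "(\<lambda>t. \<bar>r t\<bar> * (M / s)) integrable_on {0..1}"
          using abs_r by (rule integrable_on_mult_left)
        show "norm (r t * \<Psi> t) \<le> \<bar>r t\<bar> * (M / s)" if "t \<in> {0..1}" for t
          using \<Psi>bound[OF that] by (simp only: real_norm_def abs_mult) (rule mult_left_mono, auto)
      qed
      also have "\<dots> = Nq * (M / s)" unfolding Nq_def by (rule integral_mult_left)
      finally have 1: "\<bar>integral {0..1} (\<lambda>t. r t * \<Psi> t)\<bar> \<le> Nq * (M / s)" by simp
      have 2: "\<bar>P 1 * \<Psi> 1\<bar> \<le> p * (M / s)"
        unfolding abs_mult using p(2)[of 1] \<Psi>bound[of 1] p(1) by (intro mult_mono) auto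
      have "(p + Nq) * M / s = p * (M / s) + Nq * (M / s)"
        by (simp add: add_divide_distrib distrib_right)
      then show ?thesis using parts 1 2 by linarith
    qed
    have "((\<lambda>t. s + g t) has_integral \<phi> 1 - \<phi> 0) {0..1}"
      by (rule has_integral_derivative_unit[OF \<phi>']) auto
    moreover have "((\<lambda>t. s) has_integral s) {0..1::real}" using has_integral_const_real[of s 0 1] by simp
    moreover have "((\<lambda>t. P t * S t) has_integral integral {0..1} (\<lambda>t. P t * S t)) {0..1}"
      using R.cont_P Scont by (intro integrable_integral integrable_continuous_real continuous_intros)
    ultimately have "((\<lambda>t. (s + g t) - s - P t * S t) has_integral
        (\<phi> 1 - \<phi> 0) - s - integral {0..1} (\<lambda>t. P t * S t)) {0..1}"
      by (intro has_integral_diff)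
    then have rest: "((\<lambda>t. (P t)\<^sup>2 / s * (sin (\<phi> t))\<^sup>2) has_integral
        (\<phi> 1 - \<phi> 0) - s - integral {0..1} (\<lambda>t. P t * S t)) {0..1}"
      by (simp add: g_def S_def)
    have "\<bar>(\<phi> 1 - \<phi> 0) - s - integral {0..1} (\<lambda>t. P t * S t)\<bar> \<le> p\<^sup>2 / s"
    proof -
      have "(\<phi> 1 - \<phi> 0) - s - integral {0..1} (\<lambda>t. P t * S t) \<le> p\<^sup>2 / s"
        using Psq has_integral_const_real[of "p\<^sup>2 / s" 0 1] by (intro has_integral_le[OF rest]) auto
      moreover have "0 \<le> (\<phi> 1 - \<phi> 0) - s - integral {0..1} (\<lambda>t. P t * S t)"
        using s0 by (intro has_integral_nonneg[OF rest]) auto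
      ultimately show ?thesis by simp
    qed
    moreover have "\<phi> 1 = R.\<beta> s + of_nat n * pi"
      using R.eigenvalue_index_scale[OF s0, of l "int n"] R.ev[of n] l(1) by (simp add: \<phi>_def)
    moreover have "\<bar>\<phi> 0 - pi / 2\<bar> \<le> \<bar>h0\<bar> / s"
      using Arg_near_half_pi[OF s0, of "- h0"] R.angle(1)[OF s0] by (simp add: \<phi>_def)
    moreover have "\<bar>R.\<beta> s - pi / 2\<bar> \<le> \<bar>k\<bar> / s"
      using Arg_near_half_pi[OF s0, of "- k"] by (simp add: R.\<beta>_def)
    moreover have "C / s = p\<^sup>2 / s + (p + Nq) * M / s + \<bar>h0\<bar> / s + \<bar>k\<bar> / s"
      by (simp add: C_def add_divide_distrib)
    ultimately show ?thesis using osc by linarith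
  qed
  show thesis
  proof (rule that[OF C])
    fix n assume "sl_eigenvalue (h0, h, q) n \<ge> 1"
    then show "\<bar>sqrt (sl_eigenvalue (h0, h, q) n) - of_nat n * pi\<bar> \<le> C / sqrt (sl_eigenvalue (h0, h, q) n)"
      unfolding sl_eigenvalue_eq_ev P_def[symmetric] k_def[symmetric] by (intro est) auto
  qed
qed

lemma finite_sl_eigenvalue_less: "finite {n. sl_eigenvalue (h0, h, q) n < b}"
proof -
  interpret R: regular_problem "primitive q" h0 "h + primitive q 1" by (rule regular_problem_primitive)
  have "real n \<le> R.angle 1 b 1 / pi" if "sl_eigenvalue (h0, h, q) n < b" for n
  proof -
    have "R.\<beta> 1 + real n * pi < R.angle 1 b 1"
      using R.end_angle_strict_mono that by (simp add: sl_eigenvalue_eq_ev flip: R.ev)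
    then show ?thesis using R.\<beta>_bounds[of 1] by (simp add: pos_le_divide_eq)
  qed
  then have "{n. sl_eigenvalue (h0, h, q) n < b} \<subseteq> {..nat \<lfloor>R.angle 1 b 1 / pi\<rfloor>}"
    by (auto intro: le_nat_floor)
  then show ?thesis by (rule finite_subset) simp
qed

text \<open>
  Only finitely many indices escape the asymptotic estimates; taking a sum over them absorbs
  these in the constant.
\<close>

lemma bound_all_of_eventually:
  fixes f :: "nat \<Rightarrow> real"
  assumes "finite F" "\<And>n. n \<notin> F \<Longrightarrow> f n \<le> C" and "\<And>n. f n \<ge> 0"
  shows "f n \<le> \<bar>C\<bar> + sum f F"
proof (cases "n \<in> F")
  case True
  then have "f n \<le> sum f F" using assms by (intro member_le_sum) auto
  then show ?thesis by simp
next
  case False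
  then have "f n \<le> C" using assms(2) by auto
  then show ?thesis using sum_nonneg[of F f] assms(3) by (smt (verit))
qed

lemma sl_eigenvalue_asymptotics:
  obtains C where "\<And>n. \<bar>sl_eigenvalue (h0, h, q) n - (of_nat n * pi)\<^sup>2\<bar> \<le> C"
proof -
  obtain C where C: "C \<ge> 0" and sqrt_est: "\<And>n. sl_eigenvalue (h0, h, q) n \<ge> 1 \<Longrightarrow>
      \<bar>sqrt (sl_eigenvalue (h0, h, q) n) - of_nat n * pi\<bar> \<le> C / sqrt (sl_eigenvalue (h0, h, q) n)"
    using sqrt_eigenvalue_asymptotics[of h0 h q] by blast
  have "\<bar>sl_eigenvalue (h0, h, q) n - (of_nat n * pi)\<^sup>2\<bar> \<le> 2 * C + C\<^sup>2"
    if "n \<notin> {n. sl_eigenvalue (h0, h, q) n < 1}" for n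
  proof -
    define l where "l = sl_eigenvalue (h0, h, q) n"
    define s where "s = sqrt l"
    have l: "l \<ge> 1" using that by (simp add: l_def)
    then have s: "s \<ge> 1" "s\<^sup>2 = l" by (auto simp: s_def)
    have d: "\<bar>s - of_nat n * pi\<bar> \<le> C / s" using sqrt_est[of n] l by (simp add: l_def s_def)
    have "l - (of_nat n * pi)\<^sup>2 = (s - of_nat n * pi) * (2 * s - (s - of_nat n * pi))"
      unfolding s(2)[symmetric] by (simp add: algebra_simps power2_eq_square)
    also have "\<bar>\<dots>\<bar> \<le> (C / s) * (2 * s + C / s)"
      unfolding abs_mult using d s C by (intro mult_mono) auto
    also have "\<dots> = 2 * C + C\<^sup>2 / s\<^sup>2" using s(1) by (simp add: field_simps power2_eq_square)
    also have "\<dots> \<le> 2 * C + C\<^sup>2"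
    proof -
      have "C\<^sup>2 / s\<^sup>2 \<le> C\<^sup>2 / 1" using l s(2) by (intro divide_left_mono) auto
      then show ?thesis by simp
    qed
    finally show ?thesis by (simp add: l_def)
  qed
  then have "\<bar>sl_eigenvalue (h0, h, q) n - (of_nat n * pi)\<^sup>2\<bar> \<le> \<bar>2 * C + C\<^sup>2\<bar>
      + (\<Sum>n | sl_eigenvalue (h0, h, q) n < 1. \<bar>sl_eigenvalue (h0, h, q) n - (of_nat n * pi)\<^sup>2\<bar>)" for n
    by (rule bound_all_of_eventually[OF finite_sl_eigenvalue_less]) auto
  then show thesis by (rule that)
qed

section \<open>Uniform bounds on the normalized eigenfunctions\<close>

lemma sl_eigenfunction_continuous: "sl_eigenfunction (h0, h, q) l u \<Longrightarrow> continuous_on {0..1} u"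
  unfolding sl_eigenfunction_iff_system by (auto dest: sl_system_continuous(1))

lemma sl_eigenfunction_norm_pos:
  assumes "sl_eigenfunction (h0, h, q) l u" shows "norm (abs_l2 u) > 0"
proof -
  have c: "continuous_on {0..1} u" by (rule sl_eigenfunction_continuous[OF assms])
  then have c2: "continuous_on {0..1} (\<lambda>x. (u x)\<^sup>2)" by (intro continuous_intros)
  obtain x where "x \<in> {0..1}" "u x \<noteq> 0"
    using assms unfolding sl_eigenfunction_iff_system by blast
  then have "\<not> (\<forall>x\<in>{0..1}. (u x)\<^sup>2 = 0)" by force
  then have "integral {0..1} (\<lambda>x. (u x)\<^sup>2) \<noteq> 0"
    using integral_eq_0_iff[OF c2 zero_less_one] by simp
  moreover have "integral {0..1} (\<lambda>x. (u x)\<^sup>2) \<ge> 0"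
    using c2 by (intro Henstock_Kurzweil_Integration.integral_nonneg integrable_continuous_real) auto
  ultimately have "integral {0..1} (\<lambda>x. (u x)\<^sup>2) > 0" by linarith
  then show ?thesis unfolding norm_abs_l2_continuous[OF c] by (rule real_sqrt_gt_zero)
qed

lemma sl_eigenfunction_scale:
  assumes "sl_eigenfunction (h0, h, q) l u" "c \<noteq> 0"
  shows "sl_eigenfunction (h0, h, q) l (\<lambda>x. c * u x)"
proof -
  obtain w where nz: "\<exists>x\<in>{0..1}. u x \<noteq> 0" and w: "sl_system (primitive q) l u w" "w 0 = - h0 * u 0" "w 1 = - (h + primitive q 1) * u 1"
    using assms(1) unfolding sl_eigenfunction_iff_system by blast
  have "sl_system (primitive q) l (\<lambda>x. c * u x) (\<lambda>x. c * w x)"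
    using sl_system_linear[OF w(1) w(1), of c 0] by simp
  then show ?thesis
    unfolding sl_eigenfunction_iff_system using nz w assms(2) by (intro conjI exI[of _ "\<lambda>x. c * w x"]) auto
qed

lemma sl_normalized:
  "sl_eigenfunction (h0, h, q) (sl_eigenvalue (h0, h, q) n) (sl_normalized (h0, h, q) n)"
  "norm (abs_l2 (sl_normalized (h0, h, q) n)) = 1"
proof -
  let ?l = "sl_eigenvalue (h0, h, q) n"
  have "?l \<in> sl_spectrum (h0, h, q)" using sl_eigenvalue_enumerates_spectrum(2)[of h0 h q] by blast
  then obtain u where u: "sl_eigenfunction (h0, h, q) ?l u" by (auto simp: sl_spectrum_def)
  define c where "c = 1 / norm (abs_l2 u)"
  have c: "c > 0" using sl_eigenfunction_norm_pos[OF u] by (simp add: c_def)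
  have "abs_l2 (\<lambda>x. c * u x) = c *\<^sub>R abs_l2 u"
    by (rule abs_l2_scaleR[OF sl_eigenfunction_continuous[OF u], symmetric])
  then have "norm (abs_l2 (\<lambda>x. c * u x)) = 1"
    using c sl_eigenfunction_norm_pos[OF u] by (simp add: c_def)
  then have "sl_eigenfunction (h0, h, q) ?l (\<lambda>x. c * u x) \<and> norm (abs_l2 (\<lambda>x. c * u x)) = 1"
    using sl_eigenfunction_scale[OF u, of c] c by simp
  from someI[where P = "\<lambda>u. sl_eigenfunction (h0, h, q) ?l u \<and> norm (abs_l2 u) = 1", OF this]
  show "sl_eigenfunction (h0, h, q) ?l (sl_normalized (h0, h, q) n)"
    "norm (abs_l2 (sl_normalized (h0, h, q) n)) = 1"
    unfolding sl_normalized_def by auto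
qed

text \<open>
  The energy \<open>l u\<^sup>2 + w\<^sup>2\<close> varies only by a factor \<open>exp K\<close> that does not depend on \<open>l\<close>. For large \<open>l\<close>
  its mean is of order \<open>l\<close> for a normalized eigenfunction, because the means of \<open>w\<^sup>2\<close> and \<open>(l + P\<^sup>2) u\<^sup>2\<close> differ
  only by boundary terms; so \<open>u\<^sup>2\<close> is bounded.
\<close>

lemma normalized_eigenfunction_bound_large:
  obtains L B where "\<And>l u x. \<lbrakk>l \<ge> L; sl_eigenfunction (h0, h, q) l u; norm (abs_l2 u) = 1; x \<in> {0..1}\<rbrakk>
    \<Longrightarrow> \<bar>u x\<bar> \<le> B"
proof -
  define P where "P = primitive q"
  define k where "k = h + P 1"
  have Pcont: "continuous_on {0..1} P" unfolding P_def by (rule continuous_on_primitive)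
  obtain p where p: "p > 0" "\<And>x. x \<in> {0..1} \<Longrightarrow> \<bar>P x\<bar> \<le> p"
    using continuous_bound_unit[OF Pcont] by blast
  define K where "K = 2 * p + p\<^sup>2"
  define G where "G = exp K"
  define b where "b = \<bar>h0\<bar> + \<bar>k\<bar>"
  \<comment> \<open>from \<open>L\<close> on, the boundary terms are at most half of the lower bound \<open>E 0 / G\<close> for the mean energy\<close>
  define L where "L = max 1 (2 * b * G\<^sup>2)"
  have G: "G > 0" by (simp add: G_def)
  have b: "b \<ge> 0" by (simp add: b_def)
  have "(u x)\<^sup>2 \<le> 2 * G\<^sup>2 * (2 + p\<^sup>2)"
    if l: "l \<ge> L" and u: "sl_eigenfunction (h0, h, q) l u" and norm: "norm (abs_l2 u) = 1"
      and x: "x \<in> {0..1}" for l u x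
  proof -
    have l1: "l \<ge> 1" and lb: "l \<ge> 2 * b * G\<^sup>2" using l by (auto simp: L_def)
    obtain w where sys: "sl_system P l u w" and bc: "w 0 = - h0 * u 0" "w 1 = - k * u 1"
      using u unfolding sl_eigenfunction_iff_system P_def k_def by blast
    have cont: "continuous_on {0..1} u" "continuous_on {0..1} w" using sl_system_continuous[OF sys] by auto
    define E where "E = (\<lambda>x. l * (u x)\<^sup>2 + (w x)\<^sup>2)"
    define E' where "E' = (\<lambda>x. 2 * P x * (l * (u x)\<^sup>2 - (w x)\<^sup>2) - (P x)\<^sup>2 * (2 * (u x * w x)))"
    have der: "(E has_real_derivative E' t) (at t within {0..1})" if "t \<in> {0..1}" for t
      unfolding E_def E'_def
      by (auto intro!: derivative_eq_intros sl_system_deriv[OF sys that] simp: algebra_simps power2_eq_square)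
    have bound: "\<bar>E' t\<bar> \<le> K * E t + 0" if t: "t \<in> {0..1}" for t
    proof -
      have Psq: "\<bar>(P t)\<^sup>2\<bar> \<le> p\<^sup>2" using p(2)[OF t] p(1) by (simp add: abs_le_square_iff[symmetric])
      have "2 * \<bar>u t * w t\<bar> \<le> (u t)\<^sup>2 + (w t)\<^sup>2"
        using sum_squares_bound[of "\<bar>u t\<bar>" "\<bar>w t\<bar>"] by (simp add: abs_mult mult.assoc)
      also have "\<dots> \<le> E t" using l1 by (simp add: E_def mult_le_cancel_right1)
      finally have "\<bar>2 * (u t * w t)\<bar> \<le> E t" by (simp add: abs_mult)
      then have 1: "\<bar>(P t)\<^sup>2 * (2 * (u t * w t))\<bar> \<le> p\<^sup>2 * E t"
        unfolding abs_mult[of "(P t)\<^sup>2"] using Psq by (intro mult_mono) auto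
      have lu: "0 \<le> l * (u t)\<^sup>2" using l1 by simp
      have "\<bar>l * (u t)\<^sup>2 - (w t)\<^sup>2\<bar> \<le> E t" using lu by (simp add: E_def abs_le_iff)
      then have 2: "\<bar>2 * P t * (l * (u t)\<^sup>2 - (w t)\<^sup>2)\<bar> \<le> 2 * p * E t"
        unfolding abs_mult[of "2 * P t"] using p(2)[OF t] by (intro mult_mono) auto
      have "\<bar>E' t\<bar> \<le> 2 * p * E t + p\<^sup>2 * E t" unfolding E'_def using 1 2 by linarith
      then show ?thesis by (simp add: K_def distrib_right)
    qed
    have comp: "E x \<le> G * E y" if "x \<in> {0..1}" "y \<in> {0..1}" for x y
    proof -
      have "E x \<le> exp K * (E y + 0)"
      proof (rule gronwall_two_sided[OF der bound])
        show "E t \<ge> 0" for t using l1 by (simp add: E_def)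
        show "K \<ge> 0" using p(1) by (simp add: K_def)
      qed (use that in auto)
      then show ?thesis by (simp add: G_def)
    qed
    have usq: "l * (u y)\<^sup>2 \<le> G * E 0" if "y \<in> {0..1}" for y
      using comp[of y 0] that by (simp add: E_def) (smt (verit) zero_le_power2)
    have int_u: "integral {0..1} (\<lambda>t. (u t)\<^sup>2) = 1"
      using norm unfolding norm_abs_l2_continuous[OF cont(1)] by simp
    have cu: "(\<lambda>t. (u t)\<^sup>2) integrable_on {0..1}" and cw: "(\<lambda>t. (w t)\<^sup>2) integrable_on {0..1}"
      using cont by (auto intro!: integrable_continuous_real continuous_intros)
    have "((\<lambda>t. (w t)\<^sup>2 - (l + (P t)\<^sup>2) * (u t)\<^sup>2) has_integral u 1 * w 1 - u 0 * w 0) {0..1}"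
    proof (rule has_integral_derivative_unit)
      fix t :: real assume t: "t \<in> {0..1}"
      show "((\<lambda>t. u t * w t) has_real_derivative (w t)\<^sup>2 - (l + (P t)\<^sup>2) * (u t)\<^sup>2) (at t within {0..1})"
        by (auto intro!: derivative_eq_intros sl_system_deriv[OF sys t] simp: algebra_simps power2_eq_square)
    qed auto
    from has_integral_diff[OF integrable_integral[OF cw] this]
    have "((\<lambda>t. (l + (P t)\<^sup>2) * (u t)\<^sup>2) has_integral
        integral {0..1} (\<lambda>t. (w t)\<^sup>2) - (u 1 * w 1 - u 0 * w 0)) {0..1}" by simp
    moreover have "((\<lambda>t. (l + p\<^sup>2) * (u t)\<^sup>2) has_integral (l + p\<^sup>2) * 1) {0..1}"
      using has_integral_mult_right[OF integrable_integral[OF cu], of "l + p\<^sup>2"] int_u by simp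
    moreover have "(l + (P t)\<^sup>2) * (u t)\<^sup>2 \<le> (l + p\<^sup>2) * (u t)\<^sup>2" if "t \<in> {0..1}" for t
      using p(2)[OF that] p(1) by (intro mult_right_mono add_left_mono) (auto simp: abs_le_square_iff[symmetric])
    ultimately have int_w: "integral {0..1} (\<lambda>t. (w t)\<^sup>2) - (u 1 * w 1 - u 0 * w 0) \<le> (l + p\<^sup>2) * 1"
      by (rule has_integral_le)
    have "E 0 / G \<le> integral {0..1} E"
    proof -
      have "E 0 / G \<le> E t" if "t \<in> {0..1}" for t
        using comp[of 0 t] that G by (simp add: pos_divide_le_eq mult.commute)
      moreover have "E integrable_on {0..1}"
        unfolding E_def using cont by (intro integrable_continuous_real continuous_intros)
      ultimately have "integral {0..1::real} (\<lambda>t. E 0 / G) \<le> integral {0..1} E"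
        by (intro Henstock_Kurzweil_Integration.integral_le) auto
      then show ?thesis by simp
    qed
    also have "integral {0..1} E = l * 1 + integral {0..1} (\<lambda>t. (w t)\<^sup>2)"
    proof -
      have "integral {0..1} E = integral {0..1} (\<lambda>t. l * (u t)\<^sup>2) + integral {0..1} (\<lambda>t. (w t)\<^sup>2)"
        unfolding E_def using cu cw
        by (intro Henstock_Kurzweil_Integration.integral_add integrable_on_mult_right)
      then show ?thesis using int_u by simp
    qed
    also have "\<dots> \<le> 2 * l + p\<^sup>2 + (u 1 * w 1 - u 0 * w 0)" using int_w by simp
    also have "u 1 * w 1 - u 0 * w 0 \<le> b * (G * E 0 / l)"
    proof -
      have sq: "(u y)\<^sup>2 \<le> G * E 0 / l" if "y \<in> {0..1}" for y
        using usq[OF that] l1 by (simp add: pos_le_divide_eq mult.commute)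
      have "u 1 * w 1 - u 0 * w 0 = h0 * (u 0)\<^sup>2 + (- k) * (u 1)\<^sup>2"
        using bc by (simp add: power2_eq_square)
      also have "\<dots> \<le> \<bar>h0\<bar> * (G * E 0 / l) + \<bar>k\<bar> * (G * E 0 / l)"
        using sq[of 0] sq[of 1] by (intro add_mono mult_mono) auto
      finally show ?thesis unfolding b_def distrib_right .
    qed
    also have "b * (G * E 0 / l) \<le> E 0 / (2 * G)"
    proof -
      have "E 0 \<ge> 0" using l1 by (simp add: E_def)
      then have "2 * b * G\<^sup>2 * E 0 \<le> l * E 0" using lb by (intro mult_right_mono)
      then show ?thesis using l1 G by (simp add: field_simps power2_eq_square)
    qed
    finally have "E 0 / G \<le> 2 * l + p\<^sup>2 + E 0 / (2 * G)" by simp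
    then have "E 0 \<le> 2 * G * (2 * l + p\<^sup>2)" using G by (simp add: field_simps)
    then have "l * (u x)\<^sup>2 \<le> G * (2 * G * (2 * l + p\<^sup>2))"
      using usq[OF x] G by (meson mult_left_mono order_trans less_imp_le)
    also have "\<dots> \<le> G * (2 * G * (2 * l + l * p\<^sup>2))"
      using l1 G by (intro mult_left_mono add_left_mono) (auto simp: mult_le_cancel_right1)
    also have "\<dots> = l * (2 * G\<^sup>2 * (2 + p\<^sup>2))" by (simp add: algebra_simps power2_eq_square)
    finally show ?thesis using l1 by simp
  qed
  then have "\<bar>u x\<bar> \<le> sqrt (2 * G\<^sup>2 * (2 + p\<^sup>2))"
    if "l \<ge> L" "sl_eigenfunction (h0, h, q) l u" "norm (abs_l2 u) = 1" "x \<in> {0..1}" for l u x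
    using that by (metis real_sqrt_abs real_sqrt_le_iff)
  then show thesis by (rule that)
qed

lemma sl_normalized_bounded:
  obtains B where "\<And>n x. x \<in> {0..1} \<Longrightarrow> \<bar>sl_normalized (h0, h, q) n x\<bar> \<le> B"
proof -
  define g where "g = sl_normalized (h0, h, q)"
  define S where "S n = (SUP x\<in>{0..1}. \<bar>g n x\<bar>)" for n
  have bdd: "bdd_above ((\<lambda>x. \<bar>g n x\<bar>) ` {0..1})" for n
  proof -
    have "continuous_on {0..1} (\<lambda>x. \<bar>g n x\<bar>)"
      unfolding g_def by (intro continuous_intros sl_eigenfunction_continuous[OF sl_normalized(1)])
    then show ?thesis by (intro bounded_imp_bdd_above compact_imp_bounded compact_continuous_image) auto
  qed
  have le_S: "\<bar>g n x\<bar> \<le> S n" if "x \<in> {0..1}" for n x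
    unfolding S_def by (rule cSUP_upper[OF that bdd])
  obtain L B where LB: "\<And>l u x. \<lbrakk>l \<ge> L; sl_eigenfunction (h0, h, q) l u; norm (abs_l2 u) = 1; x \<in> {0..1}\<rbrakk>
    \<Longrightarrow> \<bar>u x\<bar> \<le> B"
    using normalized_eigenfunction_bound_large[of h0 h q] by blast
  have "S n \<le> B" if "n \<notin> {n. sl_eigenvalue (h0, h, q) n < L}" for n
    unfolding S_def using LB[OF _ sl_normalized] that by (intro cSUP_least) (auto simp: g_def)
  moreover have "S n \<ge> 0" for n using le_S[of 0 n] abs_ge_zero[of "g n 0"] by auto
  ultimately have "S n \<le> \<bar>B\<bar> + sum S {n. sl_eigenvalue (h0, h, q) n < L}" for n
    by (rule bound_all_of_eventually[OF finite_sl_eigenvalue_less])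
  then show thesis using that le_S unfolding g_def by (meson order_trans)
qed

section \<open>Moving a single eigenvalue\<close>

lemma sl_system_cong:
  assumes "sl_system P l u w" "\<And>x. x \<in> {0..1} \<Longrightarrow> Q x = P x" shows "sl_system Q l u w"
  using assms unfolding sl_system_def by simp

lemma sl_spectrum_iff_left_solution:
  assumes sys: "sl_system (primitive q) n f g" and init: "f 0 = 1" "g 0 = - h0"
  shows "n \<in> sl_spectrum (h0, h, q) \<longleftrightarrow> g 1 + (h + primitive q 1) * f 1 = 0"
proof -
  interpret R: regular_problem "primitive q" h0 "h + primitive q 1" by (rule regular_problem_primitive)
  have "R.U n 1 = f 1" "R.W n 1 = g 1"
    using sl_system_unique[OF R.cont_P R.UW(1)[of n] sys, of 0 1] init by (auto simp: R.UW)
  then have "n \<in> sl_spectrum (h0, h, q) \<longleftrightarrow> g 1 = - (h + primitive q 1) * f 1"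
    unfolding sl_spectrum_eq_eigenvalues R.eigenvalues_def mem_Collect_eq by simp
  also have "\<dots> \<longleftrightarrow> g 1 + (h + primitive q 1) * f 1 = 0"
    by (intro iffI) linarith+
  finally show ?thesis .
qed

text \<open>
  The double commutation method of Darboux and Crum. Given solutions \<open>z\<close> at \<open>l\<close> and \<open>v\<close> at \<open>m\<close> whose
  Wronskian \<open>Wr\<close> has no zero, the potential \<open>q - 2 (log Wr)''\<close> has, at every \<open>n\<close>, the explicit
  solution \<open>f - (m - l) v I / Wr\<close>, where \<open>f\<close> solves the original equation at \<open>n\<close> with the same left boundary
  condition as \<open>z\<close>, and \<open>I\<close> is the integral of \<open>z f\<close> from 0. Here \<open>\<tau>\<close> is \<open>(log Wr)'\<close>, and \<open>d\<tau>\<close> its derivative.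
\<close>

locale darboux =
  fixes q :: l2 and l m :: real and v wv z wz :: "real \<Rightarrow> real"
  assumes v: "sl_system (primitive q) m v wv" and z: "sl_system (primitive q) l z wz"
    and Wr_nonzero: "\<And>x. x \<in> {0..1} \<Longrightarrow> v x * wz x - wv x * z x \<noteq> 0"
begin

abbreviation "P \<equiv> primitive q"

definition Wr where "Wr x = v x * wz x - wv x * z x"
definition \<tau> where "\<tau> x = (m - l) * (v x * z x) / Wr x"
definition d\<tau> where
  "d\<tau> x = (m - l) * ((P x * v x + wv x) * z x + v x * (P x * z x + wz x)) / Wr x - (\<tau> x)\<^sup>2"
definition new_q where "new_q = q + abs_l2 (\<lambda>x. - 2 * d\<tau> x)"

lemma Wr: "x \<in> {0..1} \<Longrightarrow> Wr x \<noteq> 0"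
  using Wr_nonzero by (simp add: Wr_def)

lemma Wr_deriv: "x \<in> {0..1} \<Longrightarrow> (Wr has_real_derivative (m - l) * (v x * z x)) (at x within {0..1})"
  unfolding Wr_def[abs_def] by (rule wronskian_deriv[OF v z])

lemma continuous_solutions:
  "continuous_on {0..1} v" "continuous_on {0..1} wv" "continuous_on {0..1} z" "continuous_on {0..1} wz"
  using sl_system_continuous[OF v] sl_system_continuous[OF z] by auto

lemma \<tau>_deriv:
  assumes x: "x \<in> {0..1}" shows "(\<tau> has_real_derivative d\<tau> x) (at x within {0..1})"
proof -
  have "(\<tau> has_real_derivative ((m - l) * ((P x * v x + wv x) * z x + v x * (P x * z x + wz x)) * Wr x
      - (m - l) * (v x * z x) * ((m - l) * (v x * z x))) / (Wr x * Wr x)) (at x within {0..1})"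
    unfolding \<tau>_def[abs_def] using Wr[OF x]
    by (auto intro!: derivative_eq_intros sl_system_deriv[OF v x] sl_system_deriv[OF z x] Wr_deriv[OF x]
        simp: algebra_simps)
  also have "((m - l) * ((P x * v x + wv x) * z x + v x * (P x * z x + wz x)) * Wr x
      - (m - l) * (v x * z x) * ((m - l) * (v x * z x))) / (Wr x * Wr x) = d\<tau> x"
    using Wr[OF x] by (simp add: d\<tau>_def \<tau>_def diff_divide_distrib power2_eq_square)
  finally show ?thesis .
qed

lemma continuous_d\<tau>: "continuous_on {0..1} d\<tau>"
proof -
  have "continuous_on {0..1} Wr" using Wr_deriv by (rule DERIV_continuous_on)
  moreover have "continuous_on {0..1} \<tau>" using \<tau>_deriv by (rule DERIV_continuous_on)
  ultimately show ?thesis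
    unfolding d\<tau>_def[abs_def] using continuous_solutions continuous_on_primitive[of q] Wr
    by (intro continuous_intros) auto
qed

lemma primitive_new_q:
  assumes x: "x \<in> {0..1}" shows "primitive new_q x = P x - 2 * (\<tau> x - \<tau> 0)"
proof -
  have "((\<lambda>x. - 2 * d\<tau> x) has_integral (- 2 * \<tau> x) - (- 2 * \<tau> 0)) {0..x}"
    by (rule has_integral_derivative_unit[OF DERIV_cmult[OF \<tau>_deriv] x])
  then have "integral {0..x} (\<lambda>x. - 2 * d\<tau> x) = - 2 * \<tau> x - (- 2 * \<tau> 0)" by (rule integral_unique)
  moreover have "continuous_on {0..1} (\<lambda>x. - 2 * d\<tau> x)" by (intro continuous_intros continuous_d\<tau>)
  ultimately show ?thesis
    unfolding new_q_def using primitive_add_continuous[OF _ x] by simp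
qed

text \<open>
  The transformed solution is \<open>F = f + (m - l) v s\<close> with \<open>s = - I / Wr\<close>, and its quasi-derivative is
  \<open>G + (\<tau> - 2 \<tau>(0)) F\<close> with \<open>G = g + (m - l) wv s\<close>. The differential equation for the latter comes
  down to Green's identity for \<open>z\<close> and \<open>f\<close>.
\<close>

lemma transformed_system:
  assumes f: "sl_system P n f g" and I: "\<And>x. x \<in> {0..1} \<Longrightarrow> (I has_real_derivative z x * f x) (at x within {0..1})"
    and green: "\<And>x. x \<in> {0..1} \<Longrightarrow> (l - n) * I x = z x * g x - wz x * f x"
  defines "F \<equiv> \<lambda>x. f x - (m - l) * v x * (I x / Wr x)"
    and "G \<equiv> \<lambda>x. g x - (m - l) * wv x * (I x / Wr x)"
  shows "sl_system (primitive new_q) n F (\<lambda>x. G x + (\<tau> x - 2 * \<tau> 0) * F x)"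
proof -
  define Q where "Q = (\<lambda>x. P x - 2 * (\<tau> x - \<tau> 0))"
  define s where "s = (\<lambda>x. - I x / Wr x)"
  have F: "F = (\<lambda>x. f x + (m - l) * v x * s x)" and G: "G = (\<lambda>x. g x + (m - l) * wv x * s x)"
    by (simp_all add: F_def G_def s_def)
  have s': "(s has_real_derivative - z x * f x / Wr x - s x * \<tau> x) (at x within {0..1})" if x: "x \<in> {0..1}" for x
  proof -
    have "(s has_real_derivative (- (z x * f x) * Wr x - (- I x) * ((m - l) * (v x * z x))) / (Wr x * Wr x)) (at x within {0..1})"
      unfolding s_def using Wr[OF x] by (intro DERIV_divide DERIV_minus I Wr_deriv x) auto
    also have "(- (z x * f x) * Wr x - (- I x) * ((m - l) * (v x * z x))) / (Wr x * Wr x) = - z x * f x / Wr x - s x * \<tau> x"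
      using Wr[OF x] by (simp add: s_def \<tau>_def diff_divide_distrib add_divide_distrib)
    finally show ?thesis .
  qed
  have F': "(F has_real_derivative (P x - \<tau> x) * F x + G x) (at x within {0..1})" if x: "x \<in> {0..1}" for x
  proof -
    have "(F has_real_derivative (P x * f x + g x) + (m - l) * ((P x * v x + wv x) * s x
        + v x * (- z x * f x / Wr x - s x * \<tau> x))) (at x within {0..1})"
    proof -
      define ds where "ds = - z x * f x / Wr x - s x * \<tau> x"
      have "(s has_real_derivative ds) (at x within {0..1})" unfolding ds_def by (rule s'[OF x])
      then show ?thesis
        unfolding F ds_def[symmetric]
        by (auto intro!: derivative_eq_intros sl_system_deriv[OF f x] sl_system_deriv[OF v x] simp: algebra_simps)
    qed
    also have "(P x * f x + g x) + (m - l) * ((P x * v x + wv x) * s x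
        + v x * (- z x * f x / Wr x - s x * \<tau> x)) = (P x - \<tau> x) * F x + G x"
    proof -
      define i where "i = inverse (Wr x)"
      have "a / Wr x = a * i" for a by (simp add: i_def divide_inverse)
      then show ?thesis by (simp add: F G \<tau>_def algebra_simps)
    qed
    finally show ?thesis .
  qed
  define G' where "G' x = - P x * G x - (P x)\<^sup>2 * F x - n * f x - (m - l) * m * v x * s x
      - (m - l) * wv x * z x * f x / Wr x - \<tau> x * ((m - l) * wv x * s x)" for x
  have G': "(G has_real_derivative G' x) (at x within {0..1})" if x: "x \<in> {0..1}" for x
  proof -
    have "(G has_real_derivative (- (n + (P x)\<^sup>2) * f x - P x * g x) + (m - l) * ((- (m + (P x)\<^sup>2) * v x - P x * wv x) * s x
        + wv x * (- z x * f x / Wr x - s x * \<tau> x))) (at x within {0..1})"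
    proof -
      define ds where "ds = - z x * f x / Wr x - s x * \<tau> x"
      have "(s has_real_derivative ds) (at x within {0..1})" unfolding ds_def by (rule s'[OF x])
      then show ?thesis
        unfolding G ds_def[symmetric]
        by (auto intro!: derivative_eq_intros sl_system_deriv[OF f x] sl_system_deriv[OF v x] simp: algebra_simps)
    qed
    also have "(- (n + (P x)\<^sup>2) * f x - P x * g x) + (m - l) * ((- (m + (P x)\<^sup>2) * v x - P x * wv x) * s x
        + wv x * (- z x * f x / Wr x - s x * \<tau> x)) = G' x"
    proof -
      define i where "i = inverse (Wr x)"
      have "a / Wr x = a * i" for a by (simp add: i_def divide_inverse)
      then show ?thesis by (simp add: G'_def F G algebra_simps power2_eq_square)
    qed
    finally show ?thesis .
  qed
  have "((\<lambda>x. G x + (\<tau> x - 2 * \<tau> 0) * F x) has_real_derivative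
      - (n + (Q x)\<^sup>2) * F x - Q x * (G x + (\<tau> x - 2 * \<tau> 0) * F x)) (at x within {0..1})" if x: "x \<in> {0..1}" for x
  proof -
    have der: "((\<lambda>x. G x + (\<tau> x - 2 * \<tau> 0) * F x) has_real_derivative
        G' x + (d\<tau> x * F x + (\<tau> x - 2 * \<tau> 0) * ((P x - \<tau> x) * F x + G x))) (at x within {0..1})"
      by (auto intro!: derivative_eq_intros G'[OF x] F'[OF x] \<tau>_deriv[OF x] simp: algebra_simps)
    define i where "i = 1 / Wr x"
    have di: "a / Wr x = a * i" for a by (simp add: i_def)
    have iW: "i * (v x * wz x - wv x * z x) = 1" using Wr[OF x] by (simp add: i_def Wr_def)
    have si: "(n - l) * s x = i * (z x * g x - wz x * f x)"
      unfolding green[OF x, symmetric] s_def i_def using Wr[OF x] by (simp add: field_simps)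
    have \<tau>i: "\<tau> x = (m - l) * v x * z x * i" by (simp add: \<tau>_def i_def)
    have d\<tau>i: "d\<tau> x = 2 * P x * \<tau> x + (m - l) * (wv x * z x + v x * wz x) * i - (\<tau> x)\<^sup>2"
      by (simp add: d\<tau>_def \<tau>i) (simp add: i_def algebra_simps add_divide_distrib diff_divide_distrib)
    have "G' x + (d\<tau> x * F x + (\<tau> x - 2 * \<tau> 0) * ((P x - \<tau> x) * F x + G x))
        - (- (n + (Q x)\<^sup>2) * F x - Q x * (G x + (\<tau> x - 2 * \<tau> 0) * F x))
      = G' x + (d\<tau> x + n) * F x + (P x - \<tau> x) * ((P x - \<tau> x) * F x + G x)"
      by (simp add: Q_def algebra_simps power2_eq_square)
    also have "\<dots> = - \<tau> x * G x - n * f x - (m - l) * m * v x * s x - (m - l) * wv x * z x * f x * i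
        - \<tau> x * ((m - l) * wv x * s x) + (m - l) * (wv x * z x + v x * wz x) * i * F x + n * F x"
      unfolding d\<tau>i by (simp add: G'_def di algebra_simps power2_eq_square)
    also have "\<dots> = (m - l) * v x * s x * (n - m) - (m - l) * v x * (i * (z x * g x - wz x * f x))
        + (m - l)\<^sup>2 * v x * s x * (i * (v x * wz x - wv x * z x))"
      unfolding \<tau>i F G by (simp add: algebra_simps power2_eq_square)
    also have "\<dots> = 0"
      unfolding iW si[symmetric] by (simp add: algebra_simps power2_eq_square)
    finally show ?thesis using der by simp
  qed
  moreover have "(F has_real_derivative Q x * F x + (G x + (\<tau> x - 2 * \<tau> 0) * F x)) (at x within {0..1})"
    if "x \<in> {0..1}" for x
    using F'[OF that] by (simp add: Q_def algebra_simps)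
  ultimately have "sl_system Q n F (\<lambda>x. G x + (\<tau> x - 2 * \<tau> 0) * F x)"
    by (simp add: sl_system_def)
  then show ?thesis
    by (rule sl_system_cong) (simp add: primitive_new_q Q_def)
qed

text \<open>
  Both boundary conditions at 1 can be read off from the transformed left solution. If \<open>v\<close> satisfies
  the condition with coefficient \<open>k\<close>, the correction term drops out of that condition. If \<open>z\<close> satisfies the
  condition with coefficient \<open>h\<close>, the condition for \<open>n\<close> is \<open>(l - n) I(1) = 0\<close> before and \<open>(m - n) I(1) = 0\<close> after the
  transformation, and \<open>I(1)\<close> is positive for \<open>n = l\<close>.
\<close>

lemma new_spectra:
  assumes z0: "z 0 = 1" "wz 0 = - h0" and z1: "wz 1 = - (h + P 1) * z 1"
    and v1: "wv 1 = - (k + P 1) * v 1"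
  shows "sl_spectrum (h0 + \<tau> 0, h + \<tau> 1, new_q) = insert m (sl_spectrum (h0, h, q) - {l})"
    and "sl_spectrum (h0 + \<tau> 0, k + \<tau> 1, new_q) = sl_spectrum (h0, k, q)"
proof -
  interpret R: regular_problem P h0 k by (rule regular_problem_primitive)
  define I where "I = (\<lambda>n x. integral {0..x} (\<lambda>t. z t * R.U n t))"
  have I: "(I n has_real_derivative z x * R.U n x) (at x within {0..1})" if "x \<in> {0..1}" for n x
    unfolding I_def using continuous_solutions(3) R.continuous_UW(1)[of n] that
    by (intro integral_has_real_derivative continuous_intros) auto
  have green: "(l - n) * I n x = z x * R.W n x - wz x * R.U n x" if x: "x \<in> {0..1}" for n x
  proof -
    have "((\<lambda>t. (l - n) * (z t * R.U n t)) has_integral z x * R.W n x - wz x * R.U n x) {0..x}"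
      using greens_identity[OF z R.UW(1)[of n] x] z0 by (simp add: R.UW)
    then have "integral {0..x} (\<lambda>t. (l - n) * (z t * R.U n t)) = z x * R.W n x - wz x * R.U n x"
      by (rule integral_unique)
    then show ?thesis by (simp add: I_def)
  qed
  define F where "F n x = R.U n x - (m - l) * v x * (I n x / Wr x)" for n x
  define G where "G n x = R.W n x - (m - l) * wv x * (I n x / Wr x)" for n x
  have sys: "sl_system (primitive new_q) n (F n) (\<lambda>x. G n x + (\<tau> x - 2 * \<tau> 0) * F n x)" for n
    using transformed_system[OF R.UW(1) I green, of n] unfolding F_def[abs_def] G_def[abs_def] .
  have init: "F n 0 = 1" "G n 0 + (\<tau> 0 - 2 * \<tau> 0) * F n 0 = - (h0 + \<tau> 0)" for n
    by (simp_all add: F_def G_def I_def R.UW)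
  have new: "n \<in> sl_spectrum (h0 + \<tau> 0, c + \<tau> 1, new_q) \<longleftrightarrow> G n 1 + (c + P 1) * F n 1 = 0" for n c
  proof -
    have "n \<in> sl_spectrum (h0 + \<tau> 0, c + \<tau> 1, new_q) \<longleftrightarrow>
        (G n 1 + (\<tau> 1 - 2 * \<tau> 0) * F n 1) + (c + \<tau> 1 + primitive new_q 1) * F n 1 = 0"
      by (rule sl_spectrum_iff_left_solution[OF sys init])
    also have "(G n 1 + (\<tau> 1 - 2 * \<tau> 0) * F n 1) + (c + \<tau> 1 + primitive new_q 1) * F n 1
        = G n 1 + (c + P 1) * F n 1"
      by (simp add: primitive_new_q algebra_simps)
    finally show ?thesis .
  qed
  have old: "n \<in> sl_spectrum (h0, c, q) \<longleftrightarrow> R.W n 1 + (c + P 1) * R.U n 1 = 0" for n c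
    by (rule sl_spectrum_iff_left_solution[OF R.UW])
  have expand: "G n 1 + (c + P 1) * F n 1 = R.W n 1 + (c + P 1) * R.U n 1
      - (m - l) * ((c - k) * v 1) * (I n 1 / Wr 1)" for n c
  proof -
    define X where "X = I n 1 / Wr 1"
    show ?thesis unfolding G_def F_def X_def[symmetric] v1 by (simp add: algebra_simps)
  qed
  have "G n 1 + (k + P 1) * F n 1 = R.W n 1 + (k + P 1) * R.U n 1" for n
    using expand[of n k] by simp
  then show "sl_spectrum (h0 + \<tau> 0, k + \<tau> 1, new_q) = sl_spectrum (h0, k, q)"
    using new[of _ k] old[of _ k] by auto
  have Wr1: "Wr 1 = v 1 * z 1 * (k - h)"
    unfolding Wr_def z1 v1 by (simp add: algebra_simps)
  then have z1_nz: "z 1 \<noteq> 0" using Wr[of 1] by auto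
  have Il: "I l 1 > 0"
  proof -
    have "R.U l x = z x" if "x \<in> {0..1}" for x
      using sl_system_unique(1)[OF R.cont_P R.UW(1)[of l] z, of 0 x] that z0 by (auto simp: R.UW)
    then have "I l 1 = integral {0..1} (\<lambda>t. R.U l t * R.U l t)"
      unfolding I_def by (intro integral_cong) auto
    then show ?thesis using R.U_square_integral_pos[of l] by simp
  qed
  have Wn: "z 1 * (R.W n 1 + (h + P 1) * R.U n 1) = (l - n) * I n 1" for n
    using green[of 1 n] z1 by (simp add: algebra_simps)
  have "n \<in> sl_spectrum (h0, h, q) \<longleftrightarrow> (l - n) * I n 1 = 0" for n
    unfolding old Wn[symmetric] using z1_nz by simp
  moreover have "n \<in> sl_spectrum (h0 + \<tau> 0, h + \<tau> 1, new_q) \<longleftrightarrow> (m - n) * I n 1 = 0" for n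
  proof -
    have "v 1 * z 1 * (k - h) \<noteq> 0" using Wr[of 1] Wr1 by simp
    then have e: "z 1 * (h - k) * v 1 / Wr 1 = - 1"
      unfolding Wr1 by (simp add: divide_eq_minus_1_iff algebra_simps)
    have "(m - l) * I n 1 * (z 1 * (h - k) * v 1 / Wr 1) = - (m - l) * I n 1"
      unfolding e by (simp add: algebra_simps)
    moreover have "z 1 * (G n 1 + (h + P 1) * F n 1)
        = z 1 * (R.W n 1 + (h + P 1) * R.U n 1) - (m - l) * I n 1 * (z 1 * (h - k) * v 1 / Wr 1)"
    proof -
      have "a * (b - c * (d * e) * (j / w)) = a * b - c * j * (a * d * e / w)" for a b c d e j w :: real
        by (simp add: algebra_simps)
      then show ?thesis unfolding expand .
    qed
    ultimately have "z 1 * (G n 1 + (h + P 1) * F n 1) = (m - n) * I n 1"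
      unfolding Wn by (simp add: algebra_simps)
    then show ?thesis unfolding new using z1_nz by (metis mult_eq_0_iff)
  qed
  ultimately show "sl_spectrum (h0 + \<tau> 0, h + \<tau> 1, new_q) = insert m (sl_spectrum (h0, h, q) - {l})"
    using Il by auto
qed

end

lemma abs_mult_le: "\<bar>a\<bar> \<le> A \<Longrightarrow> \<bar>b\<bar> \<le> B \<Longrightarrow> \<bar>a * b\<bar> \<le> A * B" for a b A B :: real
  unfolding abs_mult by (intro mult_mono) auto

text \<open>
  The Wronskian of \<open>z\<close> and of the solution at \<open>m\<close> that satisfies the other right boundary condition is a
  nonzero constant at \<open>m = l\<close>, because the two conditions differ. So the transformation is available for all \<open>m\<close>
  near \<open>l\<close>, and it moves the problem by \<open>O(|m - l|)\<close>.
\<close>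

theorem single_eigenvalue_movable:
  assumes "h \<noteq> k" and l: "l \<in> sl_spectrum (h0, h, q)"
  shows "\<exists>C \<delta>. \<delta> > 0 \<and> (\<forall>m. \<bar>m - l\<bar> < \<delta> \<longrightarrow> (\<exists>t0 t1 f. continuous_on {0..1} f \<and>
    \<bar>t0\<bar> \<le> C * \<bar>m - l\<bar> \<and> \<bar>t1\<bar> \<le> C * \<bar>m - l\<bar> \<and> (\<forall>x\<in>{0..1}. \<bar>f x\<bar> \<le> C * \<bar>m - l\<bar>) \<and>
    sl_spectrum (h0 + t0, h + t1, q + abs_l2 f) = insert m (sl_spectrum (h0, h, q) - {l}) \<and>
    sl_spectrum (h0 + t0, k + t1, q + abs_l2 f) = sl_spectrum (h0, k, q)))"
proof -
  define P where "P = primitive q"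
  have Pcont: "continuous_on {0..1} P" unfolding P_def by (rule continuous_on_primitive)
  obtain z wz where z: "sl_system P l z wz" "z 0 = 1" "wz 0 = - h0"
    by (rule sl_system_exists_left[OF Pcont])
  have z1: "wz 1 = - (h + P 1) * z 1"
    using l sl_spectrum_iff_left_solution[OF z[unfolded P_def], of h] unfolding P_def by linarith
  have z1_nz: "z 1 \<noteq> 0"
  proof
    assume "z 1 = 0"
    moreover have "(z 0)\<^sup>2 + (wz 0)\<^sup>2 > 0" by (simp add: z add_pos_nonneg)
    then have "(z 1)\<^sup>2 + (wz 1)\<^sup>2 > 0"
      by (intro sl_system_nontrivial[OF Pcont z(1), of 0]) auto
    ultimately show False using z1 by simp
  qed
  obtain y wy where y: "sl_system P l y wy" "y 1 = 1" "wy 1 = - (k + P 1)"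
    by (rule sl_system_exists_right[OF Pcont])
  define c where "c = \<bar>(k - h) * z 1\<bar>"
  have c: "c > 0" using assms(1) z1_nz by (simp add: c_def)
  have Wl: "\<bar>y x * wz x - wy x * z x\<bar> = c" if "x \<in> {0..1}" for x
    using wronskian_constant[OF y(1) z(1) that] wronskian_constant[OF y(1) z(1), of 1] y z1
    by (simp add: c_def algebra_simps)
  obtain B where "\<And>x. x \<in> {0..1} \<Longrightarrow> \<bar>\<bar>z x\<bar> + \<bar>wz x\<bar> + \<bar>y x\<bar> + \<bar>wy x\<bar> + \<bar>P x\<bar>\<bar> \<le> B" and B: "B > 0"
  proof -
    have "continuous_on {0..1} (\<lambda>x. \<bar>z x\<bar> + \<bar>wz x\<bar> + \<bar>y x\<bar> + \<bar>wy x\<bar> + \<bar>P x\<bar>)"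
      using sl_system_continuous[OF z(1)] sl_system_continuous[OF y(1)] Pcont by (intro continuous_intros)
    then show thesis using continuous_bound_unit that by blast
  qed
  then have bnd: "\<bar>z x\<bar> \<le> B" "\<bar>wz x\<bar> \<le> B" "\<bar>y x\<bar> \<le> B" "\<bar>wy x\<bar> \<le> B" "\<bar>P x\<bar> \<le> B" if "x \<in> {0..1}" for x
    using that by (force simp: abs_le_iff)+
  obtain C where C: "C > 0" and lip: "\<forall>m u w x0 x. \<bar>m - l\<bar> \<le> 1 \<longrightarrow> sl_system P m u w \<longrightarrow> x0 \<in> {0..1} \<longrightarrow>
    u x0 = y x0 \<longrightarrow> w x0 = wy x0 \<longrightarrow> x \<in> {0..1} \<longrightarrow> \<bar>u x - y x\<bar> \<le> C * \<bar>m - l\<bar> \<and> \<bar>w x - wy x\<bar> \<le> C * \<bar>m - l\<bar>"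
    using sl_system_lipschitz_parameter[OF Pcont y(1)] by blast
  define N where "N = B + C"
  define A1 where "A1 = 2 * N * N / c"
  define A2 where "A2 = 2 * (2 * ((N * N + N) * N)) / c + A1 * A1"
  \<comment> \<open>for \<open>m\<close> within \<open>\<delta>\<close> of \<open>l\<close> the Wronskian keeps at least half of its size \<open>c\<close> at \<open>m = l\<close>\<close>
  define \<delta> where "\<delta> = min 1 (c / (4 * C * B))"
  have N: "N > 0" "B \<le> N" using B C by (simp_all add: N_def)
  have A1: "A1 \<ge> 0" and A2: "A2 \<ge> 0" using N c by (simp_all add: A1_def A2_def)
  have \<delta>: "\<delta> > 0" using c C B by (simp add: \<delta>_def)
  show ?thesis
  proof (rule exI[of _ "A1 + 2 * A2"], rule exI[of _ \<delta>], intro conjI allI impI \<delta>)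
    fix m assume m: "\<bar>m - l\<bar> < \<delta>"
    then have m1: "\<bar>m - l\<bar> \<le> 1" by (simp add: \<delta>_def)
    obtain v wv where v: "sl_system P m v wv" "v 1 = 1" "wv 1 = - (k + P 1)"
      by (rule sl_system_exists_right[OF Pcont])
    have close: "\<bar>v x - y x\<bar> \<le> C * \<bar>m - l\<bar>" "\<bar>wv x - wy x\<bar> \<le> C * \<bar>m - l\<bar>" if "x \<in> {0..1}" for x
      using lip[rule_format, OF m1 v(1), of 1 x] that y v by auto
    have "C * \<bar>m - l\<bar> \<le> C * 1" using m1 C by (intro mult_left_mono) auto
    then have vb: "\<bar>v x\<bar> \<le> N" "\<bar>wv x\<bar> \<le> N" if "x \<in> {0..1}" for x
      using close[OF that] bnd[OF that] unfolding N_def by linarith+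
    have Wr_ge: "\<bar>v x * wz x - wv x * z x\<bar> \<ge> c / 2" if x: "x \<in> {0..1}" for x
    proof -
      have "C * (\<bar>m - l\<bar> * B) \<le> c / 4"
      proof -
        have "\<bar>m - l\<bar> \<le> c / (4 * C * B)" using m by (simp add: \<delta>_def)
        then show ?thesis using C B by (simp add: field_simps)
      qed
      moreover have "\<bar>(v x - y x) * wz x\<bar> \<le> C * \<bar>m - l\<bar> * B" "\<bar>(wv x - wy x) * z x\<bar> \<le> C * \<bar>m - l\<bar> * B"
        by (rule abs_mult_le[OF close(1)[OF x] bnd(2)[OF x]], rule abs_mult_le[OF close(2)[OF x] bnd(1)[OF x]])
      moreover have "v x * wz x - wv x * z x = (y x * wz x - wy x * z x) + (v x - y x) * wz x - (wv x - wy x) * z x"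
        by (simp add: algebra_simps)
      moreover have "c / 2 \<le> \<bar>a + b - d\<bar>"
        if "e \<le> c / 4" "\<bar>b\<bar> \<le> e" "\<bar>d\<bar> \<le> e" "\<bar>a\<bar> = c" for a b d e
        using that by linarith
      ultimately show ?thesis using Wl[OF x] by (simp only: mult.assoc mult.commute[of B])
    qed
    interpret D: darboux q l m v wv z wz
    proof
      show "sl_system (primitive q) m v wv" "sl_system (primitive q) l z wz"
        using v(1) z(1) by (simp_all add: P_def)
      show "v x * wz x - wv x * z x \<noteq> 0" if "x \<in> {0..1}" for x
        using Wr_ge[OF that] c by auto
    qed
    have quot: "\<bar>(m - l) * a / D.Wr x\<bar> \<le> (2 * b / c) * \<bar>m - l\<bar>" if "\<bar>a\<bar> \<le> b" "x \<in> {0..1}" for a b x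
    proof -
      have "\<bar>(m - l) * a / D.Wr x\<bar> = \<bar>m - l\<bar> * \<bar>a\<bar> / \<bar>D.Wr x\<bar>" by (simp add: abs_mult)
      also have "\<dots> \<le> \<bar>m - l\<bar> * b / (c / 2)"
        using that Wr_ge[OF that(2)] c by (intro frac_le mult_left_mono mult_nonneg_nonneg) (auto simp: D.Wr_def)
      finally show ?thesis by (simp add: mult_ac)
    qed
    have \<tau>b: "\<bar>D.\<tau> x\<bar> \<le> A1 * \<bar>m - l\<bar>" if x: "x \<in> {0..1}" for x
    proof -
      have "\<bar>v x * z x\<bar> \<le> N * N"
        using vb(1)[OF x] order_trans[OF bnd(1)[OF x] N(2)] by (rule abs_mult_le)
      from quot[OF this x] show ?thesis by (simp add: D.\<tau>_def A1_def mult_ac)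
    qed
    have d\<tau>b: "\<bar>D.d\<tau> x\<bar> \<le> A2 * \<bar>m - l\<bar>" if x: "x \<in> {0..1}" for x
    proof -
      have bN: "\<bar>z x\<bar> \<le> N" "\<bar>wz x\<bar> \<le> N" "\<bar>P x\<bar> \<le> N"
        using bnd[OF x] N(2) by linarith+
      have "\<bar>P x * v x\<bar> \<le> N * N" "\<bar>P x * z x\<bar> \<le> N * N"
        using abs_mult_le[OF bN(3) vb(1)[OF x]] abs_mult_le[OF bN(3) bN(1)] by auto
      then have "\<bar>P x * v x + wv x\<bar> \<le> N * N + N" "\<bar>P x * z x + wz x\<bar> \<le> N * N + N"
        using vb(2)[OF x] bN(2) by linarith+
      then have "\<bar>(P x * v x + wv x) * z x\<bar> \<le> (N * N + N) * N" "\<bar>v x * (P x * z x + wz x)\<bar> \<le> N * (N * N + N)"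
        using abs_mult_le[OF _ bN(1)] abs_mult_le[OF vb(1)[OF x]] by auto
      then have "\<bar>(P x * v x + wv x) * z x + v x * (P x * z x + wz x)\<bar> \<le> 2 * ((N * N + N) * N)"
        by (simp add: mult.commute[of N "N * N + N"])
      from quot[OF this x] have 1: "\<bar>(m - l) * ((P x * v x + wv x) * z x + v x * (P x * z x + wz x)) / D.Wr x\<bar>
          \<le> 2 * (2 * ((N * N + N) * N)) / c * \<bar>m - l\<bar>" .
      have "\<bar>D.\<tau> x\<bar> \<le> A1 * 1"
        using \<tau>b[OF x] mult_left_mono[OF m1 A1] by linarith
      from abs_mult_le[OF \<tau>b[OF x] this]
      have "\<bar>D.\<tau> x * D.\<tau> x\<bar> \<le> (A1 * \<bar>m - l\<bar>) * (A1 * 1)" .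
      then have 2: "\<bar>(D.\<tau> x)\<^sup>2\<bar> \<le> A1 * A1 * \<bar>m - l\<bar>" by (simp add: power2_eq_square mult_ac abs_mult)
      show ?thesis
        using 1 2 unfolding D.d\<tau>_def A2_def distrib_right P_def by linarith
    qed
    have le: "A1 * \<bar>m - l\<bar> \<le> (A1 + 2 * A2) * \<bar>m - l\<bar>" "2 * A2 * \<bar>m - l\<bar> \<le> (A1 + 2 * A2) * \<bar>m - l\<bar>"
      using A1 A2 by (auto intro!: mult_right_mono)
    show "\<exists>t0 t1 f. continuous_on {0..1} f \<and>
      \<bar>t0\<bar> \<le> (A1 + 2 * A2) * \<bar>m - l\<bar> \<and> \<bar>t1\<bar> \<le> (A1 + 2 * A2) * \<bar>m - l\<bar> \<and>
      (\<forall>x\<in>{0..1}. \<bar>f x\<bar> \<le> (A1 + 2 * A2) * \<bar>m - l\<bar>) \<and>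
      sl_spectrum (h0 + t0, h + t1, q + abs_l2 f) = insert m (sl_spectrum (h0, h, q) - {l}) \<and>
      sl_spectrum (h0 + t0, k + t1, q + abs_l2 f) = sl_spectrum (h0, k, q)"
    proof (intro exI conjI ballI)
      show "continuous_on {0..1} (\<lambda>x. - 2 * D.d\<tau> x)" by (intro continuous_intros D.continuous_d\<tau>)
      show "\<bar>D.\<tau> 0\<bar> \<le> (A1 + 2 * A2) * \<bar>m - l\<bar>" "\<bar>D.\<tau> 1\<bar> \<le> (A1 + 2 * A2) * \<bar>m - l\<bar>"
        using \<tau>b[of 0] \<tau>b[of 1] le(1) by auto
      show "\<bar>- 2 * D.d\<tau> x\<bar> \<le> (A1 + 2 * A2) * \<bar>m - l\<bar>" if "x \<in> {0..1}" for x
        using d\<tau>b[OF that] le(2) by (simp add: abs_mult)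
      show "sl_spectrum (h0 + D.\<tau> 0, h + D.\<tau> 1, q + abs_l2 (\<lambda>x. - 2 * D.d\<tau> x)) = insert m (sl_spectrum (h0, h, q) - {l})"
        "sl_spectrum (h0 + D.\<tau> 0, k + D.\<tau> 1, q + abs_l2 (\<lambda>x. - 2 * D.d\<tau> x)) = sl_spectrum (h0, k, q)"
        using D.new_spectra[of h0 h k] z z1 v by (simp_all add: P_def D.new_q_def)
    qed
  qed
qed

section \<open>Biorthogonality of the eigenvalue gradients\<close>

text \<open>
  For solutions \<open>f\<close> at \<open>n\<close> and \<open>u\<close>, \<open>v\<close> at \<open>l\<close> one has
  \<open>2 f\<^sup>2 (u v)' = (f\<^sup>2 u v)' + ([f, u] [f, v])' / (n - l)\<close>, with \<open>[,]\<close> the Wronskian, since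
  \<open>[f, u]' = (n - l) f u\<close>.
\<close>

lemma square_times_product_derivative:
  assumes f: "sl_system P n f g" and u: "sl_system P l u wu" and v: "sl_system P l v wv" and nl: "n \<noteq> l"
  defines "B \<equiv> \<lambda>x. ((f x)\<^sup>2 * u x * v x) / 2
    + (f x * wu x - g x * u x) * (f x * wv x - g x * v x) / (2 * (n - l))"
  shows "((\<lambda>x. (f x)\<^sup>2 * ((P x * u x + wu x) * v x + u x * (P x * v x + wv x))) has_integral B 1 - B 0) {0..1}"
proof (rule has_integral_derivative_unit)
  fix x :: real assume x: "x \<in> {0..1}"
  let ?d = "(P x * u x + wu x) * v x + u x * (P x * v x + wv x)"
  let ?U = "f x * wu x - g x * u x" and ?V = "f x * wv x - g x * v x"
  have "((\<lambda>x. ((f x)\<^sup>2 * u x * v x) / 2) has_real_derivative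
      (2 * f x * (P x * f x + g x) * u x * v x + (f x)\<^sup>2 * ?d) / 2) (at x within {0..1})"
    by (auto intro!: derivative_eq_intros sl_system_deriv[OF f x] sl_system_deriv[OF u x] sl_system_deriv[OF v x]
        simp: algebra_simps power2_eq_square)
  moreover have "((\<lambda>x. (f x * wu x - g x * u x) * (f x * wv x - g x * v x) / (2 * (n - l))) has_real_derivative
      ((n - l) * (f x * u x) * ?V + (n - l) * (f x * v x) * ?U) / (2 * (n - l))) (at x within {0..1})"
    by (intro DERIV_cdivide DERIV_mult wronskian_deriv[OF f u x] wronskian_deriv[OF f v x])
  ultimately have "(B has_real_derivative (2 * f x * (P x * f x + g x) * u x * v x + (f x)\<^sup>2 * ?d) / 2
     + ((n - l) * (f x * u x) * ?V + (n - l) * (f x * v x) * ?U) / (2 * (n - l))) (at x within {0..1})"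
    unfolding B_def by (rule DERIV_add)
  also have "((n - l) * a * b + (n - l) * c * d) / (2 * (n - l)) = (a * b + c * d) / 2" for a b c d
  proof -
    have "(n - l) * a * b + (n - l) * c * d = (n - l) * (a * b + c * d)" by (simp add: algebra_simps)
    then show ?thesis
      using nonzero_mult_divide_mult_cancel_left[of "n - l" "a * b + c * d" 2] nl
      by (simp add: mult.commute[of 2])
  qed
  also have "(2 * f x * (P x * f x + g x) * u x * v x + (f x)\<^sup>2 * ?d) / 2
     + (f x * u x * ?V + f x * v x * ?U) / 2 = (f x)\<^sup>2 * ?d"
    by (simp add: field_simps power2_eq_square)
  finally show "(B has_real_derivative (f x)\<^sup>2 * ?d) (at x within {0..1})" .
qed auto

text \<open>
  For \<open>f = u\<close> the quotient is replaced by an integral: \<open>2 u\<^sup>2 (u v)' = (u\<^sup>3 v)' + [u, v] u\<^sup>2\<close>, and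
  \<open>[u, v]\<close> is constant.
\<close>

lemma square_times_product_derivative_same:
  assumes u: "sl_system P l u wu" and v: "sl_system P l v wv"
  shows "((\<lambda>x. (u x)\<^sup>2 * ((P x * u x + wu x) * v x + u x * (P x * v x + wv x))) has_integral
    (((u 1)\<^sup>2 * u 1 * v 1) / 2 - ((u 0)\<^sup>2 * u 0 * v 0) / 2)
      + (u 1 * wv 1 - wu 1 * v 1) / 2 * integral {0..1} (\<lambda>x. (u x)\<^sup>2)) {0..1}"
proof -
  define \<kappa> where "\<kappa> = u 1 * wv 1 - wu 1 * v 1"
  have \<kappa>: "u x * wv x - wu x * v x = \<kappa>" if "x \<in> {0..1}" for x
    using wronskian_constant[OF u v that] wronskian_constant[OF u v, of 1] by (simp add: \<kappa>_def)
  have "((\<lambda>x. (u x)\<^sup>2 * ((P x * u x + wu x) * v x + u x * (P x * v x + wv x)) - \<kappa> / 2 * (u x)\<^sup>2) has_integral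
    ((u 1)\<^sup>2 * u 1 * v 1) / 2 - ((u 0)\<^sup>2 * u 0 * v 0) / 2) {0..1}"
  proof (rule has_integral_derivative_unit)
    fix x :: real assume x: "x \<in> {0..1}"
    show "((\<lambda>x. ((u x)\<^sup>2 * u x * v x) / 2) has_real_derivative
        (u x)\<^sup>2 * ((P x * u x + wu x) * v x + u x * (P x * v x + wv x)) - \<kappa> / 2 * (u x)\<^sup>2) (at x within {0..1})"
      unfolding \<kappa>[OF x, symmetric]
      by (auto intro!: derivative_eq_intros sl_system_deriv[OF u x] sl_system_deriv[OF v x]
          simp: field_simps power2_eq_square)
  qed auto
  moreover have "((\<lambda>x. \<kappa> / 2 * (u x)\<^sup>2) has_integral \<kappa> / 2 * integral {0..1} (\<lambda>x. (u x)\<^sup>2)) {0..1}"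
    using sl_system_continuous(1)[OF u]
    by (intro has_integral_mult_right integrable_integral integrable_continuous_real continuous_intros)
  ultimately have "((\<lambda>x. ((u x)\<^sup>2 * ((P x * u x + wu x) * v x + u x * (P x * v x + wv x)) - \<kappa> / 2 * (u x)\<^sup>2)
      + \<kappa> / 2 * (u x)\<^sup>2) has_integral
    (((u 1)\<^sup>2 * u 1 * v 1) / 2 - ((u 0)\<^sup>2 * u 0 * v 0) / 2) + \<kappa> / 2 * integral {0..1} (\<lambda>x. (u x)\<^sup>2)) {0..1}"
    by (rule has_integral_add)
  then show ?thesis by (simp only: \<kappa>_def diff_add_cancel)
qed

definition right_coeff :: "real \<Rightarrow> real \<Rightarrow> nat \<Rightarrow> real" where
  "right_coeff h1 h2 i = (if i = 1 then h1 else h2)"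

lemma sl_sub_eq: "sl_sub (h0, h1, h2, q) i = (h0, right_coeff h1 h2 i, q)"
  by (simp add: right_coeff_def)

lemma sl_spectra_disjoint:
  assumes "h \<noteq> k" and "l \<in> sl_spectrum (h0, h, q)" "l \<in> sl_spectrum (h0, k, q)" shows False
proof -
  obtain f g where fg: "sl_system (primitive q) l f g" "f 0 = 1" "g 0 = - h0"
    by (rule sl_system_exists_left[OF continuous_on_primitive])
  have eq: "g 1 + (h + primitive q 1) * f 1 = 0" "g 1 + (k + primitive q 1) * f 1 = 0"
    using assms(2,3) unfolding sl_spectrum_iff_left_solution[OF fg] by auto
  moreover have "(h - k) * f 1 = (g 1 + (h + primitive q 1) * f 1) - (g 1 + (k + primitive q 1) * f 1)"
    by (simp add: algebra_simps)
  ultimately have "(h - k) * f 1 = 0" by simp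
  then have "f 1 = 0" using assms(1) by simp
  moreover have "(f 0)\<^sup>2 + (g 0)\<^sup>2 > 0" by (simp add: fg add_pos_nonneg)
  then have "(f 1)\<^sup>2 + (g 1)\<^sup>2 > 0"
    by (intro sl_system_nontrivial[OF continuous_on_primitive fg(1), of 0]) auto
  ultimately show False using eq(1) by simp
qed

text \<open>
  The direction dual to the gradient of an eigenvalue of \<open>(h0, h, q)\<close> with eigenfunction \<open>u\<close> has the
  \<open>L\<^sup>2\<close> component \<open>(u v)'\<close>, where \<open>v\<close> solves the same equation and satisfies the right boundary condition
  of the other problem. Its scalar components cancel the boundary terms \<open>f\<^sup>2 u v / 2\<close>. What is left is a product of
  Wronskians \<open>[f, u] [f, v]\<close>. It vanishes at 0 because \<open>f\<close> and \<open>u\<close> satisfy the same condition there, and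
  at 1 because \<open>f\<close> satisfies the condition of \<open>u\<close> or that of \<open>v\<close>.
\<close>

lemma eigenvalue_gradients_biorthogonal:
  assumes "h1 \<noteq> h2" and i0: "i0 \<in> {1, 2}"
  obtains D where "inner (grad_eigenvalue (h0, h1, h2, q) i0 m) D \<noteq> 0"
    "\<And>i n. i \<in> {1, 2} \<Longrightarrow> (i, n) \<noteq> (i0, m) \<Longrightarrow> inner (grad_eigenvalue (h0, h1, h2, q) i n) D = 0"
proof -
  define P where "P = primitive q"
  have Pcont: "continuous_on {0..1} P" unfolding P_def by (rule continuous_on_primitive)
  define h where "h = right_coeff h1 h2 i0"
  define k where "k = right_coeff h1 h2 (3 - i0)"
  have hk: "h \<noteq> k" using assms by (auto simp: h_def k_def right_coeff_def)
  define l where "l = sl_eigenvalue (h0, h, q) m"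
  define u where "u = sl_normalized (h0, h, q) m"
  obtain wu where u: "sl_system P l u wu" "wu 0 = - h0 * u 0" "wu 1 = - (h + P 1) * u 1"
    and unz: "\<exists>x\<in>{0..1}. u x \<noteq> 0"
    using sl_normalized(1)[of h0 h q m] unfolding sl_eigenfunction_iff_system u_def l_def P_def by blast
  obtain v wv where v: "sl_system P l v wv" "v 1 = 1" "wv 1 = - (k + P 1)"
    by (rule sl_system_exists_right[OF Pcont])
  define d where "d = (\<lambda>x. (P x * u x + wu x) * v x + u x * (P x * v x + wv x))"
  have dcont: "continuous_on {0..1} d"
    unfolding d_def using Pcont sl_system_continuous[OF u(1)] sl_system_continuous[OF v(1)]
    by (intro continuous_intros)
  define D where "D = (- (u 0 * v 0) / 2, - (u 1 * v 1) / 2, - (u 1 * v 1) / 2, abs_l2 d)"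
  have pairing: "inner (grad_eigenvalue (h0, h1, h2, q) i n) D =
      (f 0)\<^sup>2 * (u 0 * v 0) / 2 - (f 1)\<^sup>2 * (u 1 * v 1) / 2 + integral {0..1} (\<lambda>x. (f x)\<^sup>2 * d x)"
    if "i \<in> {1, 2}" and f: "f = sl_normalized (h0, right_coeff h1 h2 i, q) n" for i n f
  proof -
    have "continuous_on {0..1} (\<lambda>x. (f x)\<^sup>2)"
      unfolding f by (intro continuous_intros sl_eigenfunction_continuous[OF sl_normalized(1)])
    then have "inner (abs_l2 (\<lambda>x. (f x)\<^sup>2)) (abs_l2 d) = integral {0..1} (\<lambda>x. (f x)\<^sup>2 * d x)"
      by (rule inner_abs_l2_continuous[OF _ dcont])
    then show ?thesis
      using that(1) by (auto simp: grad_eigenvalue_def sl_sub_eq f[symmetric] Let_def D_def algebra_simps simp del: sl_sub.simps)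
  qed
  show thesis
  proof (rule that[of D])
    have "integral {0..1} (\<lambda>x. (u x)\<^sup>2 * d x) = ((u 1)\<^sup>2 * u 1 * v 1) / 2 - ((u 0)\<^sup>2 * u 0 * v 0) / 2
        + (u 1 * wv 1 - wu 1 * v 1) / 2 * integral {0..1} (\<lambda>x. (u x)\<^sup>2)"
      unfolding d_def by (rule integral_unique[OF square_times_product_derivative_same[OF u(1) v(1)]])
    then have "inner (grad_eigenvalue (h0, h1, h2, q) i0 m) D
        = (u 1 * wv 1 - wu 1 * v 1) / 2 * integral {0..1} (\<lambda>x. (u x)\<^sup>2)"
      using pairing[OF i0, of u m] by (simp add: u_def h_def mult.assoc)
    moreover have "integral {0..1} (\<lambda>x. (u x)\<^sup>2) = 1"
      using sl_normalized(2)[of h0 h q m] norm_abs_l2_continuous[OF sl_system_continuous(1)[OF u(1)]]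
      by (simp add: u_def)
    moreover have "u 1 * wv 1 - wu 1 * v 1 = (h - k) * u 1"
      unfolding u(3) v(2,3) by (simp add: algebra_simps)
    ultimately have *: "inner (grad_eigenvalue (h0, h1, h2, q) i0 m) D = (h - k) * u 1 / 2" by simp
    have "u 1 \<noteq> 0"
    proof
      assume "u 1 = 0"
      then have "u x = 0" if "x \<in> {0..1}" for x
        using sl_system_unique(1)[OF Pcont u(1) sl_system_zero, of 1 x] u that by auto
      then show False using unz by auto
    qed
    then show "inner (grad_eigenvalue (h0, h1, h2, q) i0 m) D \<noteq> 0" unfolding * using hk by simp
  next
    fix i n assume i: "i \<in> {1, 2}" and ne: "(i, n) \<noteq> (i0, m)"
    define h' where "h' = right_coeff h1 h2 i"
    define f where "f = sl_normalized (h0, h', q) n"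
    define ln where "ln = sl_eigenvalue (h0, h', q) n"
    obtain g where f: "sl_system P ln f g" "g 0 = - h0 * f 0" "g 1 = - (h' + P 1) * f 1"
      using sl_normalized(1)[of h0 h' q n] unfolding sl_eigenfunction_iff_system f_def ln_def P_def by blast
    have h': "h' = h \<and> i = i0 \<or> h' = k"
      using i i0 by (auto simp: h'_def h_def k_def right_coeff_def)
    have "ln \<noteq> l"
    proof
      assume eq: "ln = l"
      show False
      proof (cases "h' = h")
        case True
        then have "i = i0" using h' hk by auto
        moreover have "n = m"
          using eq strict_mono_eq[OF sl_eigenvalue_enumerates_spectrum(1)[of h0 h q], of n m] True
          by (simp add: ln_def l_def)
        ultimately show False using ne by simp
      next
        case False
        then have "h' = k" using h' by auto
        then have "l \<in> sl_spectrum (h0, k, q)" "l \<in> sl_spectrum (h0, h, q)"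
          using eq sl_eigenvalue_enumerates_spectrum(2)[of h0 k q] sl_eigenvalue_enumerates_spectrum(2)[of h0 h q]
          unfolding ln_def l_def by (metis rangeI)+
        then show False using sl_spectra_disjoint[OF hk] by blast
      qed
    qed
    have at0: "f 0 * wu 0 - g 0 * u 0 = 0" using f(2) u(2) by simp
    have at1: "(f 1 * wu 1 - g 1 * u 1) * (f 1 * wv 1 - g 1 * v 1) = 0"
    proof -
      have "(f 1 * wu 1 - g 1 * u 1) = (h' - h) * f 1 * u 1" "(f 1 * wv 1 - g 1 * v 1) = (h' - k) * f 1 * v 1"
        unfolding f(3) u(3) v(2,3) by (simp_all add: algebra_simps)
      then show ?thesis using h' by auto
    qed
    have "integral {0..1} (\<lambda>x. (f x)\<^sup>2 * d x) = ((f 1)\<^sup>2 * u 1 * v 1) / 2 - ((f 0)\<^sup>2 * u 0 * v 0) / 2"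
      unfolding d_def
      using integral_unique[OF square_times_product_derivative[OF f(1) u(1) v(1) \<open>ln \<noteq> l\<close>]] at0 at1 by simp
    then show "inner (grad_eigenvalue (h0, h1, h2, q) i n) D = 0"
      using pairing[OF i, of f n] by (simp add: f_def h'_def mult.assoc)
  qed
qed

section \<open>Convergence of the functional and of its gradient\<close>

lemma summable_weighted:
  fixes w f :: "'a \<Rightarrow> real"
  assumes "finite I \<or> w summable_on I" and "\<And>j. j \<in> I \<Longrightarrow> w j > 0" and "\<And>j. j \<in> I \<Longrightarrow> \<bar>f j\<bar> \<le> C"
  shows "(\<lambda>j. w j * f j) summable_on I" "(\<lambda>j. C * w j) summable_on I"
proof -
  have "w summable_on I" using assms(1) by (auto intro: summable_on_finite)
  then show s: "(\<lambda>j. C * w j) summable_on I" by (rule summable_on_cmult_right)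
  have "(\<lambda>j. norm (w j * f j)) summable_on I"
  proof (rule Infinite_Sum.abs_summable_on_comparison_test'[OF s])
    fix j assume "j \<in> I"
    then have "w j * \<bar>f j\<bar> \<le> w j * C" using assms(2,3) by (intro mult_left_mono) (auto intro: less_imp_le)
    then show "norm (w j * f j) \<le> C * w j" using assms(2)[OF \<open>j \<in> I\<close>] by (simp add: abs_mult mult.commute)
  qed
  then show "(\<lambda>j. w j * f j) summable_on I" by (rule abs_summable_summable)
qed

lemma has_sum_Pair:
  assumes "(f has_sum a) I" "(g has_sum b) I"
  shows "((\<lambda>j. (f j, g j)) has_sum (a, b)) I"
  using assms unfolding has_sum_def sum_prod by (rule tendsto_Pair)

text \<open>
  A uniformly absolutely convergent series of continuous functions converges in \<open>L\<^sup>2\<close>, because the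
  norm there is at most the supremum norm; the limit is the pointwise sum.
\<close>

lemma has_sum_abs_l2:
  assumes cont: "\<And>j. j \<in> I \<Longrightarrow> continuous_on {0..1} (f j)"
    and le: "\<And>j x. j \<in> I \<Longrightarrow> x \<in> {0..1} \<Longrightarrow> \<bar>f j x\<bar> \<le> M j" and M: "M summable_on I"
  shows "\<exists>s. ((\<lambda>j. abs_l2 (f j)) has_sum s) I"
proof -
  define S where "S = (\<lambda>x. \<Sum>\<^sub>\<infinity>j\<in>I. f j x)"
  have unif: "uniform_limit {0..1} (\<lambda>X x. \<Sum>j\<in>X. f j x) S (finite_subsets_at_top I)"
    unfolding S_def by (rule Weierstrass_m_test_general[OF _ M]) (use le in auto)
  have ev: "\<forall>\<^sub>F X in finite_subsets_at_top I. finite X \<and> X \<subseteq> I"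
    by (rule eventually_finite_subsets_at_top_weakI) auto
  have sum_cont: "continuous_on {0..1} (\<lambda>x. \<Sum>j\<in>X. f j x)" if "X \<subseteq> I" for X
    using that cont by (intro continuous_on_sum) auto
  have Scont: "continuous_on {0..1} S"
    by (rule uniform_limit_theorem[OF eventually_mono[OF ev] unif]) (use sum_cont in auto)
  have sum_abs: "(\<Sum>j\<in>X. abs_l2 (f j)) = abs_l2 (\<lambda>x. \<Sum>j\<in>X. f j x)" if "finite X" "X \<subseteq> I" for X
    using that
  proof (induction X)
    case empty
    show ?case by (simp add: zero_l2.abs_eq)
  next
    case (insert j X)
    then show ?case
      using abs_l2_add[OF cont[of j] sum_cont[of X]] by simp
  qed
  have "((\<lambda>X. \<Sum>j\<in>X. abs_l2 (f j)) \<longlongrightarrow> abs_l2 S) (finite_subsets_at_top I)"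
  proof (rule tendstoI)
    fix e :: real assume e: "e > 0"
    have "\<forall>\<^sub>F X in finite_subsets_at_top I. \<forall>x\<in>{0..1}. dist (\<Sum>j\<in>X. f j x) (S x) < e / 2"
      using unif half_gt_zero[OF e] unfolding uniform_limit_iff by blast
    with ev show "\<forall>\<^sub>F X in finite_subsets_at_top I. dist (\<Sum>j\<in>X. abs_l2 (f j)) (abs_l2 S) < e"
    proof eventually_elim
      case (elim X)
      define T where "T = (\<lambda>x. \<Sum>j\<in>X. f j x)"
      have Tcont: "continuous_on {0..1} T" unfolding T_def using elim sum_cont by auto
      have dcont: "continuous_on {0..1} (\<lambda>x. T x - S x)" using Tcont Scont by (intro continuous_intros)
      have "abs_l2 T - abs_l2 S = abs_l2 (\<lambda>x. T x - S x)"
        unfolding diff_eq_eq using abs_l2_add[OF dcont Scont] by simp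
      moreover have "norm (abs_l2 (\<lambda>x. T x - S x)) \<le> e / 2"
        using elim by (intro norm_abs_l2_le[OF dcont]) (auto simp: T_def dist_real_def less_imp_le)
      ultimately show ?case
        using e elim sum_abs[of X] by (simp add: dist_norm T_def)
    qed
  qed
  then show ?thesis unfolding has_sum_def by blast
qed

lemma eigenvalue_difference_bounded:
  "\<exists>C. \<forall>i n. \<bar>sl_eigenvalue (sl_sub q i) n - sl_eigenvalue (sl_sub Q i) n\<bar> \<le> C"
proof -
  obtain h0 h1 h2 p where q: "q = (h0, h1, h2, p)" by (metis surj_pair)
  obtain H0 H1 H2 R where Q: "Q = (H0, H1, H2, R)" by (metis surj_pair)
  have "\<exists>C. \<forall>n. \<bar>sl_eigenvalue (a, b, r) n - sl_eigenvalue (c, d, s) n\<bar> \<le> C" for a b c d r s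
  proof -
    obtain C where C: "\<And>n. \<bar>sl_eigenvalue (a, b, r) n - (of_nat n * pi)\<^sup>2\<bar> \<le> C"
      using sl_eigenvalue_asymptotics by blast
    obtain C' where C': "\<And>n. \<bar>sl_eigenvalue (c, d, s) n - (of_nat n * pi)\<^sup>2\<bar> \<le> C'"
      using sl_eigenvalue_asymptotics by blast
    have "\<bar>sl_eigenvalue (a, b, r) n - sl_eigenvalue (c, d, s) n\<bar> \<le> C + C'" for n
      using C[of n] C'[of n] by linarith
    then show ?thesis by blast
  qed
  then obtain C1 C2 where C1: "\<forall>n. \<bar>sl_eigenvalue (h0, h1, p) n - sl_eigenvalue (H0, H1, R) n\<bar> \<le> C1"
    and C2: "\<forall>n. \<bar>sl_eigenvalue (h0, h2, p) n - sl_eigenvalue (H0, H2, R) n\<bar> \<le> C2" by metis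
  have "\<bar>sl_eigenvalue (sl_sub q i) n - sl_eigenvalue (sl_sub Q i) n\<bar> \<le> max C1 C2" for i n
    using spec[OF C1, of n] spec[OF C2, of n] by (simp add: q Q le_max_iff_disj)
  then show ?thesis by blast
qed

lemma sl_normalized_sub_bounded:
  "\<exists>B. \<forall>i n. \<forall>x\<in>{0..1}. \<bar>sl_normalized (sl_sub (h0, h1, h2, q) i) n x\<bar> \<le> B"
proof -
  obtain B1 where B1: "\<And>n x. x \<in> {0..1} \<Longrightarrow> \<bar>sl_normalized (h0, h1, q) n x\<bar> \<le> B1"
    using sl_normalized_bounded by blast
  obtain B2 where B2: "\<And>n x. x \<in> {0..1} \<Longrightarrow> \<bar>sl_normalized (h0, h2, q) n x\<bar> \<le> B2"
    using sl_normalized_bounded by blast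
  have "\<bar>sl_normalized (sl_sub (h0, h1, h2, q) i) n x\<bar> \<le> max B1 B2" if "x \<in> {0..1}" for i n x
    using B1[OF that, of n] B2[OF that, of n] by (simp add: le_max_iff_disj)
  then show ?thesis by blast
qed

text \<open>
  The differences of the eigenvalues and the values of the normalized eigenfunctions are bounded
  uniformly in the index, so the weights dominate the series in each component.
\<close>

lemma gradient_series_converges:
  assumes w: "finite I \<or> w summable_on I" and pos: "\<And>j. j \<in> I \<Longrightarrow> w j > 0"
    and d: "\<And>j. j \<in> I \<Longrightarrow> \<bar>d j\<bar> \<le> C"
  shows "\<exists>s. ((\<lambda>j. (w j * d j) *\<^sub>R grad_eigenvalue (h0, h1, h2, q) (fst j) (snd j)) has_sum s) I"
proof -
  define g where "g j = sl_normalized (sl_sub (h0, h1, h2, q) (fst j)) (snd j)" for j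
  obtain B where B: "\<And>j x. x \<in> {0..1} \<Longrightarrow> \<bar>g j x\<bar> \<le> B"
    using sl_normalized_sub_bounded[of h0 h1 h2 q] unfolding g_def by blast
  have gcont: "continuous_on {0..1} (\<lambda>x. (g j x)\<^sup>2)" for j
    unfolding g_def sl_sub_eq by (intro continuous_intros sl_eigenfunction_continuous[OF sl_normalized(1)])
  have sq: "(g j x)\<^sup>2 \<le> B\<^sup>2" if "x \<in> {0..1}" for j x
    using B[OF that, of j] abs_ge_zero[of "g j x"] by (simp add: abs_le_square_iff[symmetric])
  have bnd: "\<bar>d j * b\<bar> \<le> C * B\<^sup>2" if "j \<in> I" "\<bar>b\<bar> \<le> B\<^sup>2" for j b
    using d[OF that(1)] that(2) by (rule abs_mult_le)
  have scal: "\<exists>s. ((\<lambda>j. (w j * d j) * b j) has_sum s) I" if "\<And>j. j \<in> I \<Longrightarrow> \<bar>b j\<bar> \<le> B\<^sup>2" for b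
    using summable_weighted(1)[OF w pos, of "\<lambda>j. d j * b j" "C * B\<^sup>2"] bnd that
    by (simp add: summable_on_def mult.assoc)
  have "\<exists>s. ((\<lambda>j. abs_l2 (\<lambda>x. (w j * d j) * (g j x)\<^sup>2)) has_sum s) I"
  proof (rule has_sum_abs_l2)
    show "continuous_on {0..1} (\<lambda>x. (w j * d j) * (g j x)\<^sup>2)" for j
      by (intro continuous_intros gcont)
    show "(\<lambda>j. (C * B\<^sup>2) * w j) summable_on I"
      using summable_weighted(2)[OF w pos, of "\<lambda>j. 0" "\<bar>C * B\<^sup>2\<bar>"] summable_on_cmult_right[of w I "C * B\<^sup>2"] w
      by (auto intro: summable_on_finite)
    fix j x assume j: "j \<in> I" and x: "x \<in> {0..1::real}"
    have "w j * \<bar>d j * (g j x)\<^sup>2\<bar> \<le> w j * (C * B\<^sup>2)"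
      using bnd[OF j, of "(g j x)\<^sup>2"] sq[OF x] pos[OF j] by (intro mult_left_mono) auto
    then show "\<bar>(w j * d j) * (g j x)\<^sup>2\<bar> \<le> (C * B\<^sup>2) * w j"
      using pos[OF j] by (simp add: abs_mult mult_ac)
  qed
  then obtain s3 where s3: "((\<lambda>j. abs_l2 (\<lambda>x. (w j * d j) * (g j x)\<^sup>2)) has_sum s3) I" by blast
  have b01: "\<bar>- (g j 0)\<^sup>2\<bar> \<le> B\<^sup>2" "\<bar>(g j 1)\<^sup>2 * of_bool b\<bar> \<le> B\<^sup>2" for j b
    using sq[of 0 j] sq[of 1 j] by (auto simp: of_bool_def)
  obtain s0 where s0: "((\<lambda>j. (w j * d j) * (- (g j 0)\<^sup>2)) has_sum s0) I"
    using scal[of "\<lambda>j. - (g j 0)\<^sup>2"] b01 by blast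
  obtain s1 where s1: "((\<lambda>j. (w j * d j) * ((g j 1)\<^sup>2 * of_bool (fst j = 1))) has_sum s1) I"
    using scal[of "\<lambda>j. (g j 1)\<^sup>2 * of_bool (fst j = 1)"] b01 by blast
  obtain s2 where s2: "((\<lambda>j. (w j * d j) * ((g j 1)\<^sup>2 * of_bool (fst j = 2))) has_sum s2) I"
    using scal[of "\<lambda>j. (g j 1)\<^sup>2 * of_bool (fst j = 2)"] b01 by blast
  have "(w j * d j) *\<^sub>R grad_eigenvalue (h0, h1, h2, q) (fst j) (snd j) =
      ((w j * d j) * (- (g j 0)\<^sup>2), (w j * d j) * ((g j 1)\<^sup>2 * of_bool (fst j = 1)),
        (w j * d j) * ((g j 1)\<^sup>2 * of_bool (fst j = 2)), abs_l2 (\<lambda>x. (w j * d j) * (g j x)\<^sup>2))" for j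
    unfolding grad_eigenvalue_def Let_def g_def[symmetric] using abs_l2_scaleR[OF gcont[of j], of "w j * d j"]
    by simp
  then show ?thesis
    using has_sum_Pair[OF s0 has_sum_Pair[OF s1 has_sum_Pair[OF s2 s3]]] by auto
qed

section \<open>Absence of local minima\<close>

lemma strict_mono_update_nearby:
  fixes e :: "nat \<Rightarrow> real"
  assumes "strict_mono e"
  obtains \<gamma> where "\<gamma> > 0" "\<And>\<mu>. \<bar>\<mu> - e m\<bar> < \<gamma> \<Longrightarrow> strict_mono (e(m := \<mu>))"
proof -
  define \<gamma> where "\<gamma> = min (e (Suc m) - e m) (if m = 0 then 1 else e m - e (m - 1))"
  have inc: "e n < e (Suc n)" for n using assms by (simp add: strict_mono_Suc_iff)
  have \<gamma>: "\<gamma> > 0" using inc[of m] inc[of "m - 1"] by (cases m) (auto simp: \<gamma>_def)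
  have "strict_mono (e(m := \<mu>))" if "\<bar>\<mu> - e m\<bar> < \<gamma>" for \<mu>
    unfolding strict_mono_Suc_iff
  proof
    fix n
    consider "n = m" | "Suc n = m" | "n \<noteq> m" "Suc n \<noteq> m" by blast
    then show "(e(m := \<mu>)) n < (e(m := \<mu>)) (Suc n)"
    proof cases
      case 1
      have "\<bar>\<mu> - e m\<bar> < e (Suc m) - e m" using that by (simp add: \<gamma>_def)
      then show ?thesis using 1 by simp
    next
      case 2
      then have "\<bar>\<mu> - e (Suc n)\<bar> < e (Suc n) - e n" using that by (auto simp: \<gamma>_def)
      then show ?thesis using 2 by auto
    next
      case 3
      then show ?thesis using inc[of n] by simp
    qed
  qed
  with \<gamma> show thesis by (rule that)
qed

text \<open>
  The transformation shifts the two right boundary coefficients by the same amount, so it yields a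
  single quadruple for both problems. The replaced eigenvalue keeps its index as long as it
  stays between its neighbours.
\<close>

lemma eigenvalue_perturbation:
  fixes h0 h1 h2 e :: real and r :: l2
  assumes "h1 \<noteq> h2" and i0: "i0 \<in> {1, 2}" and e: "e > 0"
  defines "q \<equiv> (h0, h1, h2, r)"
  shows "\<exists>\<delta>>0. \<forall>\<mu>. \<bar>\<mu> - sl_eigenvalue (sl_sub q i0) m\<bar> < \<delta> \<longrightarrow> (\<exists>p. dist p q < e \<and>
    sl_eigenvalue (sl_sub p i0) m = \<mu> \<and>
    (\<forall>i\<in>{1, 2}. \<forall>n. (i, n) \<noteq> (i0, m) \<longrightarrow> sl_eigenvalue (sl_sub p i) n = sl_eigenvalue (sl_sub q i) n))"
proof -
  define h where "h = right_coeff h1 h2 i0"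
  define k where "k = right_coeff h1 h2 (3 - i0)"
  have hk: "h \<noteq> k" using assms by (auto simp: h_def k_def right_coeff_def)
  define ev where "ev = sl_eigenvalue (h0, h, r)"
  have ev: "strict_mono ev" "range ev = sl_spectrum (h0, h, r)"
    unfolding ev_def by (rule sl_eigenvalue_enumerates_spectrum)+
  have "ev m \<in> sl_spectrum (h0, h, r)" using ev(2) by blast
  from single_eigenvalue_movable[OF hk this]
  obtain C \<delta>1 where \<delta>1: "\<delta>1 > 0" and move: "\<forall>\<mu>. \<bar>\<mu> - ev m\<bar> < \<delta>1 \<longrightarrow> (\<exists>t0 t1 f. continuous_on {0..1} f \<and>
    \<bar>t0\<bar> \<le> C * \<bar>\<mu> - ev m\<bar> \<and> \<bar>t1\<bar> \<le> C * \<bar>\<mu> - ev m\<bar> \<and> (\<forall>x\<in>{0..1}. \<bar>f x\<bar> \<le> C * \<bar>\<mu> - ev m\<bar>) \<and>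
    sl_spectrum (h0 + t0, h + t1, r + abs_l2 f) = insert \<mu> (sl_spectrum (h0, h, r) - {ev m}) \<and>
    sl_spectrum (h0 + t0, k + t1, r + abs_l2 f) = sl_spectrum (h0, k, r))"
    by blast
  obtain \<gamma> where \<gamma>: "\<gamma> > 0" "\<And>\<mu>. \<bar>\<mu> - ev m\<bar> < \<gamma> \<Longrightarrow> strict_mono (ev(m := \<mu>))"
    using strict_mono_update_nearby[OF ev(1)] by blast
  define \<delta> where "\<delta> = min (min \<delta>1 \<gamma>) (e / (4 * \<bar>C\<bar> + 1))"
  have \<delta>: "\<delta> > 0" using \<delta>1 \<gamma> e by (simp add: \<delta>_def)
  show ?thesis
  proof (rule exI[of _ \<delta>], intro conjI allI impI \<delta>)
    fix \<mu> assume "\<bar>\<mu> - sl_eigenvalue (sl_sub q i0) m\<bar> < \<delta>"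
    then have \<mu>: "\<bar>\<mu> - ev m\<bar> < \<delta>" by (simp add: q_def sl_sub_eq ev_def h_def del: sl_sub.simps)
    then have \<mu>1: "\<bar>\<mu> - ev m\<bar> < \<delta>1" and \<mu>2: "\<bar>\<mu> - ev m\<bar> < \<gamma>" by (simp_all add: \<delta>_def)
    obtain t0 t1 f where f: "continuous_on {0..1} f"
      and t: "\<bar>t0\<bar> \<le> C * \<bar>\<mu> - ev m\<bar>" "\<bar>t1\<bar> \<le> C * \<bar>\<mu> - ev m\<bar>" and fb: "\<forall>x\<in>{0..1}. \<bar>f x\<bar> \<le> C * \<bar>\<mu> - ev m\<bar>"
      and spec: "sl_spectrum (h0 + t0, h + t1, r + abs_l2 f) = insert \<mu> (sl_spectrum (h0, h, r) - {ev m})"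
        "sl_spectrum (h0 + t0, k + t1, r + abs_l2 f) = sl_spectrum (h0, k, r)"
      using move[rule_format, OF \<mu>1] by blast
    define p where "p = (h0 + t0, h1 + t1, h2 + t1, r + abs_l2 f)"
    have p_sub: "sl_sub p i = (h0 + t0, right_coeff h1 h2 i + t1, r + abs_l2 f)" for i
      by (simp add: p_def right_coeff_def)
    have "range (ev(m := \<mu>)) = insert \<mu> (ev ` (UNIV - {m}))"
      by (auto simp: image_iff)
    also have "ev ` (UNIV - {m}) = range ev - {ev m}"
      using strict_mono_imp_inj_on[OF ev(1)] by (auto simp: inj_on_def)
    finally have "range (ev(m := \<mu>)) = sl_spectrum (sl_sub p i0)"
      by (simp add: p_sub spec ev(2) h_def[symmetric])
    from sl_eigenvalue_eq_enumeration[OF \<gamma>(2)[OF \<mu>2] this]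
    have new: "sl_eigenvalue (sl_sub p i0) n = (ev(m := \<mu>)) n" for n .
    have other: "sl_eigenvalue (sl_sub p i) n = sl_eigenvalue (sl_sub q i) n" if "i \<in> {1, 2}" "(i, n) \<noteq> (i0, m)" for i n
    proof (cases "i = i0")
      case True
      then show ?thesis using that new[of n] by (simp add: q_def sl_sub_eq ev_def h_def del: sl_sub.simps)
    next
      case False
      then have "i = 3 - i0" using that(1) i0 by auto
      then have "sl_spectrum (sl_sub p i) = sl_spectrum (sl_sub q i)"
        using spec(2) unfolding p_sub unfolding q_def sl_sub_eq k_def by simp
      then show ?thesis by (simp add: sl_eigenvalue_def)
    qed
    have "dist p q = norm (t0, t1, t1, abs_l2 f)" by (simp add: dist_norm p_def q_def)
    also have "\<dots> \<le> \<bar>t0\<bar> + (\<bar>t1\<bar> + (\<bar>t1\<bar> + norm (abs_l2 f)))"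
      using norm_Pair_le[of t0 "(t1, t1, abs_l2 f)"] norm_Pair_le[of t1 "(t1, abs_l2 f)"] norm_Pair_le[of t1 "abs_l2 f"]
      by simp
    also have "\<dots> \<le> 4 * (C * \<bar>\<mu> - ev m\<bar>)"
      using t norm_abs_l2_le[OF f, of "C * \<bar>\<mu> - ev m\<bar>"] fb by auto
    also have "\<dots> \<le> (4 * \<bar>C\<bar> + 1) * \<bar>\<mu> - ev m\<bar>"
      unfolding mult.assoc[symmetric] by (intro mult_right_mono) auto
    also have "\<dots> < e"
    proof -
      have "\<bar>\<mu> - ev m\<bar> < e / (4 * \<bar>C\<bar> + 1)" using \<mu> by (simp add: \<delta>_def)
      then show ?thesis by (simp add: pos_less_divide_eq mult.commute)
    qed
    finally have "dist p q < e" .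
    then show "\<exists>p. dist p q < e \<and> sl_eigenvalue (sl_sub p i0) m = \<mu> \<and>
      (\<forall>i\<in>{1, 2}. \<forall>n. (i, n) \<noteq> (i0, m) \<longrightarrow> sl_eigenvalue (sl_sub p i) n = sl_eigenvalue (sl_sub q i) n)"
      using new[of m] other by (intro exI[of _ p]) auto
  qed
qed


theorem theorem2p2:
  fixes H0 H1 H2 h0 h1 h2 :: real
    and Q q :: l2
    and I :: "(nat \<times> nat) set"
    and w :: "nat \<times> nat \<Rightarrow> real"
  assumes "I \<subseteq> {1, 2} \<times> UNIV"
    and "\<And>i n. (i, n) \<in> I \<Longrightarrow> w (i, n) > 0"
    and "h1 \<noteq> h2"
    and "finite I \<or> w summable_on I"
  shows "\<not> (sl_functional I w (H0, H1, H2, Q) (h0, h1, h2, q) > 0 \<and>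
             (\<forall>\<^sub>F p in nhds (h0, h1, h2, q).
                sl_functional I w (H0, H1, H2, Q) (h0, h1, h2, q)
                  \<le> sl_functional I w (H0, H1, H2, Q) p)) \<and>
         (grad_functional I w (H0, H1, H2, Q) (h0, h1, h2, q) = 0 \<longleftrightarrow>
         sl_functional I w (H0, H1, H2, Q) (h0, h1, h2, q) = 0)"
proof -
  define qq QQ where "qq = (h0, h1, h2, q)" and "QQ = (H0, H1, H2, Q)"
  define d where "d p j = sl_eigenvalue (sl_sub p (fst j)) (snd j) - sl_eigenvalue (sl_sub QQ (fst j)) (snd j)" for p j
  define g where "g j = grad_eigenvalue qq (fst j) (snd j)" for j
  have wpos: "w j > 0" if "j \<in> I" for j using assms(2) that by (cases j) auto
  have fst_I: "fst j \<in> {1, 2}" if "j \<in> I" for j using assms(1) that by auto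
  have G: "sl_functional I w QQ p = (\<Sum>\<^sub>\<infinity>j\<in>I. w j * (d p j)\<^sup>2)" for p
    unfolding sl_functional_def d_def by (intro infsum_cong) auto
  have grad: "grad_functional I w QQ qq = 2 *\<^sub>R (\<Sum>\<^sub>\<infinity>j\<in>I. (w j * d qq j) *\<^sub>R g j)"
    unfolding grad_functional_def d_def g_def by (intro arg_cong[where f = "scaleR 2"] infsum_cong) auto
  have sumG: "(\<lambda>j. w j * (d p j)\<^sup>2) summable_on I" for p
  proof -
    obtain C where "\<forall>i n. \<bar>sl_eigenvalue (sl_sub p i) n - sl_eigenvalue (sl_sub QQ i) n\<bar> \<le> C"
      using eigenvalue_difference_bounded by blast
    then have "\<bar>d p j\<bar> \<le> C" for j by (simp add: d_def)
    then have "\<bar>(d p j)\<^sup>2\<bar> \<le> C * C" for j unfolding power2_eq_square by (intro abs_mult_le)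
    then show ?thesis by (intro summable_weighted(1)[OF assms(4) wpos]) auto
  qed
  have G0: "sl_functional I w QQ p = 0 \<longleftrightarrow> (\<forall>j\<in>I. d p j = 0)" for p
  proof
    assume "sl_functional I w QQ p = 0"
    then have "w j * (d p j)\<^sup>2 = 0" if "j \<in> I" for j
      using that wpos unfolding G by (intro nonneg_infsum_le_0D[OF _ sumG] mult_nonneg_nonneg less_imp_le[OF wpos]) auto
    then show "\<forall>j\<in>I. d p j = 0" using wpos by fastforce
  next
    assume "\<forall>j\<in>I. d p j = 0"
    then show "sl_functional I w QQ p = 0" unfolding G by (intro infsum_0) auto
  qed
  have grad0: "grad_functional I w QQ qq = 0 \<longleftrightarrow> (\<forall>j\<in>I. d qq j = 0)"
  proof
    assume "\<forall>j\<in>I. d qq j = 0"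
    then have "(\<Sum>\<^sub>\<infinity>j\<in>I. (w j * d qq j) *\<^sub>R g j) = 0" by (intro infsum_0) auto
    then show "grad_functional I w QQ qq = 0" by (simp add: grad)
  next
    assume zero: "grad_functional I w QQ qq = 0"
    obtain C where "\<forall>i n. \<bar>sl_eigenvalue (sl_sub qq i) n - sl_eigenvalue (sl_sub QQ i) n\<bar> \<le> C"
      using eigenvalue_difference_bounded by blast
    then have "\<bar>d qq j\<bar> \<le> C" for j by (simp add: d_def)
    then obtain s where s: "((\<lambda>j. (w j * d qq j) *\<^sub>R g j) has_sum s) I"
      using gradient_series_converges[OF assms(4) wpos, of "d qq" C h0 h1 h2 q] unfolding g_def qq_def by blast
    then have "s = 0" using zero infsumI[OF s] by (simp add: grad)
    show "\<forall>j\<in>I. d qq j = 0"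
    proof
      fix j0 assume j0: "j0 \<in> I"
      obtain D where D: "inner (g j0) D \<noteq> 0"
        and orth: "\<And>i n. i \<in> {1, 2} \<Longrightarrow> (i, n) \<noteq> (fst j0, snd j0) \<Longrightarrow> inner (grad_eigenvalue qq i n) D = 0"
        using eigenvalue_gradients_biorthogonal[OF assms(3) fst_I[OF j0], of h0 q "snd j0"]
        unfolding g_def qq_def by metis
      have "((\<lambda>j. inner ((w j * d qq j) *\<^sub>R g j) D) has_sum inner s D) I"
        by (rule has_sum_bounded_linear[OF bounded_linear_inner_left s])
      moreover have "((\<lambda>j. inner ((w j * d qq j) *\<^sub>R g j) D) has_sum inner ((w j0 * d qq j0) *\<^sub>R g j0) D) I"
      proof (rule has_sum_finite_neutralI[of "{j0}"])
        fix j assume "j \<in> I - {j0}"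
        then have "inner (g j) D = 0"
          unfolding g_def using fst_I[of j] by (intro orth) (auto simp: prod_eq_iff)
        then show "inner ((w j * d qq j) *\<^sub>R g j) D = 0" by simp
      qed (use j0 in auto)
      ultimately have "inner ((w j0 * d qq j0) *\<^sub>R g j0) D = 0"
        using has_sum_unique \<open>s = 0\<close> by fastforce
      then show "d qq j0 = 0" using D wpos[OF j0] by simp
    qed
  qed
  have "\<not> (\<forall>\<^sub>F p in nhds qq. sl_functional I w QQ qq \<le> sl_functional I w QQ p)"
    if Gpos: "sl_functional I w QQ qq > 0"
  proof
    assume "\<forall>\<^sub>F p in nhds qq. sl_functional I w QQ qq \<le> sl_functional I w QQ p"
    then obtain e where e: "e > 0" and min: "\<And>p. dist p qq < e \<Longrightarrow> sl_functional I w QQ qq \<le> sl_functional I w QQ p"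
      unfolding eventually_nhds_metric by blast
    obtain j0 where j0: "j0 \<in> I" "d qq j0 \<noteq> 0" using Gpos G0[of qq] by auto
    obtain i m where im: "j0 = (i, m)" by (cases j0)
    define l where "l = sl_eigenvalue (sl_sub qq i) m"
    define \<Lambda> where "\<Lambda> = sl_eigenvalue (sl_sub QQ i) m"
    have "l \<noteq> \<Lambda>" using j0 by (simp add: d_def im l_def \<Lambda>_def)
    have i: "i \<in> {1, 2}" using fst_I[OF j0(1)] by (simp add: im)
    from eigenvalue_perturbation[OF assms(3) i e, of h0 q m]
    obtain \<delta> where \<delta>: "\<delta> > 0" and pert: "\<forall>\<mu>. \<bar>\<mu> - l\<bar> < \<delta> \<longrightarrow> (\<exists>p. dist p qq < e \<and>
        sl_eigenvalue (sl_sub p i) m = \<mu> \<and>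
        (\<forall>i'\<in>{1, 2}. \<forall>n. (i', n) \<noteq> (i, m) \<longrightarrow> sl_eigenvalue (sl_sub p i') n = sl_eigenvalue (sl_sub qq i') n))"
      unfolding l_def qq_def by blast
    \<comment> \<open>a step from \<open>l\<close> towards the target value that does not overshoot it\<close>
    define s where "s = min (\<delta> / 2) \<bar>l - \<Lambda>\<bar>"
    define \<mu> where "\<mu> = (if l < \<Lambda> then l + s else l - s)"
    have s: "s > 0" "s < \<delta>" "s \<le> \<bar>l - \<Lambda>\<bar>" using \<delta> \<open>l \<noteq> \<Lambda>\<close> by (auto simp: s_def)
    have closer: "\<bar>\<mu> - \<Lambda>\<bar> < \<bar>l - \<Lambda>\<bar>" using s by (auto simp: \<mu>_def)
    have "\<bar>\<mu> - l\<bar> < \<delta>" using s by (auto simp: \<mu>_def)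
    then obtain p where p: "dist p qq < e" "sl_eigenvalue (sl_sub p i) m = \<mu>"
      and same: "\<And>i' n. i' \<in> {1, 2} \<Longrightarrow> (i', n) \<noteq> (i, m) \<Longrightarrow> sl_eigenvalue (sl_sub p i') n = sl_eigenvalue (sl_sub qq i') n"
      using pert by blast
    have less: "(d p j0)\<^sup>2 < (d qq j0)\<^sup>2"
      using power_strict_mono[OF closer abs_ge_zero, of 2] p(2) by (simp add: d_def im l_def \<Lambda>_def)
    have eq: "d p j = d qq j" if "j \<in> I" "j \<noteq> j0" for j
      unfolding d_def using same[of "fst j" "snd j"] fst_I[OF that(1)] that(2) by (auto simp: im prod_eq_iff)
    have "sl_functional I w QQ p < sl_functional I w QQ qq"
      unfolding G
    proof (rule has_sum_strict_mono[OF has_sum_infsum[OF sumG] has_sum_infsum[OF sumG] _ j0(1)])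
      show "w j * (d p j)\<^sup>2 \<le> w j * (d qq j)\<^sup>2" if "j \<in> I" for j
        using eq[OF that] less wpos[OF that] by (cases "j = j0") auto
      show "w j0 * (d p j0)\<^sup>2 < w j0 * (d qq j0)\<^sup>2"
        using less wpos[OF j0(1)] by simp
    qed
    then show False using min[OF p(1)] by simp
  qed
  then show ?thesis
    using grad0 G0[of qq] unfolding qq_def QQ_def by blast
qed

end
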